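(* Let $G$ be of type $B_n$, $\mathbf{i}_0=(1\,2\cdots n)^n$ and $c=(c^{(m)}_i)_{1\le i,m\le n}\in(\mathbb{C}^\times)^{n^2}$. Then $$\Delta_{w_0s_n\Lambda_n,\Lambda_n}(\Theta^-_{\mathbf{i}_0}(c))=\sum_{\delta\in\triangle_n\setminus\{\delta_l\}}\overline{m(\delta)},$$ where $\triangle_n$ is the set of triangles, $m(\delta)$ the Laurent monomial attached to $\delta$, $\delta_l$ the triangle with $j^{(l)}_k=k$ for all $k,l$, and $\overline{m(\delta)}$ is obtained from $m(\delta)$ by substituting $c^{(j)}_i\mapsto (c^{(n-j+1)}_i)^{-1}$.
   Context: Group side. $G$ is the simply connected simple algebraic group over $\mathbb{C}$ of type $B_n$ ($n\ge2$), $I=\{1,\dots,n\}$, with Chevalley generators $e_i,f_i,h_i$, simple roots $\alpha_i$, fundamental weights $\Lambda_i$, Cartan matrix $a_{ij}=\alpha_j(h_i)$: $a_{ii}=2$, $a_{n,n-1}=-2$, $a_{ij}=-1$ for other $|i-j|=1$, $0$ otherwise. $T$ is the maximal torus, $U^{\pm}$ the unipotent subgroups generated by $x_i(t)=\exp(te_i)$, resp. $y_i(t)=\exp(tf_i)$; $\alpha_i^\vee$ is the coroot one-parameter subgroup; $s_i$ are the simple reflections, $w_0$ the longest Weyl group element. $\overline{s}_i=x_i(-1)y_i(1)x_i(-1)$ and $\overline{w}=\overline{s}_{i_1}\cdots\overline{s}_{i_l}$ for any reduced expression $w=s_{i_1}\cdots s_{i_l}$. $\Delta_{\Lambda_i}$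 is the regular function on $G$ with $\Delta_{\Lambda_i}(u^-tu^+)=\Lambda_i(t)$ ($u^\pm\in U^\pm$, $t\in T$), and $\Delta_{u\Lambda_i,v\Lambda_i}(g)=\Delta_{\Lambda_i}(\overline{u}^{-1}g\,\overline{v})$ for Weyl group elements $u,v$. With $\mathbf{y}_i(c)=y_i(c)\alpha_i^\vee(c^{-1})$, $\Theta^-_{\mathbf{i}_0}(c)=\prod_{m=1}^{n}\mathbf{y}_1(c^{(m)}_1)\cdots\mathbf{y}_n(c^{(m)}_n)$ (factors for $m=1,\dots,n$ from left to right). Triangles. $\triangle_n$ is the set of integer arrays $\delta=(j^{(l)}_k)_{1\le k\le l\le n}$ with $1\le j^{(l+1)}_k\le j^{(l)}_k<j^{(l+1)}_{k+1}\le n+1$ for $1\le k\le l<n$. The $k$-th row of $\delta$ is $(j^{(k)}_k,j^{(k)}_{k-1},\dots,j^{(k)}_1)$; it always equals $(k+1,k,\dots,s+1,s-1,\dots,2,1)$ for a unique $s=s_k\in\{1,\dots,k+1\}$, and $s(\delta)=(s_1,\dots,s_n)$ is called the label of $\delta$. It satisfies $s_{k+1}\in\{s_k,s_k+1\}$. Put $s_0=1$ and $s_{n+1}=s_{n-1}+1$. The $k$-th row ($1\le k\le n$) is of type I if $s_k=s_{k-1}$, $s_{k+1}=s_k+1$; type II if $s_k=s_{k-1}$, $s_{k+1}=s_k$; type III if $s_k=s_{k-1}+1$, $s_{k+1}=s_k+1$; type IV if $s_k=s_{k-1}+1$, $s_{k+1}=s_k$. The monomial is $$m(\delta)=\prod_{i:\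 \text{row }i\text{ of type I}}c^{(s_i)}_i\ \prod_{i:\ \text{row }i\text{ of type IV}}(c^{(s_i)}_i)^{-1},$$ a Laurent monomial in variables $c^{(j)}_i$ ($i\in I$, $j\in\mathbb{Z}$). *)

theory Defs
  imports "HOL-Analysis.Analysis" "HOL-Algebra.Generated_Groups"
begin

section \<open>The simply connected group of type \<open>B\<^sub>n\<close>\<close>

text \<open>
  The simply connected simple algebraic group of type \<open>B\<^sub>n\<close> is described by its
  realisations as a Chevalley group: Chevalley generators \<open>e i\<close>, \<open>f i\<close>, \<open>h i\<close>
  (\<open>i = 1, \<dots>, n\<close>) acting on a finite-dimensional complex vector space \<open>V\<close> of arbitrary
  dimension, and the subgroup of \<open>GL(V)\<close> generated by the one-parameter subgroups
  \<open>exp (t e i)\<close> and \<open>exp (t f i)\<close>. Every faithful rational representation of the group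
  arises in this way.
\<close>

type_synonym 'v cmat = "complex^'v^'v"

definition mat_scale :: "complex \<Rightarrow> 'v::finite cmat \<Rightarrow> 'v cmat" where
  "mat_scale t A = (\<chi> r s. t * A $ r $ s)"

primrec mat_pow :: "'v::finite cmat \<Rightarrow> nat \<Rightarrow> 'v cmat" where
  "mat_pow A 0 = mat 1"
| "mat_pow A (Suc k) = A ** mat_pow A k"

text \<open>The multiplication of the type \<open>complex^'v^'v\<close> is not the matrix product, so the
  exponential of the library does not apply.\<close>

definition mat_exp :: "'v::finite cmat \<Rightarrow> 'v cmat" where
  "mat_exp A = (\<Sum>k. (1 / fact k) *\<^sub>R mat_pow A k)"

definition bracket :: "'v::finite cmat \<Rightarrow> 'v cmat \<Rightarrow> 'v cmat" where
  "bracket A B = A ** B - B ** A"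

definition mat_prod :: "'v::finite cmat list \<Rightarrow> 'v cmat" where
  "mat_prod As = foldr (**) As (mat 1)"

definition GL :: "('v::finite cmat) monoid" where
  "GL = \<lparr>carrier = {A. invertible A}, monoid.mult = (**), one = mat 1\<rparr>"

text \<open>\<open>cartan n i j\<close> is \<open>\<alpha>\<^sub>j(h\<^sub>i)\<close>; thus \<open>\<alpha>\<^sub>n\<close> is the short simple root.\<close>

definition cartan :: "nat \<Rightarrow> nat \<Rightarrow> nat \<Rightarrow> int" where
  "cartan n i j =
     (if i = j then 2
      else if i = n \<and> Suc j = n then -2
      else if i = Suc j \<or> j = Suc i then -1
      else 0)"

text \<open>The defining (Serre) relations of the simple Lie algebra of type \<open>B\<^sub>n\<close>.\<close>

definition chevalley_generators ::
  "nat \<Rightarrow> (nat \<Rightarrow> 'v::finite cmat) \<Rightarrow> (nat \<Rightarrow> 'v cmat) \<Rightarrow> (nat \<Rightarrow> 'v cmat) \<Rightarrow> bool" where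
  "chevalley_generators n e f h \<longleftrightarrow>
     (\<forall>i\<in>{1..n}. \<forall>j\<in>{1..n}.
        bracket (h i) (h j) = 0 \<and>
        bracket (h i) (e j) = mat_scale (of_int (cartan n i j)) (e j) \<and>
        bracket (h i) (f j) = mat_scale (of_int (- cartan n i j)) (f j) \<and>
        bracket (e i) (f j) = (if i = j then h i else 0) \<and>
        (i \<noteq> j \<longrightarrow>
           (bracket (e i) ^^ nat (1 - cartan n i j)) (e j) = 0 \<and>
           (bracket (f i) ^^ nat (1 - cartan n i j)) (f j) = 0))"

definition one_param :: "(nat \<Rightarrow> 'v::finite cmat) \<Rightarrow> nat \<Rightarrow> complex \<Rightarrow> 'v cmat" where
  "one_param e i t = mat_exp (mat_scale t (e i))"

text \<open>The coroot \<open>\<alpha>\<^sub>i\<^sup>\<or>\<close> is the homomorphism from the nonzero complex numbers with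
  \<open>\<alpha>\<^sub>i\<^sup>\<or>(exp z) = exp (z h\<^sub>i)\<close>. Since \<open>h i\<close> is diagonalisable with integer
  eigenvalues in every finite-dimensional representation, the choice of the branch of the
  logarithm is irrelevant.\<close>

definition coroot :: "(nat \<Rightarrow> 'v::finite cmat) \<Rightarrow> nat \<Rightarrow> complex \<Rightarrow> 'v cmat" where
  "coroot h i t = mat_exp (mat_scale (Ln t) (h i))"

definition unipotent :: "nat \<Rightarrow> (nat \<Rightarrow> 'v::finite cmat) \<Rightarrow> 'v cmat set" where
  "unipotent n e = generate GL {one_param e i t |i t. i \<in> {1..n}}"

definition torus :: "nat \<Rightarrow> (nat \<Rightarrow> 'v::finite cmat) \<Rightarrow> 'v cmat set" where
  "torus n h = generate GL {coroot h i t |i t. i \<in> {1..n} \<and> t \<noteq> 0}"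

definition chevalley_group ::
  "nat \<Rightarrow> (nat \<Rightarrow> 'v::finite cmat) \<Rightarrow> (nat \<Rightarrow> 'v cmat) \<Rightarrow> 'v cmat set" where
  "chevalley_group n e f =
     generate GL ({one_param e i t |i t. i \<in> {1..n}} \<union> {one_param f i t |i t. i \<in> {1..n}})"

definition coroot_prod :: "nat \<Rightarrow> (nat \<Rightarrow> 'v::finite cmat) \<Rightarrow> (nat \<Rightarrow> complex) \<Rightarrow> 'v cmat" where
  "coroot_prod n h \<tau> = mat_prod (map (\<lambda>i. coroot h i (\<tau> i)) [1..<Suc n])"

text \<open>Simply connected: the cocharacter lattice of the maximal torus is spanned by the simple
  coroots, i.e. \<open>(\<tau>\<^sub>1, \<dots>, \<tau>\<^sub>n) \<mapsto> \<Prod>\<^sub>i \<alpha>\<^sub>i\<^sup>\<or>(\<tau>\<^sub>i)\<close>, which always maps onto the torus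
  with finite kernel, is injective. Equivalently, all fundamental weights are characters of
  the torus. The condition also excludes the trivial representation.\<close>

definition simply_connected_B ::
  "nat \<Rightarrow> (nat \<Rightarrow> 'v::finite cmat) \<Rightarrow> (nat \<Rightarrow> 'v cmat) \<Rightarrow> (nat \<Rightarrow> 'v cmat) \<Rightarrow> bool" where
  "simply_connected_B n e f h \<longleftrightarrow>
     chevalley_generators n e f h \<and>
     (\<forall>\<tau>. (\<forall>i\<in>{1..n}. \<tau> i \<noteq> 0) \<and> coroot_prod n h \<tau> = mat 1 \<longrightarrow> (\<forall>i\<in>{1..n}. \<tau> i = 1))"

text \<open>The fundamental weight \<open>\<Lambda>\<^sub>i\<close> as a character of the torus; it is determined by
  \<open>\<Lambda>\<^sub>i(\<alpha>\<^sub>j\<^sup>\<or>(t))\<close> being \<open>t\<close> for \<open>j = i\<close> and \<open>1\<close> otherwise.\<close>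

definition fund_weight :: "nat \<Rightarrow> (nat \<Rightarrow> 'v::finite cmat) \<Rightarrow> nat \<Rightarrow> 'v cmat \<Rightarrow> complex" where
  "fund_weight n h i t =
     (THE z. \<exists>\<tau>. (\<forall>j\<in>{1..n}. \<tau> j \<noteq> 0) \<and> t = coroot_prod n h \<tau> \<and> z = \<tau> i)"


section \<open>Regular functions and generalized minors\<close>

inductive_set mat_polynomials :: "('v::finite cmat \<Rightarrow> complex) set" where
  const: "(\<lambda>_. a) \<in> mat_polynomials"
| entry: "(\<lambda>A. A $ r $ s) \<in> mat_polynomials"
| add: "p \<in> mat_polynomials \<Longrightarrow> q \<in> mat_polynomials \<Longrightarrow> (\<lambda>A. p A + q A) \<in> mat_polynomials"
| mult: "p \<in> mat_polynomials \<Longrightarrow> q \<in> mat_polynomials \<Longrightarrow> (\<lambda>A. p A * q A) \<in> mat_polynomials"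

text \<open>For a Zariski closed subgroup of \<open>SL(V)\<close> (all \<open>e i\<close> and \<open>f i\<close> are nilpotent)
  the inverse of the determinant need not be adjoined.\<close>

definition regular_on :: "'v::finite cmat set \<Rightarrow> ('v cmat \<Rightarrow> complex) \<Rightarrow> bool" where
  "regular_on G F \<longleftrightarrow> (\<exists>p\<in>mat_polynomials. \<forall>g\<in>G. F g = p g)"

text \<open>\<open>\<Delta>\<close> is the function \<open>\<Delta>\<^bsub>\<Lambda>\<^sub>i\<^esub>\<close>. This determines \<open>\<Delta>\<close> on the group, because the
  open cell \<open>U\<^sup>- T U\<^sup>+\<close> is dense; its values elsewhere are irrelevant.\<close>

definition is_principal_minor ::
  "nat \<Rightarrow> (nat \<Rightarrow> 'v::finite cmat) \<Rightarrow> (nat \<Rightarrow> 'v cmat) \<Rightarrow> (nat \<Rightarrow> 'v cmat) \<Rightarrow>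
   nat \<Rightarrow> ('v cmat \<Rightarrow> complex) \<Rightarrow> bool" where
  "is_principal_minor n e f h i \<Delta> \<longleftrightarrow>
     regular_on (chevalley_group n e f) \<Delta> \<and>
     (\<forall>u\<in>unipotent n f. \<forall>t\<in>torus n h. \<forall>v\<in>unipotent n e.
        \<Delta> (u ** t ** v) = fund_weight n h i t)"

text \<open>The Weyl group acts on the weight lattice; the weight \<open>\<lambda>\<close> is the function
  \<open>j \<mapsto> \<lambda>(h\<^sub>j)\<close>, and \<open>s\<^sub>i \<lambda> = \<lambda> - \<lambda>(h\<^sub>i) \<alpha>\<^sub>i\<close>.\<close>

definition simple_refl :: "nat \<Rightarrow> nat \<Rightarrow> (nat \<Rightarrow> int) \<Rightarrow> (nat \<Rightarrow> int)" where
  "simple_refl n i l = (\<lambda>j. if j \<in> {1..n} then l j - l i * cartan n j i else l j)"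

definition word_elt :: "nat \<Rightarrow> nat list \<Rightarrow> (nat \<Rightarrow> int) \<Rightarrow> (nat \<Rightarrow> int)" where
  "word_elt n is = foldr (\<circ>) (map (simple_refl n) is) id"

definition weyl_group :: "nat \<Rightarrow> ((nat \<Rightarrow> int) \<Rightarrow> (nat \<Rightarrow> int)) set" where
  "weyl_group n = {word_elt n is |is. set is \<subseteq> {1..n}}"

definition weyl_length :: "nat \<Rightarrow> ((nat \<Rightarrow> int) \<Rightarrow> (nat \<Rightarrow> int)) \<Rightarrow> nat" where
  "weyl_length n w = (LEAST l. \<exists>is. set is \<subseteq> {1..n} \<and> word_elt n is = w \<and> length is = l)"

definition reduced_expr :: "nat \<Rightarrow> ((nat \<Rightarrow> int) \<Rightarrow> (nat \<Rightarrow> int)) \<Rightarrow> nat list \<Rightarrow> bool" where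
  "reduced_expr n w is \<longleftrightarrow>
     set is \<subseteq> {1..n} \<and> word_elt n is = w \<and> length is = weyl_length n w"

definition longest_elt :: "nat \<Rightarrow> (nat \<Rightarrow> int) \<Rightarrow> (nat \<Rightarrow> int)" where
  "longest_elt n =
     (THE w. w \<in> weyl_group n \<and> (\<forall>w'\<in>weyl_group n. weyl_length n w' \<le> weyl_length n w))"

definition refl_lift ::
  "(nat \<Rightarrow> 'v::finite cmat) \<Rightarrow> (nat \<Rightarrow> 'v cmat) \<Rightarrow> nat \<Rightarrow> 'v cmat" where
  "refl_lift e f i = one_param e i (-1) ** one_param f i 1 ** one_param e i (-1)"

text \<open>The product does not depend on the reduced expression.\<close>

definition weyl_lift ::
  "nat \<Rightarrow> (nat \<Rightarrow> 'v::finite cmat) \<Rightarrow> (nat \<Rightarrow> 'v cmat) \<Rightarrow>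
   ((nat \<Rightarrow> int) \<Rightarrow> (nat \<Rightarrow> int)) \<Rightarrow> 'v cmat" where
  "weyl_lift n e f w = mat_prod (map (refl_lift e f) (SOME is. reduced_expr n w is))"

text \<open>\<open>\<Delta>\<^bsub>u\<Lambda>\<^sub>i,v\<Lambda>\<^sub>i\<^esub>\<close> in terms of \<open>\<Delta> = \<Delta>\<^bsub>\<Lambda>\<^sub>i\<^esub>\<close>.\<close>

definition gen_minor ::
  "nat \<Rightarrow> (nat \<Rightarrow> 'v::finite cmat) \<Rightarrow> (nat \<Rightarrow> 'v cmat) \<Rightarrow> ('v cmat \<Rightarrow> complex) \<Rightarrow>
   ((nat \<Rightarrow> int) \<Rightarrow> (nat \<Rightarrow> int)) \<Rightarrow> ((nat \<Rightarrow> int) \<Rightarrow> (nat \<Rightarrow> int)) \<Rightarrow> 'v cmat \<Rightarrow> complex" where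
  "gen_minor n e f \<Delta> u v g = \<Delta> (matrix_inv (weyl_lift n e f u) ** g ** weyl_lift n e f v)"

definition y_bold ::
  "(nat \<Rightarrow> 'v::finite cmat) \<Rightarrow> (nat \<Rightarrow> 'v cmat) \<Rightarrow> nat \<Rightarrow> complex \<Rightarrow> 'v cmat" where
  "y_bold f h i t = one_param f i t ** coroot h i (inverse t)"

text \<open>\<open>\<Theta>\<^sup>-\<close> for the word \<open>(1 2 \<dots> n)\<^sup>n\<close>; here and below \<open>c m i\<close> is \<open>c\<^sup>(\<^sup>m\<^sup>)\<^sub>i\<close>.\<close>

definition Theta_minus ::
  "nat \<Rightarrow> (nat \<Rightarrow> 'v::finite cmat) \<Rightarrow> (nat \<Rightarrow> 'v cmat) \<Rightarrow> (nat \<Rightarrow> nat \<Rightarrow> complex) \<Rightarrow> 'v cmat" where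
  "Theta_minus n f h c =
     mat_prod (concat (map (\<lambda>m. map (\<lambda>i. y_bold f h i (c m i)) [1..<Suc n]) [1..<Suc n]))"


section \<open>Triangles and their monomials\<close>

text \<open>\<open>\<delta> l k\<close> is \<open>j\<^sup>(\<^sup>l\<^sup>)\<^sub>k\<close>. The value \<open>0\<close> outside the index range makes functions
  correspond bijectively to arrays.\<close>

definition triangles :: "nat \<Rightarrow> (nat \<Rightarrow> nat \<Rightarrow> nat) set" where
  "triangles n =
     {\<delta>. (\<forall>l k. \<not> (1 \<le> k \<and> k \<le> l \<and> l \<le> n) \<longrightarrow> \<delta> l k = 0) \<and>
          (\<forall>l k. 1 \<le> k \<and> k \<le> l \<and> l < n \<longrightarrow>
             1 \<le> \<delta> (Suc l) k \<and> \<delta> (Suc l) k \<le> \<delta> l k \<and>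
             \<delta> l k < \<delta> (Suc l) (Suc k) \<and> \<delta> (Suc l) (Suc k) \<le> n + 1)}"

definition lowest_triangle :: "nat \<Rightarrow> nat \<Rightarrow> nat \<Rightarrow> nat" where
  "lowest_triangle n = (\<lambda>l k. if 1 \<le> k \<and> k \<le> l \<and> l \<le> n then k else 0)"

definition row :: "(nat \<Rightarrow> nat \<Rightarrow> nat) \<Rightarrow> nat \<Rightarrow> nat list" where
  "row \<delta> k = map (\<delta> k) (rev [1..<Suc k])"

text \<open>The entries \<open>s\<^sub>k\<close> of the label, with the conventions for \<open>k = 0\<close> and \<open>k = n + 1\<close>.\<close>

definition row_label :: "(nat \<Rightarrow> nat \<Rightarrow> nat) \<Rightarrow> nat \<Rightarrow> nat" where
  "row_label \<delta> k =
     (THE s. s \<in> {1..k + 1} \<and> row \<delta> k = filter (\<lambda>x. x \<noteq> s) (rev [1..<k + 2]))"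

definition label :: "nat \<Rightarrow> (nat \<Rightarrow> nat \<Rightarrow> nat) \<Rightarrow> nat \<Rightarrow> nat" where
  "label n \<delta> k =
     (if k = 0 then 1
      else if k = n + 1 then row_label \<delta> (n - 1) + 1
      else row_label \<delta> k)"

definition type_I :: "nat \<Rightarrow> (nat \<Rightarrow> nat \<Rightarrow> nat) \<Rightarrow> nat \<Rightarrow> bool" where
  "type_I n \<delta> k \<longleftrightarrow>
     label n \<delta> k = label n \<delta> (k - 1) \<and> label n \<delta> (k + 1) = label n \<delta> k + 1"

definition type_IV :: "nat \<Rightarrow> (nat \<Rightarrow> nat \<Rightarrow> nat) \<Rightarrow> nat \<Rightarrow> bool" where
  "type_IV n \<delta> k \<longleftrightarrow>
     label n \<delta> k = label n \<delta> (k - 1) + 1 \<and> label n \<delta> (k + 1) = label n \<delta> k"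

text \<open>The Laurent monomial \<open>m(\<delta>)\<close>, evaluated at nonzero values of the variables.\<close>

definition tri_monomial ::
  "nat \<Rightarrow> (nat \<Rightarrow> nat \<Rightarrow> nat) \<Rightarrow> (nat \<Rightarrow> nat \<Rightarrow> complex) \<Rightarrow> complex" where
  "tri_monomial n \<delta> c =
     (\<Prod>i\<in>{i\<in>{1..n}. type_I n \<delta> i}. c (label n \<delta> i) i) *
     (\<Prod>i\<in>{i\<in>{1..n}. type_IV n \<delta> i}. inverse (c (label n \<delta> i) i))"

text \<open>The substitution \<open>c\<^sup>(\<^sup>j\<^sup>)\<^sub>i \<mapsto> (c\<^sup>(\<^sup>n\<^sup>-\<^sup>j\<^sup>+\<^sup>1\<^sup>)\<^sub>i)\<^sup>-\<^sup>1\<close>. Labels are at most \<open>n + 1\<close>, so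
  the subtraction is never truncated; the superscript \<open>0\<close> occurs only for the lowest triangle.\<close>

definition tri_monomial_bar ::
  "nat \<Rightarrow> (nat \<Rightarrow> nat \<Rightarrow> nat) \<Rightarrow> (nat \<Rightarrow> nat \<Rightarrow> complex) \<Rightarrow> complex" where
  "tri_monomial_bar n \<delta> c = tri_monomial n \<delta> (\<lambda>j i. inverse (c (n + 1 - j) i))"

end

theory Submission
  imports Defs "HOL-Complex_Analysis.Complex_Analysis"
begin

text \<open>
  A polynomial representing \<open>\<Delta>\<close> generates, under the derivations \<open>p \<mapsto> d/dt p (x exp (t A))\<close>,
  a highest weight module for the Lie algebra whose highest weight is \<open>\<Lambda>\<^sub>n\<close>; here the density of
  the open cell is used. This module is the spin module: it has weight vectors \<open>phi S\<close> indexed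
  by the set \<open>S \<subseteq> {1..n}\<close> of negative coordinates of the weight, and \<open>f\<^sub>i\<close> moves a minus sign from
  position \<open>i + 1\<close> to position \<open>i\<close>, respectively creates one at position \<open>n\<close>. Along a reduced word
  of \<open>w = w\<^sub>0 s\<^sub>n\<close> the lifts of the simple reflections carry \<open>phi {}\<close> to \<open>phi {1..n-1}\<close> without a
  sign, so \<open>phi S\<close> takes at the inverse of the lift of \<open>w\<close> the value \<open>1\<close> if \<open>S = {1..n-1}\<close> and \<open>0\<close>
  otherwise. Hence the minor is the coefficient of \<open>phi {1..n-1}\<close> in \<open>\<Theta>\<^sup>- phi {}\<close>, a sum over ways of
  creating and moving minus signs in \<open>n\<close> sweeps.

  Suppose that the first \<open>r\<close> sweeps create a minus sign and the next one does not. For a nonzero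
  contribution the \<open>m\<close>-th minus sign, \<open>m \<le> r\<close>, comes to rest at some \<open>q\<^sub>m\<close> and passes on to its final
  position \<open>m\<close> in the next sweep, and the later ones go to their final positions at once. The
  contributions thus correspond to \<open>q\<^sub>1 < \<dots> < q\<^sub>r\<close> with \<open>r < n\<close>, that is, to the proper subsets of
  \<open>{1..n}\<close>, and these are the sets of rows at which the label of a triangle other than \<open>\<delta>\<^sub>l\<close> increases.
\<close>

section \<open>Exponentials of matrices\<close>

text \<open>The space V is arbitrary, so the spin representation is not given by explicit matrices;
  all that is known is the value of the minor on the open cell. It yields a function invariant under
  the lower unipotent group on the left and the upper one on the right, of right weight Lambda_n.
  The relations with e_i and h_i then follow formally by commutation, but a Verma module satisfies
  the same ones. That f_i kills \<open>phi S\<close> when the result would leave the spin weights is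
  where the integration to the group enters: it rests on Liouville's theorem for entire functions
  along y_i. Left invariance serves another end, the values at the identity. Since Lambda_n is
  minuscule, e_i and f_i square to zero on the module, so their exponentials act by affine formulas.
  The reduced word behind a lift is an unspecified choice, hence the sign-free formula is proved for
  every reduced word.\<close>

lemma mat_scale_nth [simp]: "mat_scale t A $ r $ s = t * A $ r $ s"
  by (simp add: mat_scale_def)

lemma mat_scale_0 [simp]: "mat_scale 0 A = 0" "mat_scale t 0 = 0"
  by (simp_all add: vec_eq_iff)

lemma mat_scale_1 [simp]: "mat_scale 1 A = A"
  by (simp add: vec_eq_iff)

lemma mat_scale_minus [simp]: "mat_scale (- t) A = - mat_scale t A"
  by (simp add: vec_eq_iff)

lemma mat_scale_scale [simp]: "mat_scale s (mat_scale t A) = mat_scale (s * t) A"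
  by (simp add: vec_eq_iff)

lemma mat_scale_mult_left: "mat_scale t A ** B = mat_scale t (A ** B)"
  by (simp add: vec_eq_iff matrix_matrix_mult_def sum_distrib_left mult.assoc)

lemma mat_scale_mult_right: "A ** mat_scale t B = mat_scale t (A ** B)"
  by (simp add: vec_eq_iff matrix_matrix_mult_def sum_distrib_left mult.left_commute)

lemma mat_scale_distrib: "mat_scale t (A + B) = mat_scale t A + mat_scale t B"
  "mat_scale t (A - B) = mat_scale t A - mat_scale t B"
  "mat_scale t (- A) = - mat_scale t A"
  by (simp_all add: vec_eq_iff algebra_simps)

lemma matrix_diff_distrib:
  fixes A B C :: "'a::comm_ring_1^'v::finite^'v"
  shows "(A - B) ** C = A ** C - B ** C" "C ** (A - B) = C ** A - C ** B"
  by (simp_all add: vec_eq_iff matrix_matrix_mult_def sum_subtractf algebra_simps)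

lemma matrix_add_distrib:
  fixes A B C :: "'a::comm_ring_1^'v::finite^'v"
  shows "(A + B) ** C = A ** C + B ** C" "C ** (A + B) = C ** A + C ** B"
  by (simp_all add: vec_eq_iff matrix_matrix_mult_def sum.distrib algebra_simps)

lemma matrix_minus_mult:
  fixes A B :: "'a::comm_ring_1^'v::finite^'v"
  shows "(- A) ** B = - (A ** B)" "A ** (- B) = - (A ** B)"
  by (simp_all add: vec_eq_iff matrix_matrix_mult_def sum_negf)

lemma matrix_zero_mult [simp]:
  fixes A :: "'a::comm_ring_1^'v::finite^'v"
  shows "0 ** A = 0" "A ** 0 = 0"
  by (simp_all add: vec_eq_iff matrix_matrix_mult_def)

lemmas mat_algebra = mat_scale_mult_left mat_scale_mult_right mat_scale_distrib
  matrix_diff_distrib matrix_add_distrib matrix_minus_mult matrix_mul_assoc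

section \<open>Holomorphic matrix-valued curves, differentiated entry by entry\<close>

definition mderiv :: "(complex \<Rightarrow> 'v::finite cmat) \<Rightarrow> 'v cmat \<Rightarrow> complex \<Rightarrow> bool" where
  "mderiv X Y z \<longleftrightarrow> (\<forall>r s. ((\<lambda>w. X w $ r $ s) has_field_derivative Y $ r $ s) (at z))"

lemma mderiv_const: "mderiv (\<lambda>w. A) 0 z"
  by (simp add: mderiv_def)

lemma mderiv_add: "mderiv X X' z \<Longrightarrow> mderiv Y Y' z \<Longrightarrow> mderiv (\<lambda>w. X w + Y w) (X' + Y') z"
  by (auto simp: mderiv_def intro!: derivative_intros)

lemma mderiv_scale:
  "(g has_field_derivative g') (at z) \<Longrightarrow> mderiv (\<lambda>w. mat_scale (g w) A) (mat_scale g' A) z"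
  by (auto simp: mderiv_def intro!: derivative_eq_intros)

lemma mderiv_mult:
  assumes "mderiv X X' z" "mderiv Y Y' z"
  shows "mderiv (\<lambda>w. X w ** Y w) (X' ** Y z + X z ** Y') z"
  unfolding mderiv_def
proof (intro allI)
  fix r s
  have "((\<lambda>w. \<Sum>k\<in>UNIV. X w $ r $ k * Y w $ k $ s) has_field_derivative
      (\<Sum>k\<in>UNIV. X' $ r $ k * Y z $ k $ s + Y' $ k $ s * X z $ r $ k)) (at z)"
    using assms by (intro DERIV_sum DERIV_mult) (auto simp: mderiv_def)
  then show "((\<lambda>w. (X w ** Y w) $ r $ s) has_field_derivative
      (X' ** Y z + X z ** Y') $ r $ s) (at z)"
    by (simp add: matrix_matrix_mult_def sum.distrib mult.commute)
qed

lemma mderiv_chain: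
  assumes "mderiv X Y (g z)" "(g has_field_derivative g') (at z)"
  shows "mderiv (\<lambda>w. X (g w)) (mat_scale g' Y) z"
  unfolding mderiv_def
proof (intro allI)
  fix r s
  have "((\<lambda>w. X w $ r $ s) has_field_derivative Y $ r $ s) (at (g z))"
    using assms by (auto simp: mderiv_def)
  from DERIV_chain2[OF this assms(2)]
  show "((\<lambda>w. X (g w) $ r $ s) has_field_derivative mat_scale g' Y $ r $ s) (at z)"
    by (simp add: mult.commute)
qed

lemma mderiv_eq: "mderiv X Y z \<Longrightarrow> Y = Y' \<Longrightarrow> mderiv X Y' z"
  by simp

lemma mderiv_0_const:
  assumes "\<And>z. mderiv X 0 z"
  shows "X z = X w"
proof -
  have "X z $ r $ s = X w $ r $ s" for r s
  proof -
    have "\<exists>c. \<forall>x\<in>UNIV. X x $ r $ s = c"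
      by (rule has_field_derivative_zero_constant[OF convex_UNIV])
        (use assms in \<open>auto simp: mderiv_def\<close>)
    then show ?thesis by auto
  qed
  then show ?thesis by (simp add: vec_eq_iff)
qed

definition mexp :: "'v::finite cmat \<Rightarrow> complex \<Rightarrow> 'v cmat" where
  "mexp A z = mat_exp (mat_scale z A)"

lemma mat_pow_scale: "mat_pow (mat_scale z A) k = mat_scale (z ^ k) (mat_pow A k)"
  by (induction k) (simp_all add: mat_algebra mult.commute)

lemma mat_pow_commute: "mat_pow A k ** A = A ** mat_pow A k"
  by (induction k) (simp_all add: mat_algebra flip: matrix_mul_assoc)

text \<open>The sum of the moduli of all entries dominates every row sum, so it can serve as the
  ratio of a geometric bound. Comparison with the scalar exponential series then gives
  convergence.\<close>

lemma mat_pow_bound: "\<exists>C. \<forall>k r s. norm (mat_pow A k $ r $ s) \<le> C ^ k"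
proof -
  define C where "C = (\<Sum>r\<in>UNIV. \<Sum>t\<in>UNIV. norm (A $ r $ t))"
  have C: "(\<Sum>t\<in>UNIV. norm (A $ r $ t)) \<le> C" for r
    unfolding C_def by (rule member_le_sum) (auto intro: sum_nonneg)
  have C0: "0 \<le> C" unfolding C_def by (intro sum_nonneg) auto
  have "norm (mat_pow A k $ r $ s) \<le> C ^ k" for k r s
  proof (induction k arbitrary: r s)
    case 0
    then show ?case by (simp add: mat_def)
  next
    case (Suc k)
    have "norm (mat_pow A (Suc k) $ r $ s) \<le> (\<Sum>t\<in>UNIV. norm (A $ r $ t) * C ^ k)"
      unfolding mat_pow.simps matrix_matrix_mult_def vec_lambda_beta
      by (intro sum_norm_le) (simp add: norm_mult mult_left_mono Suc)
    also have "\<dots> \<le> C * C ^ k"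
      unfolding sum_distrib_right[symmetric] using C C0 by (intro mult_right_mono) auto
    finally show ?case by simp
  qed
  then show ?thesis by blast
qed

lemma summable_mat_pow: "summable (\<lambda>k. mat_pow A k $ r $ s / fact k * z ^ k)"
proof -
  obtain C where C: "\<And>k r s. norm (mat_pow A k $ r $ s) \<le> C ^ k"
    using mat_pow_bound by metis
  have "summable (\<lambda>k. (C * norm z) ^ k / fact k)"
    using summable_exp[of "C * norm z"] by (simp add: field_simps)
  then show ?thesis
  proof (rule summable_comparison_test'[where N = 0])
    fix k
    show "norm (mat_pow A k $ r $ s / fact k * z ^ k) \<le> (C * norm z) ^ k / fact k"
      using C[of k r s]
      by (simp add: norm_mult norm_divide norm_power power_mult_distrib divide_right_mono mult_right_mono)
  qed
qed

lemma sums_matI: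
  fixes L :: "complex^'v::finite^'v"
  assumes "\<And>r s. (\<lambda>k. g k $ r $ s) sums (L $ r $ s)"
  shows "g sums L"
  unfolding sums_def
  by (intro vec_tendstoI) (use assms in \<open>simp add: sums_def sum_component\<close>)

lemma mexp_nth: "mexp A z $ r $ s = (\<Sum>k. mat_pow A k $ r $ s / fact k * z ^ k)"
proof -
  define L where "L = (\<chi> r s. \<Sum>k. mat_pow A k $ r $ s / fact k * z ^ k)"
  have "(\<lambda>k. (1 / fact k) *\<^sub>R mat_pow (mat_scale z A) k) sums L"
  proof (rule sums_matI)
    fix r s
    have "(\<lambda>k. mat_pow A k $ r $ s / fact k * z ^ k) sums (L $ r $ s)"
      unfolding L_def vec_lambda_beta by (rule summable_sums) (rule summable_mat_pow)
    then show "(\<lambda>k. ((1 / fact k) *\<^sub>R mat_pow (mat_scale z A) k) $ r $ s) sums (L $ r $ s)"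
      by (simp add: mat_pow_scale scaleR_conv_of_real[where 'a = complex] field_simps)
  qed
  then have "mexp A z = L"
    unfolding mexp_def mat_exp_def by (rule sums_unique[symmetric])
  then show ?thesis by (simp add: L_def)
qed

lemma mexp_sums: "(\<lambda>k. mat_pow A k $ r $ s / fact k * z ^ k) sums (mexp A z $ r $ s)"
  unfolding mexp_nth using summable_mat_pow by (rule summable_sums)

lemma mexp_0 [simp]: "mexp A 0 = mat 1"
proof -
  have "mexp A 0 $ r $ s = mat 1 $ r $ s" for r s
    unfolding mexp_nth using powser_zero[of "\<lambda>k. mat_pow A k $ r $ s / fact k"] by simp
  then show ?thesis by (simp add: vec_eq_iff)
qed

lemma mexp_commute_gen: "mexp A z ** A = A ** mexp A z"
proof -
  have "(A ** mexp A z) $ r $ s = (mexp A z ** A) $ r $ s" for r s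
  proof -
    have 1: "(\<lambda>k. \<Sum>t\<in>UNIV. A $ r $ t * (mat_pow A k $ t $ s / fact k * z ^ k)) sums
        ((A ** mexp A z) $ r $ s)"
      unfolding matrix_matrix_mult_def vec_lambda_beta by (intro sums_sum sums_mult mexp_sums)
    have 2: "(\<lambda>k. \<Sum>t\<in>UNIV. (mat_pow A k $ r $ t / fact k * z ^ k) * A $ t $ s) sums
        ((mexp A z ** A) $ r $ s)"
      unfolding matrix_matrix_mult_def vec_lambda_beta by (intro sums_sum sums_mult2 mexp_sums)
    have "(\<Sum>t\<in>UNIV. A $ r $ t * (mat_pow A k $ t $ s / fact k * z ^ k)) =
        (\<Sum>t\<in>UNIV. (mat_pow A k $ r $ t / fact k * z ^ k) * A $ t $ s)" for k
    proof -
      have "(A ** mat_pow A k) $ r $ s = (mat_pow A k ** A) $ r $ s"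
        by (simp add: mat_pow_commute)
      then show ?thesis
        by (simp add: matrix_matrix_mult_def mult_ac sum_distrib_left[symmetric]
            sum_divide_distrib[symmetric] times_divide_eq_right[symmetric] del: times_divide_eq_right)
           (simp add: sum_distrib_left[symmetric] sum_divide_distrib[symmetric] mult_ac)
    qed
    then show ?thesis using sums_unique2[OF 1] 2 by simp
  qed
  then show ?thesis by (simp add: vec_eq_iff)
qed

lemma mexp_commute_gen': "B ** mexp A z ** A = B ** A ** mexp A z"
  by (simp add: mexp_commute_gen flip: matrix_mul_assoc)

lemma mderiv_mexp: "mderiv (mexp A) (A ** mexp A z) z"
  unfolding mderiv_def
proof (intro allI)
  fix r s
  let ?c = "\<lambda>k. mat_pow A k $ r $ s / fact k"
  have "((\<lambda>w. \<Sum>k. ?c k * w ^ k) has_field_derivative (\<Sum>k. diffs ?c k * z ^ k)) (at z)"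
    by (rule termdiffs_strong_converges_everywhere) (rule summable_mat_pow)
  moreover have "(\<lambda>k. diffs ?c k * z ^ k) sums ((A ** mexp A z) $ r $ s)"
  proof -
    have "(\<lambda>k. \<Sum>t\<in>UNIV. A $ r $ t * (mat_pow A k $ t $ s / fact k * z ^ k)) sums
        ((A ** mexp A z) $ r $ s)"
      unfolding matrix_matrix_mult_def vec_lambda_beta by (intro sums_sum sums_mult mexp_sums)
    moreover have "diffs ?c k * z ^ k = (\<Sum>t\<in>UNIV. A $ r $ t * (mat_pow A k $ t $ s / fact k * z ^ k))" for k
    proof -
      have "diffs ?c k = mat_pow A (Suc k) $ r $ s / fact k"
        by (simp add: diffs_def divide_simps del: of_nat_Suc mat_pow.simps)
      then show ?thesis
        by (simp add: matrix_matrix_mult_def sum_divide_distrib sum_distrib_right mult.assoc)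
    qed
    ultimately show ?thesis by simp
  qed
  ultimately show "((\<lambda>w. mexp A w $ r $ s) has_field_derivative (A ** mexp A z) $ r $ s) (at z)"
    by (simp add: mexp_nth sums_iff)
qed

lemma mderiv_mexp_chain:
  assumes "(g has_field_derivative g') (at z)"
  shows "mderiv (\<lambda>w. mexp A (g w)) (mat_scale g' (A ** mexp A (g z))) z"
  by (rule mderiv_chain[OF mderiv_mexp assms])

lemma mexp_minus [simp]: "mexp A z ** mexp A (- z) = mat 1" "mexp A (- z) ** mexp A z = mat 1"
proof -
  have *: "mexp A z ** mexp A (- z) = mat 1" for z
  proof -
    have "mderiv (\<lambda>z. mexp A z ** mexp A (- z)) 0 z" for z
      by (rule mderiv_eq[OF mderiv_mult[OF mderiv_mexp mderiv_mexp_chain[where g' = "-1"]]])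
         (auto intro!: derivative_eq_intros simp: mat_algebra mexp_commute_gen mexp_commute_gen')
    from mderiv_0_const[OF this, of z 0] show ?thesis by simp
  qed
  show "mexp A z ** mexp A (- z) = mat 1" "mexp A (- z) ** mexp A z = mat 1"
    using *[of z] *[of "- z"] by simp_all
qed

text \<open>Uniqueness for a linear differential equation: multiplying by the inverse exponential
  produces a curve of derivative zero. The reparametrisation \<open>g\<close> is needed for the
  factorisation in SL_2, where the parameter of one factor is not the variable itself.\<close>

lemma mexp_unique:
  assumes "\<And>z. mderiv X (mat_scale (g' z) (A ** X z)) z"
    and "\<And>z. (g has_field_derivative g' z) (at z)"
  shows "X z = mexp A (g z - g w) ** X w"
proof -
  let ?Y = "\<lambda>z. mexp A (- g z) ** X z"
  have "mderiv ?Y 0 z" for z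
    by (rule mderiv_eq[OF mderiv_mult[OF mderiv_mexp_chain[where g' = "- g' z"] assms(1)]])
       (auto intro!: derivative_eq_intros assms simp: mat_algebra mexp_commute_gen mexp_commute_gen')
  from mderiv_0_const[OF this, of z w] have *: "?Y z = ?Y w" .
  \<comment> \<open>The addition law proper is a consequence of this lemma, so the instance required
    here comes from a separate constancy argument in \<open>v\<close>.\<close>
  have add: "mexp A a = mexp A (v + a) ** mexp A (- v)" for a v
  proof -
    have "mderiv (\<lambda>v. mexp A (v + a) ** mexp A (- v)) 0 v" for v
      by (rule mderiv_eq[OF mderiv_mult[OF mderiv_mexp_chain[where g' = 1] mderiv_mexp_chain[where g' = "-1"]]])
         (auto intro!: derivative_eq_intros simp: mat_algebra mexp_commute_gen mexp_commute_gen')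
    from mderiv_0_const[OF this, of 0 v] show ?thesis by simp
  qed
  have "X z = mexp A (g z) ** ?Y z"
    by (simp add: matrix_mul_assoc)
  also have "\<dots> = mexp A (g z) ** mexp A (- g w) ** X w"
    by (simp add: * matrix_mul_assoc)
  also have "mexp A (g z) ** mexp A (- g w) = mexp A (g z - g w)"
    using add[of "g z - g w" "g w"] by simp
  finally show ?thesis .
qed

lemma mexp_add: "mexp A (z + w) = mexp A z ** mexp A w"
proof -
  have "mexp A (z + w) = mexp A (z - 0) ** mexp A (0 + w)"
    by (rule mexp_unique[where X = "\<lambda>z. mexp A (z + w)" and g = "\<lambda>z. z" and g' = "\<lambda>_. 1"])
       (auto intro!: derivative_eq_intros mderiv_eq[OF mderiv_mexp_chain[where g' = 1]])
  then show ?thesis by simp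
qed

lemma mexp_intertwine:
  fixes P A B :: "'v::finite cmat"
  assumes "P ** A = B ** P"
  shows "P ** mexp A z = mexp B z ** P"
proof -
  have "P ** mexp A z = mexp B (z - 0) ** (P ** mexp A 0)"
  proof (rule mexp_unique[where X = "\<lambda>z. P ** mexp A z" and g = "\<lambda>z. z" and g' = "\<lambda>_. 1"])
    fix z
    show "mderiv (\<lambda>z. P ** mexp A z) (mat_scale 1 (B ** (P ** mexp A z))) z"
      by (rule mderiv_eq[OF mderiv_mult[OF mderiv_const mderiv_mexp]])
         (simp add: mat_algebra assms)
  qed auto
  then show ?thesis by simp
qed

lemma mexp_commute: "A ** B = B ** A \<Longrightarrow> mexp A z ** mexp B w = mexp B w ** mexp A z"
  by (metis mexp_intertwine)

lemma mexp_scale: "mexp (mat_scale a A) z = mexp A (a * z)"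
  by (simp add: mexp_def mult.commute)

text \<open>The hypothesis is the Lax equation B' = [A, B], whose solution is conjugation of
  \<open>B 0\<close> by \<open>mexp A z\<close>. Adjoint actions are thus computed by writing down
  the curve and differentiating it.\<close>

lemma mexp_conj:
  assumes "\<And>z. mderiv B (A ** B z - B z ** A) z"
  shows "mexp A z ** B 0 = B z ** mexp A z"
proof -
  have "B z ** mexp A z = mexp A (z - 0) ** (B 0 ** mexp A 0)"
  proof (rule mexp_unique[where X = "\<lambda>z. B z ** mexp A z" and g = "\<lambda>z. z" and g' = "\<lambda>_. 1"])
    fix z
    show "mderiv (\<lambda>z. B z ** mexp A z) (mat_scale 1 (A ** (B z ** mexp A z))) z"
      by (rule mderiv_eq[OF mderiv_mult[OF assms mderiv_mexp]])
         (simp add: mat_algebra)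
  qed auto
  then show ?thesis by simp
qed

section \<open>Relations in the group \<open>SL\<^sub>2\<close>\<close>

lemma bracket_eqD:
  "bracket A B = C \<Longrightarrow> A ** B = B ** A + C"
  by (auto simp: bracket_def)

lemma mexp_sl2_h:
  assumes "bracket h e = mat_scale a e"
  shows "mexp h z ** e = mat_scale (exp (a * z)) e ** mexp h z"
proof -
  have "mexp h z ** mat_scale (exp (a * 0)) e = mat_scale (exp (a * z)) e ** mexp h z"
  proof (rule mexp_conj)
    fix z
    have "mderiv (\<lambda>z. mat_scale (exp (a * z)) e) (mat_scale (exp (a * z) * a) e) z"
      by (intro mderiv_scale) (auto intro!: derivative_eq_intros)
    then show "mderiv (\<lambda>z. mat_scale (exp (a * z)) e)
      (h ** mat_scale (exp (a * z)) e - mat_scale (exp (a * z)) e ** h) z"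
      by (rule mderiv_eq) (simp add: mat_algebra bracket_eqD[OF assms])
  qed
  then show ?thesis by simp
qed

lemma mexp_f_h:
  assumes "bracket h f = mat_scale (-2) f"
  shows "mexp f z ** h = (h + mat_scale (2 * z) f) ** mexp f z"
proof -
  have "mexp f z ** (h + mat_scale (2 * 0) f) = (h + mat_scale (2 * z) f) ** mexp f z"
  proof (rule mexp_conj)
    fix z
    have "mderiv (\<lambda>z. h + mat_scale (2 * z) f) (0 + mat_scale 2 f) z"
      by (intro mderiv_add mderiv_const mderiv_scale) (auto intro!: derivative_eq_intros)
    then show "mderiv (\<lambda>z. h + mat_scale (2 * z) f)
      (f ** (h + mat_scale (2 * z) f) - (h + mat_scale (2 * z) f) ** f) z"
      by (rule mderiv_eq) (simp add: mat_algebra bracket_eqD[OF assms])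
  qed
  then show ?thesis by simp
qed

text \<open>The adjoint action of exp(z f) on e; it is quadratic in \<open>z\<close> because the
  third power of ad f kills e.\<close>

lemma mexp_f_e:
  assumes "bracket h f = mat_scale (-2) f" "bracket e f = h"
  shows "mexp f z ** e = (e + (mat_scale (- z) h + mat_scale (- (z\<^sup>2)) f)) ** mexp f z"
proof -
  have "mexp f z ** (e + (mat_scale (- 0) h + mat_scale (- (0\<^sup>2)) f)) =
      (e + (mat_scale (- z) h + mat_scale (- (z\<^sup>2)) f)) ** mexp f z"
  proof (rule mexp_conj)
    fix z
    have "mderiv (\<lambda>z. e + (mat_scale (- z) h + mat_scale (- (z\<^sup>2)) f))
        (0 + (mat_scale (- 1) h + mat_scale (- 2 * z) f)) z"
      by (intro mderiv_add mderiv_const mderiv_scale) (auto intro!: derivative_eq_intros)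
    then show "mderiv (\<lambda>z. e + (mat_scale (- z) h + mat_scale (- (z\<^sup>2)) f))
      (f ** (e + (mat_scale (- z) h + mat_scale (- (z\<^sup>2)) f)) -
       (e + (mat_scale (- z) h + mat_scale (- (z\<^sup>2)) f)) ** f) z"
      by (rule mderiv_eq)
         (simp add: mat_algebra bracket_eqD[OF assms(1)] bracket_eqD[OF assms(2)], 
          simp add: vec_eq_iff algebra_simps)
  qed
  then show ?thesis by simp
qed

text \<open>The Gauss factorisation of x(s) y(t) in SL_2 with 1 + s t = exp z. With \<open>z\<close>
  as the variable no logarithm occurs, and both sides solve the same differential equation in the
  parameter s = (exp z - 1) / t.\<close>

lemma sl2_factor_exp:
  assumes he: "bracket h e = mat_scale 2 e" and hf: "bracket h f = mat_scale (-2) f"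
    and ef: "bracket e f = h" and t: "t \<noteq> 0"
  shows "mexp e ((exp z - 1) / t) ** mexp f t =
    mexp f (t * exp (- z)) ** mexp h z ** mexp e ((1 - exp (- z)) / t)"
proof -
  let ?R = "\<lambda>z. mexp f (t * exp (- z)) ** mexp h z ** mexp e ((1 - exp (- z)) / t)"
  have "?R z = mexp e ((exp z - 1) / t - (exp 0 - 1) / t) ** ?R 0"
  proof (rule mexp_unique[where X = ?R])
    fix z
    show "((\<lambda>z. (exp z - 1) / t) has_field_derivative exp z / t) (at z)"
      using t by (auto intro!: derivative_eq_intros)
    define a where "a = t * exp (- z)"
    let ?Y = "mexp f a" and ?H = "mexp h z" and ?X = "mexp e ((1 - exp (- z)) / t)"
    have "mderiv ?R ((mat_scale (- a) (f ** ?Y) ** ?H + ?Y ** mat_scale 1 (h ** ?H)) ** ?X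
        + (?Y ** ?H) ** mat_scale (exp (- z) / t) (e ** ?X)) z"
      unfolding a_def
      by (intro mderiv_mult mderiv_mexp_chain)
         (use t in \<open>auto intro!: derivative_eq_intros simp: a_def\<close>)
    then show "mderiv ?R (mat_scale (exp z / t) (e ** ?R z)) z"
    proof (rule mderiv_eq)
      \<comment> \<open>The derivative has h and e in the middle of the product. Moving them to the
        left past \<open>?Y\<close> creates multiples of h and f that cancel, and only the multiple
        of e required by the equation remains.\<close>
      have Yh: "?Y ** h = h ** ?Y + mat_scale (2 * a) (f ** ?Y)"
        by (simp add: mexp_f_h[OF hf] mat_algebra)
      have Ye: "?Y ** e = e ** ?Y + (mat_scale (- a) (h ** ?Y) + mat_scale (- (a\<^sup>2)) (f ** ?Y))"
        by (simp add: mexp_f_e[OF hf ef] mat_algebra)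
      have "?Y ** ?H ** e = mat_scale (exp (2 * z)) (?Y ** e ** ?H)"
        using mexp_sl2_h[OF he, of z] by (simp add: mat_algebra flip: matrix_mul_assoc)
      then have YHe: "?Y ** ?H ** e = mat_scale (exp (2 * z)) ((e ** ?Y + (mat_scale (- a) (h ** ?Y) + mat_scale (- (a\<^sup>2)) (f ** ?Y))) ** ?H)"
        by (simp only: Ye)
      have "exp z * exp (- z) = 1" "exp (- z) * exp z = 1" by (simp_all flip: exp_add)
      then have sc: "exp (- z) / t * exp (2 * z) = exp z / t" "exp z / t * a = 1"
          "exp z / t * (a * a) = a"
        using t by (simp_all add: a_def exp_double power2_eq_square)
      have "mat_scale (exp (- z) / t) (?Y ** ?H ** e) = mat_scale (exp z / t) (e ** ?Y ** ?H) +
          (mat_scale (- (exp z / t * a)) (h ** ?Y ** ?H) + mat_scale (- (exp z / t * (a * a))) (f ** ?Y ** ?H))"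
        unfolding YHe mat_algebra mat_scale_scale sc(1)[symmetric]
        by (simp add: vec_eq_iff power2_eq_square mult.assoc)
      then have K: "mat_scale (exp (- z) / t) (?Y ** ?H ** e) = mat_scale (exp z / t) (e ** ?Y ** ?H) +
          (- (h ** ?Y ** ?H) - mat_scale a (f ** ?Y ** ?H))"
        unfolding sc by simp
      have "(mat_scale (- a) (f ** ?Y) ** ?H + ?Y ** mat_scale 1 (h ** ?H)) ** ?X
        + (?Y ** ?H) ** mat_scale (exp (- z) / t) (e ** ?X) =
        (- mat_scale a (f ** ?Y ** ?H) + ?Y ** h ** ?H + mat_scale (exp (- z) / t) (?Y ** ?H ** e)) ** ?X"
        by (simp add: mat_algebra)
      also have "- mat_scale a (f ** ?Y ** ?H) + ?Y ** h ** ?H + mat_scale (exp (- z) / t) (?Y ** ?H ** e) =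
          mat_scale (exp z / t) (e ** ?Y ** ?H)"
        unfolding K Yh mat_algebra by (simp add: vec_eq_iff)
      also have "\<dots> ** ?X = mat_scale (exp z / t) (e ** (?Y ** ?H ** ?X))"
        by (simp add: mat_algebra)
      finally have "(mat_scale (- a) (f ** ?Y) ** ?H + ?Y ** mat_scale 1 (h ** ?H)) ** ?X
        + (?Y ** ?H) ** mat_scale (exp (- z) / t) (e ** ?X) =
         mat_scale (exp z / t) (e ** (?Y ** ?H ** ?X))" .
      then show "(mat_scale (- a) (f ** ?Y) ** ?H + ?Y ** mat_scale 1 (h ** ?H)) ** ?X
        + (?Y ** ?H) ** mat_scale (exp (- z) / t) (e ** ?X) = mat_scale (exp z / t) (e ** ?R z)"
        by (simp add: a_def)
    qed
  qed
  then show ?thesis by simp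
qed

lemma sl2_factor:
  assumes "bracket h e = mat_scale 2 e" "bracket h f = mat_scale (-2) f" "bracket e f = h"
    and "1 + s * t \<noteq> 0"
  shows "mexp e s ** mexp f t =
    mexp f (t / (1 + s * t)) ** mexp h (Ln (1 + s * t)) ** mexp e (s / (1 + s * t))"
proof (cases "t = 0")
  case False
  have "1 - inverse (1 + s * t) = s * t / (1 + s * t)"
    using assms(4) by (simp add: field_simps)
  then have "(1 - inverse (1 + s * t)) / t = s / (1 + s * t)"
    using False by simp
  moreover have "(1 + s * t - 1) / t = s" "exp (Ln (1 + s * t)) = 1 + s * t"
    using assms(4) False by simp_all
  ultimately show ?thesis
    using sl2_factor_exp[OF assms(1-3) False, of "Ln (1 + s * t)"]
    by (simp only: exp_minus divide_inverse)
qed simp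

text \<open>The right side depends on \<open>z\<close> only through exp z. Hence exp(2 pi i h) is
  the identity without diagonalising h, and the torus lies in the group generated by the e and f
  exponentials.\<close>

lemma mexp_h_eq:
  assumes "bracket h e = mat_scale 2 e" "bracket h f = mat_scale (-2) f" "bracket e f = h"
  shows "mexp h z = mexp f (- exp (- z)) ** mexp e (exp z - 1) ** mexp f 1 ** mexp e (exp (- z) - 1)"
proof -
  have "mexp f (- exp (- z)) ** (mexp e (exp z - 1) ** mexp f 1) ** mexp e (exp (- z) - 1) =
     (mexp f (- exp (- z)) ** mexp f (exp (- z))) ** mexp h z **
     (mexp e (1 - exp (- z)) ** mexp e (- (1 - exp (- z))))"
    using sl2_factor_exp[OF assms, of 1 z] by (simp add: matrix_mul_assoc)
  then show ?thesis by (simp add: matrix_mul_assoc del: minus_diff_eq)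
qed

lemma mexp_h_cong:
  assumes "bracket h e = mat_scale 2 e" "bracket h f = mat_scale (-2) f" "bracket e f = h"
    and "exp z = exp w"
  shows "mexp h z = mexp h w"
  using assms(4) by (simp add: mexp_h_eq[OF assms(1-3)] exp_minus)

section \<open>Derivations of polynomials on matrices\<close>

lemma mat_polynomials_sum:
  "finite I \<Longrightarrow> (\<And>i. i \<in> I \<Longrightarrow> p i \<in> mat_polynomials) \<Longrightarrow> (\<lambda>A. \<Sum>i\<in>I. p i A) \<in> mat_polynomials"
  by (induction I rule: finite_induct) (auto intro: mat_polynomials.intros)

lemma mat_polynomials_cmult: "p \<in> mat_polynomials \<Longrightarrow> (\<lambda>A. c * p A) \<in> mat_polynomials"
  by (rule mat_polynomials.mult[OF mat_polynomials.const])

lemma mat_polynomials_diff: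
  assumes "p \<in> mat_polynomials" "q \<in> mat_polynomials"
  shows "(\<lambda>A. p A - q A) \<in> mat_polynomials"
  using mat_polynomials.add[OF assms(1) mat_polynomials_cmult[OF assms(2), of "-1"]] by simp

lemma mat_polynomials_translate:
  assumes "p \<in> mat_polynomials"
  shows "(\<lambda>A. p (P ** A ** Q)) \<in> mat_polynomials"
  using assms
proof induction
  case (entry r s)
  show ?case unfolding matrix_matrix_mult_def vec_lambda_beta
    by (intro mat_polynomials_sum mat_polynomials.mult mat_polynomials.const mat_polynomials.entry) auto
qed (auto intro: mat_polynomials.intros)

text \<open>\<open>F\<close> is a vector field on the space of matrices. The order of the
  quantifiers says that the derivative depends on the point alone, so it may be computed on any
  convenient curve with that velocity.\<close>

lemma mat_polynomials_deriv_ex: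
  assumes "p \<in> mat_polynomials"
  shows "\<exists>D. \<forall>X z. mderiv X (F (X z)) z \<longrightarrow> ((\<lambda>w. p (X w)) has_field_derivative D (X z)) (at z)"
  using assms
proof induction
  case (const a)
  show ?case by (rule exI[of _ "\<lambda>_. 0"]) simp
next
  case (entry r s)
  show ?case by (rule exI[of _ "\<lambda>x. F x $ r $ s"]) (simp add: mderiv_def)
next
  case (add p q)
  then obtain L M where "\<forall>X z. mderiv X (F (X z)) z \<longrightarrow> ((\<lambda>w. p (X w)) has_field_derivative L (X z)) (at z)"
    "\<forall>X z. mderiv X (F (X z)) z \<longrightarrow> ((\<lambda>w. q (X w)) has_field_derivative M (X z)) (at z)" by blast
  then show ?case by (intro exI[of _ "\<lambda>x. L x + M x"]) (auto intro!: DERIV_add)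
next
  case (mult p q)
  then obtain L M where "\<forall>X z. mderiv X (F (X z)) z \<longrightarrow> ((\<lambda>w. p (X w)) has_field_derivative L (X z)) (at z)"
    "\<forall>X z. mderiv X (F (X z)) z \<longrightarrow> ((\<lambda>w. q (X w)) has_field_derivative M (X z)) (at z)" by blast
  then show ?case by (intro exI[of _ "\<lambda>x. L x * q x + M x * p x"]) (auto intro!: DERIV_mult)
qed

text \<open>The left-invariant vector field of \<open>A\<close>. The straight line x + t x A has the
  same velocity at 0 as the curve x exp(t A), and needs no exponential.\<close>

definition rderiv :: "'v::finite cmat \<Rightarrow> ('v cmat \<Rightarrow> complex) \<Rightarrow> 'v cmat \<Rightarrow> complex" where
  "rderiv A p x = deriv (\<lambda>t. p (x + mat_scale t (x ** A))) 0"

lemma rderiv_chain: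
  assumes "p \<in> mat_polynomials" "mderiv X (X z ** A) z"
  shows "((\<lambda>w. p (X w)) has_field_derivative rderiv A p (X z)) (at z)"
proof -
  obtain D where D: "\<And>X z. mderiv X (X z ** A) z \<Longrightarrow>
      ((\<lambda>w. p (X w)) has_field_derivative D (X z)) (at z)"
    using mat_polynomials_deriv_ex[OF assms(1), of "\<lambda>x. x ** A"] by blast
  have "mderiv (\<lambda>t. X z + mat_scale t (X z ** A)) (0 + mat_scale 1 (X z ** A)) 0"
    by (intro mderiv_add mderiv_const mderiv_scale) (auto intro!: derivative_eq_intros)
  then have "((\<lambda>t. p (X z + mat_scale t (X z ** A))) has_field_derivative D (X z)) (at 0)"
    using D[of "\<lambda>t. X z + mat_scale t (X z ** A)" 0] by simp
  then have "rderiv A p (X z) = D (X z)"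
    unfolding rderiv_def by (rule DERIV_imp_deriv)
  then show ?thesis using D[OF assms(2)] by simp
qed

text \<open>The curve t -> x exp(t A) passes through every \<open>x\<close> with the right velocity,
  so a candidate that is correct along all such curves is correct at every point.\<close>

lemma rderiv_eqI:
  assumes "p \<in> mat_polynomials"
    and "\<And>X z. mderiv X (X z ** A) z \<Longrightarrow> ((\<lambda>w. p (X w)) has_field_derivative D (X z)) (at z)"
  shows "rderiv A p = D"
proof
  fix x
  have "mderiv (\<lambda>t. x ** mexp A t) (x ** mexp A 0 ** A) 0"
    by (rule mderiv_eq[OF mderiv_mult[OF mderiv_const mderiv_mexp]]) simp
  from DERIV_unique[OF rderiv_chain[OF assms(1) this] assms(2)[OF this]]
  show "rderiv A p x = D x" by simp
qed

lemma rderiv_const [simp]: "rderiv A (\<lambda>x. a) = (\<lambda>x. 0)"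
  by (rule rderiv_eqI) (auto intro: mat_polynomials.intros)

lemma rderiv_entry: "rderiv A (\<lambda>x. x $ r $ s) = (\<lambda>x. (x ** A) $ r $ s)"
  by (rule rderiv_eqI) (auto intro: mat_polynomials.intros simp: mderiv_def)

lemma rderiv_add:
  "p \<in> mat_polynomials \<Longrightarrow> q \<in> mat_polynomials \<Longrightarrow> rderiv A (\<lambda>x. p x + q x) = (\<lambda>x. rderiv A p x + rderiv A q x)"
  by (rule rderiv_eqI) (auto intro!: mat_polynomials.intros DERIV_add rderiv_chain)

lemma rderiv_mult:
  "p \<in> mat_polynomials \<Longrightarrow> q \<in> mat_polynomials \<Longrightarrow>
    rderiv A (\<lambda>x. p x * q x) = (\<lambda>x. rderiv A p x * q x + rderiv A q x * p x)"
  by (rule rderiv_eqI) (auto intro!: mat_polynomials.intros DERIV_mult rderiv_chain)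

lemma rderiv_cmult: "p \<in> mat_polynomials \<Longrightarrow> rderiv A (\<lambda>x. c * p x) = (\<lambda>x. c * rderiv A p x)"
  by (simp add: rderiv_mult mat_polynomials.const mult.commute)

lemma mat_polynomials_mult_entry:
  fixes A :: "'v::finite cmat"
  shows "(\<lambda>x. (x ** A) $ r $ s) \<in> mat_polynomials"
  using mat_polynomials_translate[OF mat_polynomials.entry, of "mat 1" A r s] by simp

lemma rderiv_poly: "p \<in> mat_polynomials \<Longrightarrow> rderiv A p \<in> mat_polynomials"
proof (induction rule: mat_polynomials.induct)
  case (const a)
  then show ?case by (simp add: mat_polynomials.const)
next
  case (entry r s)
  then show ?case by (simp add: rderiv_entry mat_polynomials_mult_entry)
next
  case (add p q)
  then show ?case by (simp add: rderiv_add mat_polynomials.add)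
next
  case (mult p q)
  then show ?case by (simp add: rderiv_mult mat_polynomials.add mat_polynomials.mult)
qed

lemma rderiv_mult_entry:
  fixes A B :: "'v::finite cmat"
  shows "rderiv A (\<lambda>x. (x ** B) $ r $ s) = (\<lambda>x. (x ** A ** B) $ r $ s)"
proof (rule rderiv_eqI[OF mat_polynomials_mult_entry])
  fix X :: "complex \<Rightarrow> 'v cmat" and z
  assume "mderiv X (X z ** A) z"
  from mderiv_mult[OF this mderiv_const[of B]]
  show "((\<lambda>w. (X w ** B) $ r $ s) has_field_derivative (X z ** A ** B) $ r $ s) (at z)"
    by (simp add: mderiv_def)
qed

text \<open>Both sides are derivations in \<open>p\<close>, so the identity is decided on the matrix
  entries. Differentiating right translations makes the assignment a homomorphism of Lie algebras,
  without a sign.\<close>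

lemma rderiv_bracket:
  "p \<in> mat_polynomials \<Longrightarrow> rderiv (bracket A B) p x = rderiv A (rderiv B p) x - rderiv B (rderiv A p) x"
proof (induction arbitrary: x rule: mat_polynomials.induct)
  case (entry r s)
  then show ?case
    by (simp add: rderiv_entry rderiv_mult_entry bracket_def matrix_diff_distrib matrix_mul_assoc)
next
  case (add p q)
  then show ?case by (simp add: rderiv_add rderiv_poly)
next
  case (mult p q)
  show ?case
    by (simp add: rderiv_mult rderiv_add rderiv_poly mat_polynomials.mult mult.IH mult.hyps)
       (simp add: algebra_simps)
qed simp

lemma rderiv_scale: "p \<in> mat_polynomials \<Longrightarrow> rderiv (mat_scale c A) p x = c * rderiv A p x"
proof (induction arbitrary: x rule: mat_polynomials.induct)
  case (entry r s)
  then show ?case by (simp add: rderiv_entry mat_scale_mult_right)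
next
  case (add p q)
  then show ?case by (simp add: rderiv_add algebra_simps)
next
  case (mult p q)
  then show ?case by (simp add: rderiv_mult algebra_simps)
qed simp

text \<open>Right derivations commute with left translations. This passes the left invariance of the
  minor on to all functions derived from it.\<close>

lemma rderiv_translate:
  fixes A :: "'v::finite cmat"
  assumes "p \<in> mat_polynomials"
  shows "rderiv A (\<lambda>x. p (P ** x)) = (\<lambda>x. rderiv A p (P ** x))"
proof (rule rderiv_eqI)
  show "(\<lambda>x. p (P ** x)) \<in> mat_polynomials"
    using mat_polynomials_translate[OF assms, of P "mat 1"] by simp
  fix X :: "complex \<Rightarrow> 'v cmat" and z
  assume "mderiv X (X z ** A) z"
  from mderiv_mult[OF mderiv_const[of P] this]
  have "mderiv (\<lambda>w. P ** X w) (P ** X z ** A) z" by (simp add: matrix_mul_assoc)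
  from rderiv_chain[OF assms this]
  show "((\<lambda>w. p (P ** X w)) has_field_derivative rderiv A p (P ** X z)) (at z)" .
qed

lemma mat_poly_mexp_deriv:
  assumes "p \<in> mat_polynomials"
  shows "((\<lambda>w. p (x ** mexp A w)) has_field_derivative rderiv A p (x ** mexp A z)) (at z)"
proof (rule rderiv_chain[OF assms])
  show "mderiv (\<lambda>w. x ** mexp A w) (x ** mexp A z ** A) z"
    by (rule mderiv_eq[OF mderiv_mult[OF mderiv_const mderiv_mexp]])
       (simp add: mexp_commute_gen flip: matrix_mul_assoc)
qed

text \<open>When the generating set contains the inverses of its elements, every generated element
  is a product of generators, so induction by left multiplication with one generator
  suffices.\<close>

lemma generate_GL_induct [consumes 2, case_names one mult]:
  assumes "x \<in> generate GL S" "\<And>s. s \<in> S \<Longrightarrow> \<exists>s'\<in>S. s ** s' = mat 1 \<and> s' ** s = mat 1"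
    and "P (mat 1)" "\<And>s x. s \<in> S \<Longrightarrow> x \<in> generate GL S \<Longrightarrow> P x \<Longrightarrow> P (s ** x)"
  shows "P x"
proof -
  \<comment> \<open>Carrying \<open>P\<close> along left multiplication by \<open>x\<close> is a
    claim that is stable under products of two generated elements, whereas \<open>P\<close> itself
    need not be.\<close>
  have "\<forall>y\<in>generate GL S. P y \<longrightarrow> P (x ** y)"
    using assms(1)
  proof induction
    case (inv s)
    obtain s' where s': "s' \<in> S" "s ** s' = mat 1" "s' ** s = mat 1" using assms(2) inv by blast
    have "inv\<^bsub>GL\<^esub> s = s'"
      unfolding m_inv_def
    proof (rule the_equality)
      show "s' \<in> carrier GL \<and> s \<otimes>\<^bsub>GL\<^esub> s' = \<one>\<^bsub>GL\<^esub> \<and> s' \<otimes>\<^bsub>GL\<^esub> s = \<one>\<^bsub>GL\<^esub>"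
        using s' by (auto simp: GL_def invertible_def)
      fix y assume "y \<in> carrier GL \<and> s \<otimes>\<^bsub>GL\<^esub> y = \<one>\<^bsub>GL\<^esub> \<and> y \<otimes>\<^bsub>GL\<^esub> s = \<one>\<^bsub>GL\<^esub>"
      then have "y ** s = mat 1" by (simp add: GL_def)
      then have "s' = (y ** s) ** s'" by simp
      also have "\<dots> = y" by (simp add: s' flip: matrix_mul_assoc)
      finally show "y = s'" by simp
    qed
    then show ?case using assms(4) s' by simp
  next
    case (eng a b)
    have "a ** (b ** y) = a \<otimes>\<^bsub>GL\<^esub> b ** y" for y by (simp add: GL_def matrix_mul_assoc)
    moreover have "b ** y \<in> generate GL S" if "y \<in> generate GL S" for y
      using generate.eng[OF eng(2) that] by (simp add: GL_def)
    ultimately show ?case using eng by metis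
  qed (use assms(3,4) in \<open>auto simp: GL_def\<close>)
  moreover have "mat 1 \<in> generate GL S" using generate.one[of GL S] by (simp add: GL_def)
  ultimately show ?thesis using assms(3) by (metis matrix_mul_rid)
qed

lemma generate_GL_mult: "x \<in> generate GL S \<Longrightarrow> y \<in> generate GL S \<Longrightarrow> x ** y \<in> generate GL S"
  using generate.eng[of x GL S y] by (simp add: GL_def)

lemma generate_GL_one: "mat 1 \<in> generate GL S"
  using generate.one[of GL S] by (simp add: GL_def)

lemma generate_GL_incl: "s \<in> S \<Longrightarrow> s \<in> generate GL S"
  by (rule generate.incl)

section \<open>The open cell\<close>

locale chevalley_B =
  fixes n :: nat and e f h :: "nat \<Rightarrow> 'v::finite cmat"
  assumes n2: "n \<ge> 2" and gens: "chevalley_generators n e f h"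
begin

abbreviation "G \<equiv> chevalley_group n e f"
abbreviation "Um \<equiv> unipotent n f"
abbreviation "Up \<equiv> unipotent n e"
abbreviation "T \<equiv> torus n h"

lemma brackets:
  assumes "i \<in> {1..n}" "j \<in> {1..n}"
  shows "bracket (h i) (h j) = 0" "bracket (h i) (e j) = mat_scale (of_int (cartan n i j)) (e j)"
    "bracket (h i) (f j) = mat_scale (- of_int (cartan n i j)) (f j)"
    "bracket (e i) (f j) = (if i = j then h i else 0)"
    "i \<noteq> j \<Longrightarrow> cartan n i j = 0 \<Longrightarrow> bracket (f i) (f j) = 0"
proof -
  have *: "bracket (h i) (h j) = 0 \<and>
        bracket (h i) (e j) = mat_scale (of_int (cartan n i j)) (e j) \<and>
        bracket (h i) (f j) = mat_scale (of_int (- cartan n i j)) (f j) \<and>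
        bracket (e i) (f j) = (if i = j then h i else 0) \<and>
        (i \<noteq> j \<longrightarrow>
           (bracket (e i) ^^ nat (1 - cartan n i j)) (e j) = 0 \<and>
           (bracket (f i) ^^ nat (1 - cartan n i j)) (f j) = 0)"
    using gens assms unfolding chevalley_generators_def by blast
  from * show "bracket (h i) (h j) = 0" "bracket (h i) (e j) = mat_scale (of_int (cartan n i j)) (e j)"
    "bracket (h i) (f j) = mat_scale (- of_int (cartan n i j)) (f j)"
    "bracket (e i) (f j) = (if i = j then h i else 0)" by (simp_all del: mat_scale_minus)
  show "bracket (f i) (f j) = 0" if "i \<noteq> j" "cartan n i j = 0"
    using * that by simp
qed

lemma sl2:
  assumes "i \<in> {1..n}"
  shows "bracket (h i) (e i) = mat_scale 2 (e i)" "bracket (h i) (f i) = mat_scale (-2) (f i)"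
    "bracket (e i) (f i) = h i"
  using brackets[OF assms assms] by (simp_all add: cartan_def)

lemma one_param_eq: "one_param x i t = mexp (x i) t"
  by (simp add: one_param_def mexp_def)

lemma coroot_eq: "coroot h i t = mexp (h i) (Ln t)"
  by (simp add: coroot_def mexp_def)

lemma coroot_exp: "i \<in> {1..n} \<Longrightarrow> coroot h i (exp z) = mexp (h i) z"
  unfolding coroot_eq by (rule mexp_h_cong[OF sl2]) auto

lemma coroot_mult:
  assumes "i \<in> {1..n}" "s \<noteq> 0" "t \<noteq> 0"
  shows "coroot h i s ** coroot h i t = coroot h i (s * t)"
proof -
  have "coroot h i s ** coroot h i t = coroot h i (exp (Ln s + Ln t))"
    by (simp only: coroot_exp[OF assms(1)] mexp_add) (simp add: coroot_eq)
  then show ?thesis using assms by (simp add: exp_add)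
qed

lemma coroot_1 [simp]: "coroot h i 1 = mat 1"
  by (simp add: coroot_eq)

lemma mexp_h_commute:
  "i \<in> {1..n} \<Longrightarrow> j \<in> {1..n} \<Longrightarrow> mexp (h i) z ** mexp (h j) w = mexp (h j) w ** mexp (h i) z"
  using brackets(1)[of i j] by (intro mexp_commute) (simp add: bracket_def)

section \<open>Membership and induction for the group, the torus and the unipotent subgroups\<close>

lemma Up_X: "i \<in> {1..n} \<Longrightarrow> mexp (e i) t \<in> Up"
  unfolding unipotent_def by (rule generate_GL_incl) (auto simp: one_param_eq)

lemma Um_Y: "i \<in> {1..n} \<Longrightarrow> mexp (f i) t \<in> Um"
  unfolding unipotent_def by (rule generate_GL_incl) (auto simp: one_param_eq)

lemma T_coroot: "i \<in> {1..n} \<Longrightarrow> t \<noteq> 0 \<Longrightarrow> coroot h i t \<in> T"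
  unfolding torus_def by (rule generate_GL_incl) auto

lemma T_H: "i \<in> {1..n} \<Longrightarrow> mexp (h i) z \<in> T"
  using T_coroot[of i "exp z"] by (simp add: coroot_exp)

lemma G_X: "i \<in> {1..n} \<Longrightarrow> mexp (e i) t \<in> G"
  unfolding chevalley_group_def by (rule generate_GL_incl) (auto simp: one_param_eq)

lemma G_Y: "i \<in> {1..n} \<Longrightarrow> mexp (f i) t \<in> G"
  unfolding chevalley_group_def by (rule generate_GL_incl) (auto simp: one_param_eq)

lemma mult_closed:
  "x \<in> G \<Longrightarrow> y \<in> G \<Longrightarrow> x ** y \<in> G" "x \<in> Up \<Longrightarrow> y \<in> Up \<Longrightarrow> x ** y \<in> Up"
  "x \<in> Um \<Longrightarrow> y \<in> Um \<Longrightarrow> x ** y \<in> Um" "x \<in> T \<Longrightarrow> y \<in> T \<Longrightarrow> x ** y \<in> T"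
  by (simp_all add: chevalley_group_def unipotent_def torus_def generate_GL_mult)

lemma one_closed [simp, intro]: "mat 1 \<in> G" "mat 1 \<in> Up" "mat 1 \<in> Um" "mat 1 \<in> T"
  by (simp_all add: chevalley_group_def unipotent_def torus_def generate_GL_one)

lemma G_H: "i \<in> {1..n} \<Longrightarrow> mexp (h i) z \<in> G"
  using mexp_h_eq[OF sl2, of i z] by (simp add: mult_closed(1) G_X G_Y)

lemma unipotent_inverse_closed:
  "s \<in> {one_param x i t |i t. i \<in> {1..n}} \<Longrightarrow>
    \<exists>s'\<in>{one_param x i t |i t. i \<in> {1..n}}. s ** s' = mat 1 \<and> s' ** s = mat 1"
proof -
  assume "s \<in> {one_param x i t |i t. i \<in> {1..n}}"
  then obtain i t where i: "i \<in> {1..n}" "s = one_param x i t" by blast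
  then have "one_param x i (- t) \<in> {one_param x i t |i t. i \<in> {1..n}}" by blast
  then show ?thesis using i(2) by (intro bexI[of _ "one_param x i (- t)"]) (auto simp: one_param_eq)
qed

lemma unipotent_induct [consumes 1, case_names one mult]:
  assumes "v \<in> unipotent n x" "P (mat 1)"
    and "\<And>i t v. i \<in> {1..n} \<Longrightarrow> v \<in> unipotent n x \<Longrightarrow> P v \<Longrightarrow> P (mexp (x i) t ** v)"
  shows "P v"
  using assms(1) unfolding unipotent_def
  by (rule generate_GL_induct[OF _ unipotent_inverse_closed])
     (use assms(2,3) in \<open>auto simp: one_param_eq unipotent_def\<close>)

lemma torus_induct [consumes 1, case_names one mult]:
  assumes "t \<in> T" "P (mat 1)"
    and "\<And>i s t. i \<in> {1..n} \<Longrightarrow> s \<noteq> 0 \<Longrightarrow> t \<in> T \<Longrightarrow> P t \<Longrightarrow> P (coroot h i s ** t)"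
  shows "P t"
  using assms(1) unfolding torus_def
proof (rule generate_GL_induct)
  fix s assume "s \<in> {coroot h i t |i t. i \<in> {1..n} \<and> t \<noteq> 0}"
  then obtain i t where i: "i \<in> {1..n}" "t \<noteq> 0" "s = coroot h i t" by blast
  then have "coroot h i (inverse t) \<in> {coroot h i t |i t. i \<in> {1..n} \<and> t \<noteq> 0}"
    by (metis (mono_tags, lifting) inverse_nonzero_iff_nonzero mem_Collect_eq)
  then show "\<exists>s'\<in>{coroot h i t |i t. i \<in> {1..n} \<and> t \<noteq> 0}. s ** s' = mat 1 \<and> s' ** s = mat 1"
    using i by (intro bexI[of _ "coroot h i (inverse t)"]) (simp_all add: coroot_mult)
qed (use assms(2,3) in \<open>auto simp: torus_def\<close>)

lemma group_induct [consumes 1, case_names one e f]: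
  assumes "x \<in> G" "P (mat 1)"
    and e: "\<And>i t v. i \<in> {1..n} \<Longrightarrow> v \<in> G \<Longrightarrow> P v \<Longrightarrow> P (mexp (e i) t ** v)"
    and f: "\<And>i t v. i \<in> {1..n} \<Longrightarrow> v \<in> G \<Longrightarrow> P v \<Longrightarrow> P (mexp (f i) t ** v)"
  shows "P x"
  using assms(1) unfolding chevalley_group_def
proof (rule generate_GL_induct)
  let ?S = "{one_param e i t |i t. i \<in> {1..n}} \<union> {one_param f i t |i t. i \<in> {1..n}}"
  show "\<exists>s'\<in>?S. s ** s' = mat 1 \<and> s' ** s = mat 1" if "s \<in> ?S" for s
    using that unipotent_inverse_closed[of s e] unipotent_inverse_closed[of s f] by blast
  show "P (s ** y)" if "s \<in> ?S" "y \<in> generate GL ?S" "P y" for s y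
    using that e f unfolding chevalley_group_def by (auto simp: one_param_eq)
qed (rule assms(2))

lemma Up_G: "v \<in> Up \<Longrightarrow> v \<in> G"
  by (induction rule: unipotent_induct) (simp_all add: mult_closed G_X)

lemma Um_G: "v \<in> Um \<Longrightarrow> v \<in> G"
  by (induction rule: unipotent_induct) (simp_all add: mult_closed G_Y)

lemma T_G: "t \<in> T \<Longrightarrow> t \<in> G"
  by (induction rule: torus_induct) (simp_all add: mult_closed G_H coroot_eq)

section \<open>Commutation of the torus with the root subgroups\<close>

lemma H_X:
  "i \<in> {1..n} \<Longrightarrow> j \<in> {1..n} \<Longrightarrow>
    mexp (h i) z ** mexp (e j) s = mexp (e j) (exp (of_int (cartan n i j) * z) * s) ** mexp (h i) z"
  using mexp_intertwine[OF mexp_sl2_h[OF brackets(2)], of i j z s] by (simp add: mexp_scale)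

lemma H_Y:
  "i \<in> {1..n} \<Longrightarrow> j \<in> {1..n} \<Longrightarrow>
    mexp (h i) z ** mexp (f j) s = mexp (f j) (exp (- of_int (cartan n i j) * z) * s) ** mexp (h i) z"
  using mexp_intertwine[OF mexp_sl2_h[OF brackets(3)], of i j z s] by (simp add: mexp_scale)

lemma X_H:
  assumes "i \<in> {1..n}" "j \<in> {1..n}"
  shows "mexp (e j) s ** mexp (h i) z = mexp (h i) z ** mexp (e j) (exp (- of_int (cartan n i j) * z) * s)"
  using H_X[OF assms, of z "exp (- of_int (cartan n i j) * z) * s"]
  by (simp add: mult.assoc[symmetric] flip: exp_add)

lemma Up_coroot:
  assumes "i \<in> {1..n}" "v \<in> Up"
  shows "\<exists>v'\<in>Up. v ** coroot h i s = coroot h i s ** v'"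
  using assms(2)
proof (induction rule: unipotent_induct)
  case (mult j t v)
  then obtain v' where v': "v' \<in> Up" "v ** coroot h i s = coroot h i s ** v'" by blast
  let ?x = "mexp (e j) (exp (- of_int (cartan n i j) * Ln s) * t)"
  have "mexp (e j) t ** v ** coroot h i s = mexp (e j) t ** coroot h i s ** v'"
    using v'(2) by (simp flip: matrix_mul_assoc)
  also have "\<dots> = coroot h i s ** (?x ** v')"
    using X_H[OF assms(1) mult(1)] by (simp add: coroot_eq matrix_mul_assoc)
  finally show ?case using v' mult by (intro bexI[of _ "?x ** v'"]) (auto intro!: Up_X mult_closed)
qed (auto intro!: bexI[of _ "mat 1"])

lemma Up_T:
  assumes "t \<in> T" "v \<in> Up"
  shows "\<exists>v'\<in>Up. v ** t = t ** v'"
  using assms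
proof (induction arbitrary: v rule: torus_induct)
  case (mult i s t)
  then obtain v' where v': "v' \<in> Up" "v ** coroot h i s = coroot h i s ** v'" using Up_coroot by blast
  obtain v'' where v'': "v'' \<in> Up" "v' ** t = t ** v''" using mult.IH v'(1) by blast
  have "v ** (coroot h i s ** t) = coroot h i s ** (v' ** t)"
    using v'(2) by (simp add: matrix_mul_assoc)
  then show ?case using v'' by (auto simp: matrix_mul_assoc)
qed (auto intro!: bexI)

lemma T_Y:
  assumes "t \<in> T" "i \<in> {1..n}"
  shows "\<exists>s'. t ** mexp (f i) s = mexp (f i) s' ** t"
  using assms(1)
proof (induction rule: torus_induct)
  case (mult j r t)
  then obtain s' where s': "t ** mexp (f i) s = mexp (f i) s' ** t" by blast
  have "coroot h j r ** t ** mexp (f i) s = coroot h j r ** mexp (f i) s' ** t"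
    using s' by (simp flip: matrix_mul_assoc)
  then show ?case using H_Y[OF mult(1) assms(2)] by (auto simp: coroot_eq matrix_mul_assoc)
qed (auto intro: exI[of _ s])

lemma e_f_commute:
  "i \<in> {1..n} \<Longrightarrow> j \<in> {1..n} \<Longrightarrow> i \<noteq> j \<Longrightarrow> mexp (e i) s ** mexp (f j) t = mexp (f j) t ** mexp (e i) s"
  using brackets(4)[of i j] by (intro mexp_commute) (simp add: bracket_def)

text \<open>An element of U^+ is a product of factors x_j(a), past which y_i(s) is moved one by one.
  For j = i the SL_2 factorisation requires 1 + a s' to be nonzero, so the parameter must stay small
  throughout; this is why the bound \<eta> is arbitrary in the induction.\<close>

lemma Up_Y:
  assumes "v \<in> Up" "i \<in> {1..n}" "\<eta> > 0"
  shows "\<exists>\<epsilon>>0. \<forall>s. norm s < \<epsilon> \<longrightarrow> (\<exists>s' t v'. norm s' < \<eta> \<and> t \<in> T \<and> v' \<in> Up \<and>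
    v ** mexp (f i) s = mexp (f i) s' ** t ** v')"
  using assms(1,3)
proof (induction arbitrary: \<eta> rule: unipotent_induct)
  case one
  show ?case
  proof (intro exI[of _ \<eta>] conjI allI impI)
    fix s :: complex assume "norm s < \<eta>"
    then show "\<exists>s' t v'. norm s' < \<eta> \<and> t \<in> T \<and> v' \<in> Up \<and>
      mat 1 ** mexp (f i) s = mexp (f i) s' ** t ** v'"
      by (intro exI[of _ s] exI[of _ "mat 1"]) auto
  qed (fact one)
next
  case (mult j a v)
  \<comment> \<open>The second bound makes a s' smaller than 1/2, so 1 + a s' has modulus above 1/2
    and the new parameter s' / (1 + a s') is at most twice as large as s'. The first bound absorbs
    this factor 2.\<close>
  define \<eta>' where "\<eta>' = min (\<eta> / 2) (1 / (2 * (norm a + 1)))"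
  have \<eta>': "\<eta>' > 0" unfolding \<eta>'_def using mult.prems
    by (simp add: add_nonneg_pos)
  from mult.IH[OF \<eta>'] obtain \<epsilon> where \<epsilon>: "\<epsilon> > 0"
    "\<And>s. norm s < \<epsilon> \<Longrightarrow> \<exists>s' t v'. norm s' < \<eta>' \<and> t \<in> T \<and> v' \<in> Up \<and>
    v ** mexp (f i) s = mexp (f i) s' ** t ** v'" by blast
  show ?case
  proof (intro exI[of _ \<epsilon>] conjI allI impI)
    fix s :: complex assume "norm s < \<epsilon>"
    from \<epsilon>(2)[OF this] obtain s' t v' where *: "norm s' < \<eta>'" "t \<in> T" "v' \<in> Up"
      "v ** mexp (f i) s = mexp (f i) s' ** t ** v'" by blast
    have eq: "mexp (e j) a ** v ** mexp (f i) s = mexp (e j) a ** mexp (f i) s' ** t ** v'"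
      using *(4) by (simp flip: matrix_mul_assoc)
    have s': "norm s' < \<eta> / 2" "norm s' < 1 / (2 * (norm a + 1))" using *(1) by (simp_all add: \<eta>'_def)
    show "\<exists>s' t v'. norm s' < \<eta> \<and> t \<in> T \<and> v' \<in> Up \<and>
      mexp (e j) a ** v ** mexp (f i) s = mexp (f i) s' ** t ** v'"
    proof (cases "i = j")
      case False
      obtain w where w: "w \<in> Up" "mexp (e j) a ** t = t ** w"
        using Up_T[OF *(2) Up_X] mult by blast
      have "mexp (e j) a ** mexp (f i) s' ** t ** v' = mexp (f i) s' ** (mexp (e j) a ** t) ** v'"
        using e_f_commute[of j i a s'] False mult assms by (simp add: matrix_mul_assoc)
      also have "\<dots> = mexp (f i) s' ** t ** (w ** v')"
        using w by (simp add: matrix_mul_assoc)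
      finally have "mexp (e j) a ** mexp (f i) s' ** t ** v' = mexp (f i) s' ** t ** (w ** v')" .
      moreover have "norm s' < \<eta>" using s'(1) norm_ge_zero[of s'] by linarith
      ultimately show ?thesis unfolding eq using w(1) *(2,3) mult_closed(2) by blast
    next
      case True
      have "norm (a * s') < 1 / 2"
      proof -
        have "norm (a * s') \<le> (norm a + 1) * norm s'" by (simp add: norm_mult algebra_simps)
        also have "\<dots> < (norm a + 1) * (1 / (2 * (norm a + 1)))"
          using s'(2) by (intro mult_strict_left_mono) (auto simp: add_nonneg_pos)
        also have "\<dots> = 1 / 2" using norm_ge_zero[of a] by (simp add: field_simps add_nonneg_eq_0_iff)
        finally show ?thesis .
      qed
      then have half: "norm (1 + a * s') > 1 / 2"
        using norm_triangle_ineq4[of "1 + a * s'" "a * s'"] by simp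
      then have nz: "1 + a * s' \<noteq> 0" by auto
      let ?s = "s' / (1 + a * s')" and ?t = "mexp (h i) (Ln (1 + a * s'))" and ?a = "a / (1 + a * s')"
      have "norm ?s \<le> 2 * norm s'"
        using half nz divide_left_mono[of "1 / 2" "norm (1 + a * s')" "norm s'"]
        by (simp add: norm_divide mult.commute)
      then have s: "norm ?s < \<eta>" using s'(1) by simp
      obtain w where w: "w \<in> Up" "mexp (e j) ?a ** t = t ** w"
        using Up_T[OF *(2) Up_X] mult by blast
      have "mexp (e j) a ** mexp (f i) s' ** t ** v' = mexp (f i) ?s ** ?t ** (mexp (e j) ?a ** t) ** v'"
        using sl2_factor[OF sl2 nz, of i] assms True by (simp add: matrix_mul_assoc)
      also have "\<dots> = mexp (f i) ?s ** (?t ** t) ** (w ** v')"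
        using w by (simp add: matrix_mul_assoc)
      finally have "mexp (e j) a ** mexp (f i) s' ** t ** v' = mexp (f i) ?s ** (?t ** t) ** (w ** v')" .
      moreover have "?t ** t \<in> T" "w ** v' \<in> Up"
        using mult_closed(4)[OF T_H[OF assms(2)] *(2)] mult_closed(2)[OF w(1) *(3)] by auto
      ultimately show ?thesis unfolding eq using s by blast
    qed
  qed (fact \<epsilon>(1))
qed

definition cell :: "'v cmat set" where
  "cell = {u ** t ** v |u t v. u \<in> Um \<and> t \<in> T \<and> v \<in> Up}"

lemma cell_X: "x \<in> cell \<Longrightarrow> i \<in> {1..n} \<Longrightarrow> x ** mexp (e i) s \<in> cell"
proof -
  assume "x \<in> cell" and i: "i \<in> {1..n}"
  then obtain u t v where x: "x = u ** t ** v" "u \<in> Um" "t \<in> T" "v \<in> Up"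
    by (auto simp: cell_def)
  then have "x ** mexp (e i) s = u ** t ** (v ** mexp (e i) s)" by (simp add: matrix_mul_assoc)
  moreover have "v ** mexp (e i) s \<in> Up" using x(4) Up_X[OF i] by (rule mult_closed)
  ultimately show ?thesis using x(2,3) unfolding cell_def by blast
qed

lemma cell_Y:
  assumes "x \<in> cell" "i \<in> {1..n}"
  shows "\<exists>\<epsilon>>0. \<forall>s. norm s < \<epsilon> \<longrightarrow> x ** mexp (f i) s \<in> cell"
proof -
  obtain u t v where x: "x = u ** t ** v" "u \<in> Um" "t \<in> T" "v \<in> Up"
    using assms(1) by (auto simp: cell_def)
  obtain \<epsilon> where \<epsilon>: "\<epsilon> > 0" "\<And>s. norm s < \<epsilon> \<Longrightarrow> \<exists>s' t v'. norm s' < 1 \<and> t \<in> T \<and> v' \<in> Up \<and>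
    v ** mexp (f i) s = mexp (f i) s' ** t ** v'" using Up_Y[OF x(4) assms(2), of 1] by auto
  have "x ** mexp (f i) s \<in> cell" if small: "norm s < \<epsilon>" for s
  proof -
    obtain s' t' v' where *: "t' \<in> T" "v' \<in> Up" "v ** mexp (f i) s = mexp (f i) s' ** t' ** v'"
      using \<epsilon>(2)[OF small] by blast
    obtain s'' where s'': "t ** mexp (f i) s' = mexp (f i) s'' ** t" using T_Y[OF x(3) assms(2)] by blast
    have "x ** mexp (f i) s = u ** (t ** mexp (f i) s') ** t' ** v'"
      using *(3) x(1) by (simp add: matrix_mul_assoc) (simp flip: matrix_mul_assoc)
    also have "\<dots> = (u ** mexp (f i) s'') ** (t ** t') ** v'"
      by (simp add: s'' matrix_mul_assoc)
    finally show ?thesis unfolding cell_def using x * Um_Y[OF assms(2)] mult_closed(3,4) by blast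
  qed
  then show ?thesis using \<epsilon>(1) by blast
qed

lemma one_cell: "mat 1 \<in> cell"
  unfolding cell_def by (auto intro!: exI[of _ "mat 1"])

text \<open>The open cell is Zariski dense: its right translate by \<open>y\<^sub>i(s)\<close> stays inside for small
  \<open>s\<close>, and a polynomial along the curve \<open>s \<mapsto> x y\<^sub>i(s)\<close> is an entire function of \<open>s\<close>.\<close>

lemma cell_dense:
  assumes "p \<in> mat_polynomials" "\<And>x. x \<in> cell \<Longrightarrow> p x = 0" "g \<in> G"
  shows "p g = 0"
proof -
  have "\<forall>p\<in>mat_polynomials. (\<forall>x\<in>cell. p x = 0) \<longrightarrow> (\<forall>x\<in>cell. p (x ** g) = 0)"
    using assms(3)
  proof (induction rule: group_induct)
    case (e i t g)
    show ?case
    proof (intro ballI impI)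
      fix p x assume p: "p \<in> mat_polynomials" "\<forall>x\<in>cell. p x = 0" and x: "x \<in> cell"
      show "p (x ** (mexp (e i) t ** g)) = 0"
        using e(3) p cell_X[OF x e(1), of t] by (simp add: matrix_mul_assoc)
    qed
  next
    case (f i t g)
    show ?case
    proof (intro ballI impI)
      fix p x assume p: "p \<in> mat_polynomials" "\<forall>x\<in>cell. p x = 0" and x: "x \<in> cell"
      \<comment> \<open>The induction hypothesis applies to the translate by \<open>g\<close>: it
        vanishes on the cell, hence at x y_i(s) for all small \<open>s\<close>.\<close>
      let ?q = "\<lambda>x. p (x ** g)"
      have q: "?q \<in> mat_polynomials"
        using mat_polynomials_translate[OF p(1), of "mat 1" g] by simp
      have q0: "?q x = 0" if "x \<in> cell" for x using f(3) p that by blast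
      obtain \<epsilon> where \<epsilon>: "\<epsilon> > 0" "\<And>s. norm s < \<epsilon> \<Longrightarrow> x ** mexp (f i) s \<in> cell"
        using cell_Y[OF x f(1)] by blast
      have hol: "(\<lambda>s. ?q (x ** mexp (f i) s)) holomorphic_on UNIV"
        unfolding holomorphic_on_def field_differentiable_def
        using mat_poly_mexp_deriv[OF q] by blast
      have "?q (x ** mexp (f i) t) = 0"
        by (rule analytic_continuation_open[of "ball 0 \<epsilon>" UNIV "\<lambda>s. ?q (x ** mexp (f i) s)" "\<lambda>_. 0"])
           (use \<epsilon> hol q0 in auto)
      then show "p (x ** (mexp (f i) t ** g)) = 0" by (simp add: matrix_mul_assoc)
    qed
  qed simp
  then have "p (mat 1 ** g) = 0" using assms(1,2) one_cell by blast
  then show ?thesis by simp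
qed

end

section \<open>Transfer along the spin weights\<close>

text \<open>A set \<open>S \<subseteq> {1..n}\<close> encodes the weight \<open>\<Sum>\<^sub>k \<plusminus>\<epsilon>\<^sub>k / 2\<close> with minus signs at the positions in
  \<open>S\<close>; it is lowerable, respectively raisable, at \<open>i\<close> if its value on \<open>h\<^sub>i\<close> is \<open>1\<close>, respectively \<open>-1\<close>.\<close>

definition lowerable :: "nat \<Rightarrow> nat \<Rightarrow> nat set \<Rightarrow> bool" where
  "lowerable n i S \<longleftrightarrow> i \<notin> S \<and> (i = n \<or> Suc i \<in> S)"

definition raisable :: "nat \<Rightarrow> nat \<Rightarrow> nat set \<Rightarrow> bool" where
  "raisable n i S \<longleftrightarrow> i \<in> S \<and> (i = n \<or> Suc i \<notin> S)"

definition lowered :: "nat \<Rightarrow> nat \<Rightarrow> nat set \<Rightarrow> nat set" where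
  "lowered n i S = (if i = n then insert n S else insert i (S - {Suc i}))"

definition raised :: "nat \<Rightarrow> nat \<Rightarrow> nat set \<Rightarrow> nat set" where
  "raised n i S = (if i = n then S - {n} else insert (Suc i) (S - {i}))"

lemma lowered_subset: "S \<subseteq> {1..n} \<Longrightarrow> i \<in> {1..n} \<Longrightarrow> lowered n i S \<subseteq> {1..n}"
  by (auto simp: lowered_def)

text \<open>The contribution of row \<open>k\<close> to the substituted monomial when the label
  increases at the rows in \<open>Q\<close>: lowerable is type I, raisable is type IV, and the
  remaining types contribute nothing. The exponents are opposite to those in m because the
  substitution inverts the variables.\<close>

definition row_factor :: "nat \<Rightarrow> nat set \<Rightarrow> complex \<Rightarrow> nat \<Rightarrow> complex" where
  "row_factor n Q x k = (if lowerable n k Q then inverse x else if raisable n k Q then x else 1)"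

text \<open>The factors contributed to the monomial by the rows \<open>q, \<dots>, n\<close> of a triangle whose label
  increases at \<open>q\<close> and at the rows in \<open>R\<close>, when \<open>r\<close> sweeps are left. The value \<open>q = 0\<close> is the start of
  the process, with the convention \<open>c r 0 = 1\<close>.\<close>

definition path_weight :: "nat \<Rightarrow> (nat \<Rightarrow> nat \<Rightarrow> complex) \<Rightarrow> nat \<Rightarrow> nat \<Rightarrow> nat set \<Rightarrow> complex" where
  "path_weight n c r q R = (\<Prod>k\<in>{q..n}. row_factor n (insert q R) (c (r - card (R \<inter> {..k})) k) k)"

text \<open>With no increase after \<open>q\<close>, only row \<open>q\<close> (raisable) and row
  \<open>n\<close> (lowerable) are not neutral; for q = n they coincide and the row is
  raisable.\<close>

lemma path_weight_empty:
  "q \<le> n \<Longrightarrow> path_weight n c r q {} = (if q = n then c r n else c r q / c r n)"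
proof -
  assume q: "q \<le> n"
  show ?thesis
  proof (cases "q = n")
    case True
    then show ?thesis by (simp add: path_weight_def row_factor_def lowerable_def raisable_def)
  next
    case False
    with q have "{q..n} = insert q (insert n {Suc q..<n})" by auto
    moreover have "(\<Prod>k\<in>{Suc q..<n}. row_factor n {q} (c r k) k) = 1"
      by (rule prod.neutral) (auto simp: row_factor_def lowerable_def raisable_def)
    ultimately show ?thesis using False q
      by (simp add: path_weight_def) (auto simp: row_factor_def lowerable_def raisable_def field_simps)
  qed
qed

text \<open>From row \<open>q'\<close> on, the increase at \<open>q'\<close> is counted in every
  superscript, which accounts for the drop from \<open>Suc r\<close> to \<open>r\<close>. Of the
  rows before \<open>q'\<close> only the first and the last are not neutral.\<close>

lemma path_weight_insert:
  assumes "q < q'" "q' \<le> n" "R \<subseteq> {q' + 1..n}" "c (Suc r) q \<noteq> 0"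
  shows "path_weight n c (Suc r) q (insert q' R) =
    c (Suc r) q / c (Suc r) (q' - 1) * path_weight n c r q' R"
proof -
  have finR: "finite R" using assms(3) finite_subset by blast
  have R: "q' < x" if "x \<in> R" for x using that assms(3) by auto
  let ?Q = "insert q (insert q' R)"
  let ?F = "\<lambda>k. row_factor n ?Q (c (Suc r - card (insert q' R \<inter> {..k})) k) k"
  have "{q..n} = {q..<q'} \<union> {q'..n}" using assms by auto
  then have "path_weight n c (Suc r) q (insert q' R) = prod ?F ({q..<q'} \<union> {q'..n})"
    by (simp add: path_weight_def)
  also have "\<dots> = prod ?F {q..<q'} * prod ?F {q'..n}"
    by (rule prod.union_disjoint) auto
  also have "prod ?F {q'..n} = path_weight n c r q' R"
    unfolding path_weight_def
  proof (rule prod.cong[OF refl])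
    fix k assume k: "k \<in> {q'..n}"
    then have "insert q' R \<inter> {..k} = insert q' (R \<inter> {..k})" by auto
    moreover have "q' \<notin> R" using assms(3) by auto
    ultimately have "card (insert q' R \<inter> {..k}) = Suc (card (R \<inter> {..k}))" using finR by simp
    moreover have "row_factor n ?Q x k = row_factor n (insert q' R) x k" for x
      using k assms(1) by (auto simp: row_factor_def lowerable_def raisable_def)
    ultimately show "?F k = row_factor n (insert q' R) (c (r - card (R \<inter> {..k})) k) k" by simp
  qed
  also have "prod ?F {q..<q'} = (\<Prod>k\<in>{q..<q'}. row_factor n ?Q (c (Suc r) k) k)"
  proof (rule prod.cong[OF refl])
    fix k assume "k \<in> {q..<q'}"
    then have "insert q' R \<inter> {..k} = {}" using assms(3) by auto
    then show "?F k = row_factor n ?Q (c (Suc r) k) k" by simp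
  qed
  also have "\<dots> = c (Suc r) q / c (Suc r) (q' - 1)"
  proof (cases "q' = Suc q")
    \<comment> \<open>For consecutive increases row \<open>q\<close> is neutral and the quotient
      reads c / c, hence the hypothesis that this value is nonzero.\<close>
    case True
    then have "{q..<q'} = {q}" by auto
    then show ?thesis using True assms by (auto simp: row_factor_def lowerable_def raisable_def)
  next
    case False
    then have "{q..<q'} = insert q (insert (q' - 1) {Suc q..<q' - 1})" using assms by auto
    moreover have "(\<Prod>k\<in>{Suc q..<q' - 1}. row_factor n ?Q (c (Suc r) k) k) = 1"
    proof (intro prod.neutral ballI)
      fix k assume "k \<in> {Suc q..<q' - 1}"
      moreover from this have "k \<notin> R" "Suc k \<notin> R" by (auto dest: R)
      ultimately show "row_factor n ?Q (c (Suc r) k) k = 1"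
        using assms(2) by (auto simp: row_factor_def lowerable_def raisable_def)
    qed
    moreover have "row_factor n ?Q (c (Suc r) q) q = c (Suc r) q"
      using False assms by (auto simp: row_factor_def lowerable_def raisable_def)
    moreover have "q' - 1 \<notin> R" using R[of "q' - 1"] by linarith
    then have "row_factor n ?Q (c (Suc r) (q' - 1)) (q' - 1) = inverse (c (Suc r) (q' - 1))"
      using False assms \<open>q' - 1 \<notin> R\<close> by (auto simp: row_factor_def lowerable_def raisable_def)
    ultimately show ?thesis using False assms(1)
      by (simp add: divide_inverse)
  qed
  finally show ?thesis .
qed

text \<open>Nonempty subsets are sorted by their minimum \<open>q'\<close>. This is the shape of the
  recursion over sweeps, with \<open>q'\<close> the place where the next minus sign comes to
  rest.\<close>

lemma sum_subsets_min:
  fixes F :: "nat set \<Rightarrow> 'a::comm_monoid_add"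
  shows "(\<Sum>R | R \<subseteq> {q + 1..n} \<and> card R < Suc r. F R) =
    F {} + (\<Sum>q'\<in>{q + 1..n}. \<Sum>R | R \<subseteq> {q' + 1..n} \<and> card R < r. F (insert q' R))"
proof -
  let ?T = "\<lambda>q' r. {R. R \<subseteq> {q' + 1..n} \<and> card R < r}"
  have fin: "finite (?T q' r)" for q' r :: nat
    by (rule finite_subset[of _ "Pow {q' + 1..n}"]) auto
  have eq: "?T q (Suc r) = insert {} (\<Union>q'\<in>{q + 1..n}. insert q' ` ?T q' r)" (is "_ = insert {} ?U")
  proof (intro equalityI subsetI)
    fix R assume R: "R \<in> ?T q (Suc r)"
    then have finR: "finite R" using finite_subset by blast
    show "R \<in> insert {} ?U"
    proof (cases "R = {}")
      case False
      define m where "m = Min R"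
      have m: "m \<in> R" "\<And>x. x \<in> R \<Longrightarrow> m \<le> x" using False finR by (auto simp: m_def)
      have "R = insert m (R - {m})" using m by auto
      moreover have "R - {m} \<in> ?T m r"
      proof -
        have "card (R - {m}) < r" using R m finR by (simp add: card_Diff_singleton)
             (metis Suc_pred card_gt_0_iff empty_iff less_Suc_eq_le not_less_eq Suc_le_eq)
        moreover have "x \<in> {m + 1..n}" if "x \<in> R - {m}" for x
          using that m(2)[of x] R by fastforce
        ultimately show ?thesis by blast
      qed
      moreover have "m \<in> {q + 1..n}" using m R by auto
      ultimately show ?thesis by blast
    qed auto
  next
    fix R assume "R \<in> insert {} ?U"
    then consider "R = {}" | q' R' where "q' \<in> {q + 1..n}" "R' \<in> ?T q' r" "R = insert q' R'" by blast
    then show "R \<in> ?T q (Suc r)"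
    proof cases
      case 2
      then have "finite R'" using finite_subset by blast
      then have "card (insert q' R') \<le> Suc (card R')" by (simp add: card_insert_if)
      then show ?thesis using 2 by fastforce
    qed auto
  qed
  have "(\<Sum>R\<in>?T q (Suc r). F R) = F {} + sum F ?U"
    unfolding eq by (rule sum.insert) (use fin in auto)
  also have "sum F ?U = (\<Sum>q'\<in>{q + 1..n}. sum F (insert q' ` ?T q' r))"
  proof (rule sum.UNION_disjoint)
    show "\<forall>i\<in>{q + 1..n}. \<forall>j\<in>{q + 1..n}. i \<noteq> j \<longrightarrow> insert i ` ?T i r \<inter> insert j ` ?T j r = {}"
    proof (intro ballI impI)
      fix i j :: nat assume "i \<noteq> j"
      have "insert i R \<noteq> insert j R'" if "R \<in> ?T i r" "R' \<in> ?T j r" for R R'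
      proof
        assume eq: "insert i R = insert j R'"
        then have "i \<in> R'" "j \<in> R" using \<open>i \<noteq> j\<close> by auto
        then show False using that by fastforce
      qed
      then show "insert i ` ?T i r \<inter> insert j ` ?T j r = {}" by blast
    qed
  qed (use fin in auto)
  also have "\<dots> = (\<Sum>q'\<in>{q + 1..n}. \<Sum>R\<in>?T q' r. F (insert q' R))"
  proof (rule sum.cong[OF refl])
    fix q'
    have "inj_on (insert q') (?T q' r)"
    proof (rule inj_onI)
      fix R R' assume "R \<in> ?T q' r" "R' \<in> ?T q' r" "insert q' R = insert q' R'"
      moreover have "q' \<notin> R" "q' \<notin> R'" using calculation by auto
      ultimately show "R = R'" by (metis insert_ident)
    qed
    then show "sum F (insert q' ` ?T q' r) = (\<Sum>R\<in>?T q' r. F (insert q' R))"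
      by (simp add: sum.reindex)
  qed
  finally show ?thesis by simp
qed

text \<open>\<open>A r S\<close> is the coefficient of the target \<open>{1..<n}\<close> in the first \<open>r\<close> sweeps applied to the state \<open>S\<close>;
  \<open>B r j S\<close> is the same for the first \<open>r - 1\<close> sweeps followed by the letters \<open>1, \<dots>, j\<close> of the \<open>r\<close>-th. The
  letters act from the right, so that sweep \<open>n\<close> and in each sweep the letter \<open>n\<close> come first.\<close>

locale spin_transfer =
  fixes n :: nat and c :: "nat \<Rightarrow> nat \<Rightarrow> complex"
    and A :: "nat \<Rightarrow> nat set \<Rightarrow> complex" and B :: "nat \<Rightarrow> nat \<Rightarrow> nat set \<Rightarrow> complex"
  assumes n: "n \<ge> 1"
    and c0: "\<And>r. c r 0 = 1" and c_nz: "\<And>r j. r \<in> {1..n} \<Longrightarrow> j \<in> {1..n} \<Longrightarrow> c r j \<noteq> 0"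
    and A0: "\<And>S. S \<subseteq> {1..n} \<Longrightarrow> A 0 S = (if S = {1..<n} then 1 else 0)"
    and B0: "\<And>r S. r \<in> {1..n} \<Longrightarrow> S \<subseteq> {1..n} \<Longrightarrow> B r 0 S = A (r - 1) S"
    and Bn: "\<And>r S. r \<in> {1..n} \<Longrightarrow> S \<subseteq> {1..n} \<Longrightarrow> A r S = B r n S"
    and step: "\<And>r j S. r \<in> {1..n} \<Longrightarrow> j \<in> {1..n} \<Longrightarrow> S \<subseteq> {1..n} \<Longrightarrow>
      B r j S = (if lowerable n j S then inverse (c r j) * B r (j - 1) S + B r (j - 1) (lowered n j S)
        else if raisable n j S then c r j * B r (j - 1) S else B r (j - 1) S)"
begin

text \<open>A plus sign moves at most one position to the right in each sweep, so the plus sign at \<open>i\<close> is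
  still at a position \<open>< n\<close> in the end.\<close>

lemma dead_step:
  assumes "r \<in> {1..n}" "\<And>S i. S \<subseteq> {1..n} \<Longrightarrow> i \<notin> S \<Longrightarrow> 1 \<le> i \<Longrightarrow> i + r \<le> n \<Longrightarrow> A (r - 1) S = 0"
    and "j \<le> n" "S \<subseteq> {1..n}" "i \<notin> S" "1 \<le> i" "i + r + (if i \<le> j then 1 else 0) \<le> n"
  shows "B r j S = 0"
  using assms(3-)
proof (induction j arbitrary: S i)
  case 0
  then show ?case using assms(1) B0 assms(2)[of S i] by auto
next
  case (Suc j)
  have S1: "B r j S = 0"
    by (rule Suc.IH[of S i]) (use Suc.prems in \<open>auto split: if_splits\<close>)
  have "B r j (lowered n (Suc j) S) = 0"
  proof (cases "i = Suc j")
    case False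
    then show ?thesis using Suc.prems
      by (intro Suc.IH[of _ i] lowered_subset) (auto simp: lowered_def split: if_splits)
  next
    \<comment> \<open>The letter \<open>Suc j\<close> pushes the plus sign from \<open>i\<close> to
      \<open>Suc i\<close>, out of reach of the remaining letters of this sweep. The extra unit
      allowed for i at most j is now used up.\<close>
    case True
    then show ?thesis using Suc.prems assms(1)
      by (intro Suc.IH[of _ "Suc i"] lowered_subset) (auto simp: lowered_def split: if_splits)
  qed
  with S1 show ?case using step[of r "Suc j" S] Suc.prems assms(1) by simp
qed

lemma dead_A:
  "r \<le> n \<Longrightarrow> S \<subseteq> {1..n} \<Longrightarrow> i \<notin> S \<Longrightarrow> 1 \<le> i \<Longrightarrow> i + r < n \<Longrightarrow> A r S = 0"
proof (induction r arbitrary: S i)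
  case 0
  then have "S \<noteq> {1..<n}" by auto
  then show ?case using A0 0 by simp
next
  case (Suc r)
  have "B (Suc r) n S = 0"
    by (rule dead_step[of "Suc r" n S i]) (use Suc in auto)
  then show ?case using Bn[of "Suc r" S] Suc by simp
qed

lemma dead_B:
  assumes "r \<in> {1..n}" "j \<le> n" "S \<subseteq> {1..n}" "i \<notin> S" "1 \<le> i" "i + r + (if i \<le> j then 1 else 0) \<le> n"
  shows "B r j S = 0"
  by (rule dead_step[OF assms(1) _ assms(2-)]) (use assms(1) in \<open>auto intro!: dead_A\<close>)

text \<open>A plus sign only moves into a place occupied by a minus sign, so the one at \<open>m\<close> rests.\<close>

lemma dead_gap:
  assumes "1 \<le> m" "m + r \<le> n" "1 \<le> r" "S \<subseteq> {1..n}"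
  shows "j < n \<Longrightarrow> m \<le> Suc j \<Longrightarrow> S \<inter> {m..Suc j} = {} \<Longrightarrow> B r j S = 0"
proof (induction j)
  case 0
  then show ?case using assms by (intro dead_B[of _ _ _ m]) auto
next
  case (Suc j)
  show ?case
  proof (cases "Suc j < m")
    case True
    have "m \<notin> S" using Suc.prems by auto
    then show ?thesis using assms Suc.prems True by (intro dead_B[of _ _ _ m]) auto
  next
    case False
    then have "B r j S = 0" using Suc.prems by (intro Suc.IH) auto
    moreover have "Suc j \<notin> S" "Suc (Suc j) \<notin> S" using Suc.prems False by auto
    ultimately show ?thesis using step[of r "Suc j" S] Suc.prems assms
      by (auto simp: lowerable_def raisable_def)
  qed
qed

text \<open>Inside an initial block of minus signs every letter acts trivially, so the rest of the
  sweep is idle.\<close>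

lemma full:
  assumes "r \<in> {1..n}" "S \<subseteq> {1..n}"
  shows "j < n \<Longrightarrow> {1..Suc j} \<subseteq> S \<Longrightarrow> B r j S = A (r - 1) S"
proof (induction j)
  case 0
  then show ?case using B0 assms by auto
next
  case (Suc j)
  then have "Suc j \<in> S" "Suc (Suc j) \<in> S" by auto
  moreover have "B r j S = A (r - 1) S"
    by (rule Suc.IH) (use Suc.prems in \<open>auto simp: subset_iff\<close>)
  ultimately show ?case using step[of r "Suc j" S] Suc.prems assms
    by (auto simp: lowerable_def raisable_def)
qed

text \<open>Leaving the minus sign at \<open>Suc j\<close> would create a gap of plus signs starting
  at \<open>m\<close>, which \<open>dead_gap\<close> excludes. Its moves are therefore forced until
  it joins the block before \<open>m\<close>. The signs in \<open>Z\<close> lie beyond the reach of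
  the letters 1, ..., j.\<close>

lemma chain:
  assumes "1 \<le> m" "m + r = n" "1 \<le> r"
  shows "m \<le> Suc j \<Longrightarrow> j < n \<Longrightarrow> Z \<subseteq> {j + 2..n} \<Longrightarrow>
    B r j ({1..<m} \<union> {Suc j} \<union> Z) = A (r - 1) ({1..<Suc m} \<union> Z)"
proof (induction j)
  case 0
  then have "m = 1" using assms by simp
  moreover have "{1..<m} \<union> {Suc 0} \<union> Z \<subseteq> {1..n}" using 0 assms by (auto simp: subset_iff)
  ultimately show ?case using B0[of r "{1..<m} \<union> {Suc 0} \<union> Z"] 0 assms by auto
next
  case (Suc j)
  let ?S = "{1..<m} \<union> {Suc (Suc j)} \<union> Z"
  have S: "?S \<subseteq> {1..n}" using Suc.prems assms by auto
  show ?case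
  proof (cases "m = Suc (Suc j)")
    case True
    then have "{1..<m} \<union> {Suc (Suc j)} = {1..<Suc m}" by auto
    then show ?thesis using S assms Suc.prems True
      by (subst full) auto
  next
    case False
    have Z: "x \<in> Z \<Longrightarrow> j + 3 \<le> x" for x using Suc.prems by auto
    have 1: "Suc j \<notin> ?S" "Suc (Suc j) \<in> ?S" "Suc j \<noteq> n"
      using False Suc.prems by (auto dest: Z)
    have "B r j ?S = 0"
      by (rule dead_gap[of m]) (use assms Suc.prems False S in \<open>auto dest: Z\<close>)
    moreover have "lowered n (Suc j) ?S = {1..<m} \<union> {Suc j} \<union> Z"
      using 1 False Suc.prems by (auto simp: lowered_def dest: Z)
    moreover have "B r j ({1..<m} \<union> {Suc j} \<union> Z) = A (r - 1) ({1..<Suc m} \<union> Z)"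
      using Suc.prems False by (intro Suc.IH) auto
    ultimately show ?thesis
      using step[OF _ _ S, of r "Suc j"] Suc.prems assms 1 by (auto simp: lowerable_def)
  qed
qed

text \<open>In each remaining sweep a minus sign must be created at \<open>n\<close> and carried all
  the way to the end of the block. Moves have coefficient 1, so the total is 1.\<close>

lemma A_initial: "1 \<le> m \<Longrightarrow> m + r = n \<Longrightarrow> A r {1..<m} = 1"
proof (induction r arbitrary: m)
  case 0
  then show ?case by (subst A0) auto
next
  case (Suc r)
  have "B (Suc r) (n - 1) {1..<m} = 0"
    by (rule dead_gap[of m]) (use Suc.prems in auto)
  moreover have "B (Suc r) (n - 1) (insert n {1..<m}) = A r {1..<Suc m}"
    using chain[of m "Suc r" "n - 1" "{}"] Suc.prems by simp
  moreover have "A r {1..<Suc m} = 1" using Suc by (intro Suc.IH) auto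
  ultimately show ?case
    using Bn[of "Suc r" "{1..<m}"] step[of "Suc r" n "{1..<m}"] Suc.prems
    by (auto simp: lowerable_def lowered_def subset_iff)
qed

text \<open>After \<open>m\<close> sweeps that have each created a minus sign, the state is \<open>{1..<m} \<union> {q}\<close>; for \<open>m = 0\<close>
  the value \<open>q = 0\<close> stands for the empty state.\<close>

definition state :: "nat \<Rightarrow> nat \<Rightarrow> nat set" where
  "state m q = {1..<m} \<union> ({q} \<inter> {1..})"

text \<open>There are \<open>m\<close> sweeps behind and \<open>r\<close> ahead; the latest minus
  sign cannot rest to the left of its final place \<open>m\<close>.\<close>

definition valid_state :: "nat \<Rightarrow> nat \<Rightarrow> nat \<Rightarrow> bool" where
  "valid_state m q r \<longleftrightarrow> m + r = n \<and> 1 \<le> r \<and> (m = 0 \<and> q = 0 \<or> 1 \<le> m \<and> m \<le> q)"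

text \<open>The letters above \<open>q\<close> meet two plus signs and act trivially. The letter
  \<open>q\<close> sees the resting minus sign with a plus sign on its right and gives
  \<open>c r q\<close>; then \<open>chain\<close> takes the sign to \<open>m\<close>.\<close>

lemma stay:
  assumes "valid_state m q r" "q \<le> j" "j < n" "Z \<subseteq> {j + 2..n}"
  shows "B r j (state m q \<union> Z) = c r q * A (r - 1) ({1..<Suc m} \<union> Z)"
  using assms(2-)
proof (induction j)
  case 0
  then have "Z \<subseteq> {1..n}" by (auto simp: subset_iff)
  then show ?case using B0[of r Z] assms(1) c0 0
    by (auto simp: state_def valid_state_def)
next
  case (Suc j)
  let ?S = "state m q \<union> Z"
  have S: "?S \<subseteq> {1..n}" using Suc.prems assms(1) by (auto simp: state_def valid_state_def)
  have Z: "x \<in> Z \<Longrightarrow> j + 3 \<le> x" for x using Suc.prems by auto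
  show ?case
  proof (cases "q = Suc j")
    case True
    then have "Suc j \<in> ?S" "Suc (Suc j) \<notin> ?S" using assms(1)
      by (auto simp: state_def valid_state_def dest: Z)
    moreover have "Z \<subseteq> {j + 2..n}" using Suc.prems by (auto simp: subset_iff)
    then have "B r j ?S = A (r - 1) ({1..<Suc m} \<union> Z)"
      using chain[of m r j Z] True assms(1) Suc.prems by (auto simp: state_def valid_state_def)
    ultimately show ?thesis using step[OF _ _ S, of r "Suc j"] Suc.prems True assms(1)
      by (auto simp: lowerable_def raisable_def valid_state_def)
  next
    case False
    then have "Suc j \<notin> ?S" "Suc (Suc j) \<notin> ?S" using assms(1) Suc.prems
      by (auto simp: state_def valid_state_def dest: Z)
    moreover have "B r j ?S = c r q * A (r - 1) ({1..<Suc m} \<union> Z)"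
      using Suc.prems False by (intro Suc.IH) auto
    ultimately show ?thesis using step[OF _ _ S, of r "Suc j"] Suc.prems assms(1)
      by (auto simp: lowerable_def raisable_def valid_state_def)
  qed
qed

text \<open>The new minus sign stops at some \<open>q'\<close>; the letter q' - 1 that fails to move
  it gives the inverse factor, and the older sign gives \<open>c r q\<close>. For q' = q + 1 the
  letter \<open>q\<close> sees two minus signs and is neutral, in agreement with a quotient equal to
  1.\<close>

lemma create:
  assumes "valid_state m q r" "q \<le> j" "j < n"
  shows "B r j (state m q \<union> {Suc j}) =
    (\<Sum>q'\<in>{q + 1..Suc j}. c r q / c r (q' - 1) * A (r - 1) ({1..<Suc m} \<union> {q'}))"
  using assms(2-)
proof (induction j)
  case 0
  then show ?case using B0[of r "{1}"] assms(1) c0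
    by (auto simp: state_def valid_state_def)
next
  case (Suc j)
  let ?S = "state m q \<union> {Suc (Suc j)}"
  have S: "?S \<subseteq> {1..n}" using Suc.prems assms(1) by (auto simp: state_def valid_state_def)
  show ?case
  proof (cases "q = Suc j")
    case True
    then have "Suc j \<in> ?S" "Suc (Suc j) \<in> ?S" using assms(1)
      by (auto simp: state_def valid_state_def)
    moreover have "B r j ?S = A (r - 1) ({1..<Suc m} \<union> {Suc (Suc j)})"
      using chain[of m r j "{Suc (Suc j)}"] True assms(1) Suc.prems by (auto simp: state_def valid_state_def)
    moreover have "c r q \<noteq> 0" using c_nz True Suc.prems assms(1) by (auto simp: valid_state_def)
    ultimately show ?thesis using step[OF _ _ S, of r "Suc j"] Suc.prems True assms(1)
      by (auto simp: lowerable_def raisable_def valid_state_def)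
  next
    case False
    then have 1: "Suc j \<notin> ?S" "Suc (Suc j) \<in> ?S" using assms(1) Suc.prems
      by (auto simp: state_def valid_state_def)
    have 2: "lowered n (Suc j) ?S = state m q \<union> {Suc j}"
      using assms(1) Suc.prems False by (auto simp: state_def valid_state_def lowered_def)
    have 3: "B r j (state m q \<union> {Suc (Suc j)}) = c r q * A (r - 1) ({1..<Suc m} \<union> {Suc (Suc j)})"
      using Suc.prems False by (intro stay assms) auto
    have 4: "B r j (state m q \<union> {Suc j}) =
      (\<Sum>q'\<in>{q + 1..Suc j}. c r q / c r (q' - 1) * A (r - 1) ({1..<Suc m} \<union> {q'}))"
      using Suc.prems False by (intro Suc.IH) auto
    have "B r (Suc j) ?S = inverse (c r (Suc j)) * B r j ?S + B r j (lowered n (Suc j) ?S)"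
      using step[OF _ _ S, of r "Suc j"] Suc.prems assms(1) 1
      by (auto simp: lowerable_def valid_state_def)
    moreover have "{q + 1..Suc (Suc j)} = insert (Suc (Suc j)) {q + 1..Suc j}"
      using Suc.prems by auto
    ultimately show ?thesis
      unfolding 2 3 4 by (simp add: divide_inverse mult_ac)
  qed
qed

text \<open>The letter \<open>n\<close> comes first in the sweep. Either it creates no minus sign,
  which forces everything that follows and gives the first summand by \<open>A_initial\<close>, or
  it creates one, which comes to rest at \<open>q'\<close>. For q = n creation is impossible and the
  sum is empty.\<close>

lemma A_rec:
  assumes "valid_state m q r" "q \<le> n"
  shows "A r (state m q) = (if q = n then c r n else c r q / c r n) +
    (\<Sum>q'\<in>{q + 1..n}. c r q / c r (q' - 1) * A (r - 1) ({1..<Suc m} \<union> {q'}))"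
proof -
  have S: "state m q \<subseteq> {1..n}" using assms by (auto simp: state_def valid_state_def)
  have r: "r \<in> {1..n}" "n \<in> {1..n}" using assms by (auto simp: valid_state_def)
  have A1: "A (r - 1) {1..<Suc m} = 1"
    using assms by (intro A_initial) (auto simp: valid_state_def)
  show ?thesis
  proof (cases "q = n")
    case True
    then have "B r (n - 1) (state m q) = 1"
      using chain[of m r "n - 1" "{}"] A1 assms n by (auto simp: state_def valid_state_def)
    moreover have "n \<in> state m q" using True n by (auto simp: state_def)
    ultimately show ?thesis using True Bn[OF r(1) S] step[OF r S]
      by (simp add: lowerable_def raisable_def)
  next
    case False
    then have "B r (n - 1) (state m q) = c r q"
      using stay[OF assms(1), of "n - 1" "{}"] assms n A1 by auto
    moreover have "n \<notin> state m q" using False assms n by (auto simp: state_def valid_state_def)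
    moreover have "B r (n - 1) (insert n (state m q)) =
       (\<Sum>q'\<in>{q + 1..n}. c r q / c r (q' - 1) * A (r - 1) ({1..<Suc m} \<union> {q'}))"
      using create[OF assms(1), of "n - 1"] assms n False by auto
    ultimately show ?thesis using False Bn[OF r(1) S] step[OF r S]
      by (simp add: lowerable_def lowered_def divide_inverse mult.commute)
  qed
qed

text \<open>\<open>R\<close> collects the resting places of the minus signs created before the first
  sweep that creates none; its cardinality is below \<open>r\<close> because such a sweep must occur
  among the remaining ones.\<close>

lemma A_eq_sum_aux:
  "m + r = n \<Longrightarrow> m = 0 \<and> q = 0 \<or> 1 \<le> m \<and> m \<le> q \<Longrightarrow> q \<le> n \<Longrightarrow>
    A r (state m q) = (\<Sum>R | R \<subseteq> {q + 1..n} \<and> card R < r. path_weight n c r q R)"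
proof (induction r arbitrary: m q)
  case 0
  \<comment> \<open>Here m = n, so q = n and the state has \<open>n\<close> minus signs, one more
    than the target.\<close>
  then have "state m q \<noteq> {1..<n}" "state m q \<subseteq> {1..n}" using n by (auto simp: state_def)
  then show ?case using A0 by simp
next
  case (Suc r)
  have "valid_state m q (Suc r)" using Suc.prems by (auto simp: valid_state_def)
  have cq: "c (Suc r) q \<noteq> 0" using c_nz[of "Suc r" q] c0[of "Suc r"] Suc.prems by (cases q) auto
  have "A (Suc r) (state m q) = (if q = n then c (Suc r) n else c (Suc r) q / c (Suc r) n) +
    (\<Sum>q'\<in>{q + 1..n}. c (Suc r) q / c (Suc r) (q' - 1) * A r ({1..<Suc m} \<union> {q'}))"
    using A_rec[OF \<open>valid_state m q (Suc r)\<close> Suc.prems(3)] by simp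
  also have "(\<Sum>q'\<in>{q + 1..n}. c (Suc r) q / c (Suc r) (q' - 1) * A r ({1..<Suc m} \<union> {q'})) =
     (\<Sum>q'\<in>{q + 1..n}. \<Sum>R | R \<subseteq> {q' + 1..n} \<and> card R < r. path_weight n c (Suc r) q (insert q' R))"
  proof (rule sum.cong[OF refl])
    fix q' assume q': "q' \<in> {q + 1..n}"
    have "{1..<Suc m} \<union> {q'} = state (Suc m) q'" using q' by (auto simp: state_def)
    moreover have "A r (state (Suc m) q') =
        (\<Sum>R | R \<subseteq> {q' + 1..n} \<and> card R < r. path_weight n c r q' R)"
      using Suc.prems q' by (intro Suc.IH) auto
    ultimately have "c (Suc r) q / c (Suc r) (q' - 1) * A r ({1..<Suc m} \<union> {q'}) =
       (\<Sum>R | R \<subseteq> {q' + 1..n} \<and> card R < r. c (Suc r) q / c (Suc r) (q' - 1) * path_weight n c r q' R)"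
      by (simp only: sum_distrib_left)
    also have "\<dots> = (\<Sum>R | R \<subseteq> {q' + 1..n} \<and> card R < r. path_weight n c (Suc r) q (insert q' R))"
      using q' cq by (intro sum.cong refl) (simp add: path_weight_insert)
    finally show "c (Suc r) q / c (Suc r) (q' - 1) * A r ({1..<Suc m} \<union> {q'}) = \<dots>" .
  qed
  also have "(if q = n then c (Suc r) n else c (Suc r) q / c (Suc r) n) = path_weight n c (Suc r) q {}"
    using path_weight_empty[OF Suc.prems(3)] by simp
  finally show ?case by (simp only: sum_subsets_min)
qed

theorem A_eq_sum: "A n {} = (\<Sum>R | R \<subseteq> {1..n} \<and> card R < n. path_weight n c n 0 R)"
  using A_eq_sum_aux[of 0 n 0] by (simp add: state_def)

end

section \<open>The fundamental weight on the torus and the spin module\<close>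

lemma mat_prod_Cons: "mat_prod (x # xs) = x ** mat_prod xs"
  by (simp add: mat_prod_def)

lemma mat_prod_Nil [simp]: "mat_prod [] = mat 1"
  by (simp add: mat_prod_def)

lemma mat_prod_append: "mat_prod (xs @ ys) = mat_prod xs ** mat_prod ys"
  by (induction xs) (simp_all add: mat_prod_Cons matrix_mul_assoc)

locale simply_connected_chevalley_B = chevalley_B n e f h
  for n :: nat and e f h :: "nat \<Rightarrow> 'v::finite cmat" +
  assumes sc: "simply_connected_B n e f h"
begin

lemma mat_prod_commute:
  assumes "\<And>x. x \<in> set xs \<Longrightarrow> A ** x = x ** A"
  shows "A ** mat_prod xs = mat_prod xs ** A"
  using assms
proof (induction xs)
  case (Cons x xs)
  have "A ** (x ** mat_prod xs) = x ** (A ** mat_prod xs)"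
    using Cons.prems[of x] by (simp add: matrix_mul_assoc)
  then show ?case using Cons by (simp add: mat_prod_Cons matrix_mul_assoc)
qed simp

lemma coroot_prod_mult:
  assumes "\<And>j. j \<in> {1..n} \<Longrightarrow> \<tau> j \<noteq> 0" "\<And>j. j \<in> {1..n} \<Longrightarrow> \<tau>' j \<noteq> 0"
  shows "coroot_prod n h \<tau> ** coroot_prod n h \<tau>' = coroot_prod n h (\<lambda>j. \<tau> j * \<tau>' j)"
proof -
  have "mat_prod (map (\<lambda>i. coroot h i (\<tau> i)) xs) ** mat_prod (map (\<lambda>i. coroot h i (\<tau>' i)) xs) =
     mat_prod (map (\<lambda>i. coroot h i (\<tau> i * \<tau>' i)) xs)" if "set xs \<subseteq> {1..n}" for xs
    using that
  proof (induction xs)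
    case (Cons x xs)
    let ?P = "\<lambda>\<tau>. mat_prod (map (\<lambda>i. coroot h i (\<tau> i)) xs)"
    have "coroot h x (\<tau>' x) ** ?P \<tau> = ?P \<tau> ** coroot h x (\<tau>' x)"
      using Cons.prems by (intro mat_prod_commute) (auto simp: coroot_eq intro!: mexp_h_commute)
    then have "coroot h x (\<tau> x) ** ?P \<tau> ** (coroot h x (\<tau>' x) ** ?P \<tau>') =
       (coroot h x (\<tau> x) ** coroot h x (\<tau>' x)) ** (?P \<tau> ** ?P \<tau>')"
      by (simp add: matrix_mul_assoc) (simp flip: matrix_mul_assoc)
    then show ?case using Cons assms by (simp add: mat_prod_Cons coroot_mult)
  qed simp
  moreover have "set [1..<Suc n] \<subseteq> {1..n}" by auto
  ultimately show ?thesis unfolding coroot_prod_def by blast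
qed

lemma coroot_prod_one: "coroot_prod n h (\<lambda>_. 1) = mat 1"
proof -
  have "mat_prod (map (\<lambda>i. coroot h i 1) xs) = mat 1" for xs
    by (induction xs) (simp_all add: mat_prod_Cons)
  then show ?thesis by (simp add: coroot_prod_def)
qed

lemma coroot_prod_single:
  assumes "i \<in> {1..n}"
  shows "coroot_prod n h (\<lambda>j. if j = i then s else 1) = coroot h i s"
proof -
  have "mat_prod (map (\<lambda>j. coroot h j (if j = i then s else 1)) xs) =
      (if i \<in> set xs then coroot h i s else mat 1)" if "distinct xs" for xs
    using that by (induction xs) (auto simp: mat_prod_Cons)
  from this[of "[1..<Suc n]"] show ?thesis using assms by (auto simp: coroot_prod_def simp del: upt_Suc)
qed

lemma coroot_prod_inj:
  assumes "\<And>j. j \<in> {1..n} \<Longrightarrow> \<tau> j \<noteq> 0" "\<And>j. j \<in> {1..n} \<Longrightarrow> \<tau>' j \<noteq> 0"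
    and "coroot_prod n h \<tau> = coroot_prod n h \<tau>'" "i \<in> {1..n}"
  shows "\<tau> i = \<tau>' i"
proof -
  have "coroot_prod n h (\<lambda>j. \<tau> j * inverse (\<tau>' j)) =
      coroot_prod n h \<tau> ** coroot_prod n h (\<lambda>j. inverse (\<tau>' j))"
    using assms by (intro coroot_prod_mult[symmetric]) auto
  also have "\<dots> = coroot_prod n h (\<lambda>j. \<tau>' j * inverse (\<tau>' j))"
    unfolding assms(3) using assms by (intro coroot_prod_mult) auto
  also have "\<dots> = coroot_prod n h (\<lambda>_. 1)"
    unfolding coroot_prod_def using assms(2)
    by (intro arg_cong[of _ _ mat_prod] map_cong) auto
  finally have "coroot_prod n h (\<lambda>j. \<tau> j * inverse (\<tau>' j)) = mat 1"
    by (simp add: coroot_prod_one)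
  moreover have "\<forall>j\<in>{1..n}. \<tau> j * inverse (\<tau>' j) \<noteq> 0" using assms by auto
  moreover have "\<forall>\<tau>. (\<forall>i\<in>{1..n}. \<tau> i \<noteq> 0) \<and> coroot_prod n h \<tau> = mat 1 \<longrightarrow> (\<forall>i\<in>{1..n}. \<tau> i = 1)"
    using sc unfolding simply_connected_B_def by (rule conjunct2)
  from spec[OF this, of "\<lambda>j. \<tau> j * inverse (\<tau>' j)"]
  have "(\<forall>i\<in>{1..n}. \<tau> i * inverse (\<tau>' i) \<noteq> 0) \<and> coroot_prod n h (\<lambda>j. \<tau> j * inverse (\<tau>' j)) = mat 1 \<longrightarrow>
      (\<forall>i\<in>{1..n}. \<tau> i * inverse (\<tau>' i) = 1)" .
  ultimately have "\<tau> i * inverse (\<tau>' i) = 1"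
    using assms(4) by (metis (no_types, lifting))
  then show ?thesis using assms(2,4) by (simp add: field_simps)
qed

lemma fund_weight_coroot_prod:
  assumes "\<And>j. j \<in> {1..n} \<Longrightarrow> \<tau> j \<noteq> 0" "i \<in> {1..n}"
  shows "fund_weight n h i (coroot_prod n h \<tau>) = \<tau> i"
  unfolding fund_weight_def
proof (rule the_equality)
  fix z assume "\<exists>\<tau>'. (\<forall>j\<in>{1..n}. \<tau>' j \<noteq> 0) \<and> coroot_prod n h \<tau> = coroot_prod n h \<tau>' \<and> z = \<tau>' i"
  then obtain \<tau>' where "\<forall>j\<in>{1..n}. \<tau>' j \<noteq> 0" "coroot_prod n h \<tau> = coroot_prod n h \<tau>'" "z = \<tau>' i"
    by blast
  then show "z = \<tau> i" using coroot_prod_inj[of \<tau> \<tau>' i] assms by auto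
qed (use assms in blast)

lemma torus_coroot_prod:
  assumes "t \<in> T"
  shows "\<exists>\<tau>. (\<forall>j\<in>{1..n}. \<tau> j \<noteq> 0) \<and> t = coroot_prod n h \<tau>"
  using assms
proof (induction rule: torus_induct)
  case one
  show ?case by (rule exI[of _ "\<lambda>_. 1"]) (simp add: coroot_prod_one)
next
  case (mult i s t)
  then obtain \<tau> where \<tau>: "\<forall>j\<in>{1..n}. \<tau> j \<noteq> 0" "t = coroot_prod n h \<tau>" by blast
  have "coroot h i s ** t = coroot_prod n h (\<lambda>j. (if j = i then s else 1) * \<tau> j)"
    unfolding coroot_prod_single[OF mult(1), symmetric] \<tau>(2)
    using \<tau> mult by (intro coroot_prod_mult) auto
  then show ?case using \<tau>(1) mult(2) by (intro exI[of _ "\<lambda>j. (if j = i then s else 1) * \<tau> j"]) auto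
qed

lemma fund_weight_mult:
  assumes "t \<in> T" "i \<in> {1..n}" "j \<in> {1..n}" "s \<noteq> 0"
  shows "fund_weight n h j (t ** coroot h i s) = (if j = i then s else 1) * fund_weight n h j t"
proof -
  obtain \<tau> where \<tau>: "\<forall>j\<in>{1..n}. \<tau> j \<noteq> 0" "t = coroot_prod n h \<tau>"
    using torus_coroot_prod assms(1) by blast
  have "t ** coroot h i s = coroot_prod n h (\<lambda>j. \<tau> j * (if j = i then s else 1))"
    unfolding coroot_prod_single[OF assms(2), symmetric] \<tau>(2)
    using \<tau> assms by (intro coroot_prod_mult) auto
  then show ?thesis
    using \<tau> assms fund_weight_coroot_prod[of \<tau> j]
      fund_weight_coroot_prod[of "\<lambda>j. \<tau> j * (if j = i then s else 1)" j] by auto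
qed

lemma fund_weight_one: "i \<in> {1..n} \<Longrightarrow> fund_weight n h i (mat 1) = 1"
  using fund_weight_coroot_prod[of "\<lambda>_. 1" i] by (simp add: coroot_prod_one)

end

text \<open>The minor is replaced by a polynomial on all matrices, so that it can be differentiated;
  everything else about it is deduced from its values on the open cell.\<close>

locale spin_minor = simply_connected_chevalley_B n e f h
  for n :: nat and e f h :: "nat \<Rightarrow> 'v::finite cmat" +
  fixes q :: "'v cmat \<Rightarrow> complex"
  assumes q_poly: "q \<in> mat_polynomials"
    and q_cell: "\<And>u t v. u \<in> Um \<Longrightarrow> t \<in> T \<Longrightarrow> v \<in> Up \<Longrightarrow> q (u ** t ** v) = fund_weight n h n t"
begin

lemma n_range: "n \<in> {1..n}" using n2 by simp

lemma q_one: "q (mat 1) = 1"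
  using q_cell[of "mat 1" "mat 1" "mat 1"] fund_weight_one[OF n_range] by simp

lemma q_eqI:
  assumes "p \<in> mat_polynomials" "r \<in> mat_polynomials" "\<And>x. x \<in> cell \<Longrightarrow> p x = r x" "x \<in> G"
  shows "p x = r x"
  using cell_dense[OF mat_polynomials_diff[OF assms(1,2)] _ assms(4)] assms(3) by simp

lemma q_X:
  assumes "x \<in> G" "i \<in> {1..n}"
  shows "q (x ** mexp (e i) s) = q x"
proof (rule q_eqI[OF _ q_poly _ assms(1)])
  show "(\<lambda>x. q (x ** mexp (e i) s)) \<in> mat_polynomials"
    using mat_polynomials_translate[OF q_poly, of "mat 1"] by simp
  fix x assume "x \<in> cell"
  then obtain u t v where x: "x = u ** t ** v" "u \<in> Um" "t \<in> T" "v \<in> Up"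
    by (auto simp: cell_def)
  then have "x ** mexp (e i) s = u ** t ** (v ** mexp (e i) s)" by (simp add: matrix_mul_assoc)
  then show "q (x ** mexp (e i) s) = q x"
    using x q_cell mult_closed(2)[OF x(4) Up_X[OF assms(2)]] by simp
qed

lemma q_Y:
  assumes "x \<in> G" "i \<in> {1..n}"
  shows "q (mexp (f i) s ** x) = q x"
proof (rule q_eqI[OF _ q_poly _ assms(1)])
  show "(\<lambda>x. q (mexp (f i) s ** x)) \<in> mat_polynomials"
    using mat_polynomials_translate[OF q_poly, of _ "mat 1"] by simp
  fix x assume "x \<in> cell"
  then obtain u t v where x: "x = u ** t ** v" "u \<in> Um" "t \<in> T" "v \<in> Up"
    by (auto simp: cell_def)
  then have "mexp (f i) s ** x = (mexp (f i) s ** u) ** t ** v" by (simp add: matrix_mul_assoc)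
  then show "q (mexp (f i) s ** x) = q x"
    using x q_cell mult_closed(3)[OF Um_Y[OF assms(2)] x(2)] by simp
qed

lemma q_H:
  assumes "x \<in> G" "i \<in> {1..n}"
  shows "q (x ** mexp (h i) z) = (if i = n then exp z else 1) * q x"
proof (rule q_eqI[OF _ mat_polynomials_cmult[OF q_poly] _ assms(1)])
  show "(\<lambda>x. q (x ** mexp (h i) z)) \<in> mat_polynomials"
    using mat_polynomials_translate[OF q_poly, of "mat 1"] by simp
  fix x assume "x \<in> cell"
  then obtain u t v where x: "x = u ** t ** v" "u \<in> Um" "t \<in> T" "v \<in> Up"
    by (auto simp: cell_def)
  have H: "mexp (h i) z = coroot h i (exp z)" using assms(2) by (simp add: coroot_exp)
  obtain v' where v': "v' \<in> Up" "v ** mexp (h i) z = mexp (h i) z ** v'"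
    using Up_T[OF T_H[OF assms(2)] x(4)] by blast
  have "x ** mexp (h i) z = u ** (t ** mexp (h i) z) ** v'"
    using x(1) v'(2) by (simp add: matrix_mul_assoc) (simp flip: matrix_mul_assoc)
  then have "q (x ** mexp (h i) z) = fund_weight n h n (t ** mexp (h i) z)"
    using q_cell[OF x(2) mult_closed(4)[OF x(3) T_H[OF assms(2)]] v'(1)] by simp
  then show "q (x ** mexp (h i) z) = (if i = n then exp z else 1) * q x"
    using fund_weight_mult[OF x(3) assms(2) n_range, of "exp z"] x q_cell H by auto
qed

text \<open>A polynomial is determined by the minor on the group only, so the relations of the
  module can hold only in this sense.\<close>

definition eqG :: "('v cmat \<Rightarrow> complex) \<Rightarrow> ('v cmat \<Rightarrow> complex) \<Rightarrow> bool" (infix "\<doteq>" 50) where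
  "p \<doteq> r \<longleftrightarrow> (\<forall>x\<in>G. p x = r x)"

text \<open>Plays the part of membership in the Lie algebra of the group: the curve x exp(z A) then
  stays in the group, so \<open>rderiv A\<close> is well defined up to equality on it.\<close>

definition stab :: "'v cmat \<Rightarrow> bool" where
  "stab A \<longleftrightarrow> (\<forall>z. mexp A z \<in> G)"

lemma stab [simp]: "i \<in> {1..n} \<Longrightarrow> stab (e i)" "i \<in> {1..n} \<Longrightarrow> stab (f i)" "i \<in> {1..n} \<Longrightarrow> stab (h i)"
  by (simp_all add: stab_def G_X G_Y G_H)

lemma eqG_refl [simp]: "p \<doteq> p" by (simp add: eqG_def)
lemma eqG_sym: "p \<doteq> r \<Longrightarrow> r \<doteq> p" by (simp add: eqG_def)
lemma eqG_trans [trans]: "p \<doteq> r \<Longrightarrow> r \<doteq> s \<Longrightarrow> p \<doteq> s" by (simp add: eqG_def)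

lemma mexp_mult_stab: "stab A \<Longrightarrow> x \<in> G \<Longrightarrow> x ** mexp A z \<in> G"
  by (simp add: stab_def mult_closed)

lemma rderiv_cong:
  assumes "p \<in> mat_polynomials" "r \<in> mat_polynomials" "p \<doteq> r" "stab A"
  shows "rderiv A p \<doteq> rderiv A r"
  unfolding eqG_def
proof
  fix x assume x: "x \<in> G"
  have "((\<lambda>w. p (x ** mexp A w)) has_field_derivative rderiv A p x) (at 0)"
    using mat_poly_mexp_deriv[OF assms(1), of x A 0] by simp
  moreover have "(\<lambda>w. p (x ** mexp A w)) = (\<lambda>w. r (x ** mexp A w))"
    using assms x mexp_mult_stab by (auto simp: eqG_def)
  moreover have "((\<lambda>w. r (x ** mexp A w)) has_field_derivative rderiv A r x) (at 0)"
    using mat_poly_mexp_deriv[OF assms(2), of x A 0] by simp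
  ultimately show "rderiv A p x = rderiv A r x" using DERIV_unique by metis
qed

lemma rderiv_eqG_I:
  assumes "p \<in> mat_polynomials" "\<And>x z. x \<in> G \<Longrightarrow> p (x ** mexp A z) = g z * p x"
    "(g has_field_derivative m) (at 0)"
  shows "rderiv A p \<doteq> (\<lambda>x. m * p x)"
  unfolding eqG_def
proof
  fix x assume x: "x \<in> G"
  have "((\<lambda>w. p (x ** mexp A w)) has_field_derivative rderiv A p x) (at 0)"
    using mat_poly_mexp_deriv[OF assms(1), of x A 0] by simp
  moreover have "((\<lambda>w. p (x ** mexp A w)) has_field_derivative m * p x) (at 0)"
    using assms(3) by (simp add: assms(2)[OF x]) (auto intro!: derivative_eq_intros)
  ultimately show "rderiv A p x = m * p x" using DERIV_unique by blast
qed

lemma exp_action: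
  assumes "p \<in> mat_polynomials" "rderiv A p \<doteq> (\<lambda>x. m * p x)" "stab A" "x \<in> G"
  shows "p (x ** mexp A z) = exp (m * z) * p x"
proof -
  let ?g = "\<lambda>z. exp (- (m * z)) * p (x ** mexp A z)"
  have "(?g has_field_derivative 0) (at z)" for z
    using assms(2) mexp_mult_stab[OF assms(3,4), of z]
    by (auto intro!: derivative_eq_intros mat_poly_mexp_deriv[OF assms(1)] simp: eqG_def)
  then have "\<exists>c. \<forall>z\<in>UNIV. ?g z = c"
    by (intro has_field_derivative_zero_constant[OF convex_UNIV]) auto
  then obtain c where "\<And>z. ?g z = c" by blast
  from this[of z] this[of 0] have "?g z = ?g 0" by simp
  then show ?thesis by (simp add: exp_minus field_simps)
qed

text \<open>Integrates an operator whose square kills \<open>p\<close>. This degree is enough for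
  e_i and f_i because the spin weights take only the values 1, 0, -1 on the coroots.\<close>

lemma affine_action:
  assumes "p \<in> mat_polynomials" "r \<in> mat_polynomials" "rderiv A p \<doteq> r" "rderiv A r \<doteq> (\<lambda>_. 0)" "stab A" "x \<in> G"
  shows "p (x ** mexp A z) = p x + z * r x"
proof -
  have r: "r (x ** mexp A z) = r x" for z
    using exp_action[OF assms(2) _ assms(5,6), of 0] assms(4) by simp
  let ?g = "\<lambda>z. p (x ** mexp A z) - z * r x"
  have "(?g has_field_derivative 0) (at z)" for z
    using assms(3) mexp_mult_stab[OF assms(5,6), of z] r[of z]
    by (auto intro!: derivative_eq_intros mat_poly_mexp_deriv[OF assms(1)] simp: eqG_def)
  then have "\<exists>c. \<forall>z\<in>UNIV. ?g z = c"
    by (intro has_field_derivative_zero_constant[OF convex_UNIV]) auto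
  then obtain c where "\<And>z. ?g z = c" by blast
  from this[of z] this[of 0] have "?g z = ?g 0" by simp
  then show ?thesis by (simp add: field_simps)
qed

text \<open>A vector killed by \<open>e\<^sub>i\<close> of negative \<open>h\<^sub>i\<close>-weight \<open>-k\<close> vanishes: moving \<open>y\<^sub>i(\<tau>)\<close> past
  \<open>x\<^sub>i\<close> shows that the entire function \<open>\<tau> \<mapsto> u (x y\<^sub>i(\<tau>))\<close> decays like \<open>\<tau>\<^sup>-\<^sup>k\<close>.\<close>

lemma negative_highest_weight:
  assumes u: "u \<in> mat_polynomials" and i: "i \<in> {1..n}"
    and eu: "rderiv (e i) u \<doteq> (\<lambda>_. 0)" and hu: "rderiv (h i) u \<doteq> (\<lambda>x. - of_nat k * u x)" and k: "k > 0"
  shows "u \<doteq> (\<lambda>_. 0)"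
proof -
  have "u x = 0" if x: "x \<in> G" for x
  proof -
    have uX: "u (y ** mexp (e i) s) = u y" if "y \<in> G" for y s
      using exp_action[OF u _ _ that, of "e i" 0 s] eu i by simp
    have uH: "u (y ** mexp (h i) z) = exp (- of_nat k * z) * u y" if "y \<in> G" for y z
      using exp_action[OF u hu _ that] i by simp
    let ?g = "\<lambda>\<tau>. u (x ** mexp (f i) \<tau>)"
    let ?r = "\<lambda>w. u (x ** mexp (e i) (w - 1) ** mexp (f i) 1)"
    have xY: "x ** mexp (f i) \<tau> \<in> G" for \<tau> using mult_closed(1)[OF x G_Y[OF i]] .
    \<comment> \<open>This is \<open>sl2_factor_exp\<close> with t = 1 and z = -Ln \<tau>. The
      factor x_i on the right does not affect \<open>u\<close>, and the torus factor contributes the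
      power \<tau>^k.\<close>
    have key: "?g \<tau> = inverse \<tau> ^ k * ?r (inverse \<tau>)" if "\<tau> \<noteq> 0" for \<tau>
    proof -
      have ex: "exp (- (- Ln \<tau>)) = \<tau>" "exp (- Ln \<tau>) = inverse \<tau>" using that by (simp_all add: exp_minus)
      have "mexp (e i) (inverse \<tau> - 1) ** mexp (f i) 1 =
          mexp (f i) \<tau> ** mexp (h i) (- Ln \<tau>) ** mexp (e i) (1 - \<tau>)"
        using sl2_factor_exp[OF sl2[OF i], of 1 "- Ln \<tau>"] unfolding ex by simp
      then have "?r (inverse \<tau>) = u (x ** mexp (f i) \<tau> ** mexp (h i) (- Ln \<tau>) ** mexp (e i) (1 - \<tau>))"
        by (simp flip: matrix_mul_assoc)
      also have "\<dots> = u (x ** mexp (f i) \<tau> ** mexp (h i) (- Ln \<tau>))"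
        using mult_closed(1)[OF xY G_H[OF i]] by (rule uX)
      also have "\<dots> = exp (of_nat k * Ln \<tau>) * ?g \<tau>" using uH[OF xY] by simp
      also have "exp (of_nat k * Ln \<tau>) = \<tau> ^ k" using that by (simp add: exp_of_nat_mult)
      finally show ?thesis using that by (simp add: field_simps)
    qed
    have "?g 0 = 0"
    proof (rule Liouville_weak_0[of ?g])
      show "?g holomorphic_on UNIV"
        unfolding holomorphic_on_def field_differentiable_def
        using mat_poly_mexp_deriv[OF u] by blast
      have "(\<lambda>w. u (x ** mexp (e i) w ** mexp (f i) 1)) holomorphic_on UNIV"
      proof -
        have "(\<lambda>y. u (y ** mexp (f i) 1)) \<in> mat_polynomials"
          using mat_polynomials_translate[OF u, of "mat 1"] by simp
        from mat_poly_mexp_deriv[OF this] show ?thesis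
          unfolding holomorphic_on_def field_differentiable_def by blast
      qed
      then have "continuous_on UNIV (\<lambda>w. u (x ** mexp (e i) w ** mexp (f i) 1))"
        by (rule holomorphic_on_imp_continuous_on)
      then have "isCont (\<lambda>w. u (x ** mexp (e i) w ** mexp (f i) 1)) (0 - 1)"
        using continuous_on_eq_continuous_at[OF open_UNIV] by blast
      then have "isCont ?r 0"
        by (rule isCont_o2[where f = "\<lambda>w. w - 1", rotated]) (intro continuous_intros)
      then have "((\<lambda>\<tau>. ?r (inverse \<tau>)) \<longlongrightarrow> ?r 0) at_infinity"
        using isCont_tendsto_compose tendsto_inverse_0 by blast
      moreover have "((\<lambda>\<tau>. inverse \<tau> ^ k) \<longlongrightarrow> (0::complex)) at_infinity"
        using tendsto_power[OF tendsto_inverse_0, of k] k by (simp add: power_0_left)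
      ultimately have "((\<lambda>\<tau>. inverse \<tau> ^ k * ?r (inverse \<tau>)) \<longlongrightarrow> 0 * ?r 0) at_infinity"
        by (intro tendsto_mult)
      then have "((\<lambda>\<tau>. inverse \<tau> ^ k * ?r (inverse \<tau>)) \<longlongrightarrow> 0) at_infinity" by simp
      then show "(?g \<longlongrightarrow> 0) at_infinity"
      proof (rule Lim_transform_eventually)
        show "\<forall>\<^sub>F \<tau> in at_infinity. inverse \<tau> ^ k * ?r (inverse \<tau>) = ?g \<tau>"
          using eventually_not_equal_at_infinity[of 0] by eventually_elim (simp add: key)
      qed
    qed
    then show ?thesis by simp
  qed
  then show ?thesis by (simp add: eqG_def)
qed

end

text \<open>The number of raisings from \<open>S\<close> to the empty set: a minus sign at
  \<open>i\<close> makes n - i moves to the right and is then removed. It is the induction measure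
  for the module.\<close>

definition raised_height :: "nat \<Rightarrow> nat set \<Rightarrow> nat" where
  "raised_height n S = (\<Sum>i\<in>S. n + 1 - i)"

lemma raisable_exists:
  assumes "S \<subseteq> {1..n}" "S \<noteq> {}"
  shows "\<exists>i\<in>{1..n}. raisable n i S"
proof -
  have fin: "finite S" using assms(1) finite_subset by blast
  have "Max S \<in> S" using fin assms(2) by simp
  moreover have "Suc (Max S) \<notin> S" using Max_ge[OF fin, of "Suc (Max S)"] by auto
  ultimately show ?thesis using assms(1) by (auto simp: raisable_def)
qed

lemma raised_subset: "S \<subseteq> {1..n} \<Longrightarrow> raisable n i S \<Longrightarrow> raised n i S \<subseteq> {1..n}"
  by (auto simp: raised_def raisable_def subset_iff)

lemma raised_height:
  assumes "S \<subseteq> {1..n}" "raisable n i S"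
  shows "raised_height n S = Suc (raised_height n (raised n i S))"
proof -
  have fin: "finite S" using assms(1) finite_subset by blast
  have i: "i \<in> S" "i \<le> n" using assms by (auto simp: raisable_def)
  have "raised_height n S = (n + 1 - i) + (\<Sum>i\<in>S - {i}. n + 1 - i)"
    unfolding raised_height_def by (rule sum.remove[OF fin i(1)])
  moreover have "Suc i \<notin> S" if "i \<noteq> n" using assms(2) that by (auto simp: raisable_def)
  ultimately show ?thesis using fin i
    by (cases "i = n") (auto simp: raised_height_def raised_def)
qed

lemma raised_lowered: "lowerable n i S \<Longrightarrow> raised n i (lowered n i S) = S"
  by (auto simp: raised_def lowered_def lowerable_def)

lemma lowered_raised: "raisable n i S \<Longrightarrow> lowered n i (raised n i S) = S"
  by (auto simp: raised_def lowered_def raisable_def)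

lemma raisable_lowered: "lowerable n i S \<Longrightarrow> raisable n i (lowered n i S)"
  by (auto simp: raisable_def lowered_def lowerable_def)

lemma lowerable_raised: "raisable n i S \<Longrightarrow> lowerable n i (raised n i S)"
  by (auto simp: raisable_def raised_def lowerable_def)

lemma lowerable_not_raisable: "lowerable n i S \<Longrightarrow> \<not> raisable n i S"
  by (auto simp: raisable_def lowerable_def)

definition spin_wt :: "nat \<Rightarrow> nat set \<Rightarrow> nat \<Rightarrow> int" where
  "spin_wt n S i = (if lowerable n i S then 1 else if raisable n i S then -1 else 0)"

lemma spin_wt_raised:
  assumes "S \<subseteq> {1..n}" "raisable n j S" "i \<in> {1..n}" "j \<in> {1..n}"
  shows "spin_wt n S i = spin_wt n (raised n j S) i - cartan n i j"
proof -
  consider "i = j" | "i = Suc j" | "j = Suc i" | "i \<noteq> j" "i \<noteq> Suc j" "j \<noteq> Suc i" by blast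
  then show ?thesis
    by cases (use assms in \<open>auto simp: spin_wt_def lowerable_def raisable_def raised_def cartan_def\<close>)
qed

text \<open>Neighbouring positions are never raisable together, since a minus sign at i + 1 blocks
  \<open>i\<close>. Two distinct raisings are therefore independent, which gives the diamond for
  path independence.\<close>

lemma two_raisable:
  assumes "raisable n i S" "raisable n j S" "i \<noteq> j" "S \<subseteq> {1..n}"
  shows "raisable n i (raised n j S)" "raisable n j (raised n i S)"
    "raised n i (raised n j S) = raised n j (raised n i S)" "cartan n i j = 0"
  using assms by (auto simp: raisable_def raised_def cartan_def)

text \<open>If \<open>i\<close> becomes raisable only through the raising at \<open>j\<close>, then
  raising at \<open>i\<close> uses the free place or the minus sign that this provided, so the
  raising at \<open>j\<close> can no longer be undone.\<close>

lemma raised_blocks: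
  assumes "raisable n j S" "i \<noteq> j" "raisable n i (raised n j S)" "\<not> raisable n i S"
  shows "\<not> lowerable n j (raised n i (raised n j S))"
  using assms by (auto simp: raisable_def raised_def lowerable_def split: if_splits)

context spin_minor
begin

text \<open>Lowering operators are applied to \<open>q\<close> along a chosen path from the empty
  set to \<open>S\<close>, with the height as recursion counter. Independence of the choice, up to
  equality on the group, is the first clause of \<open>good\<close>.\<close>

primrec phi_aux :: "nat \<Rightarrow> nat set \<Rightarrow> 'v cmat \<Rightarrow> complex" where
  "phi_aux 0 S = q"
| "phi_aux (Suc k) S =
    (let i = (SOME i. i \<in> {1..n} \<and> raisable n i S) in rderiv (f i) (phi_aux k (raised n i S)))"

definition phi :: "nat set \<Rightarrow> 'v cmat \<Rightarrow> complex" where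
  "phi S = phi_aux (raised_height n S) S"

lemma phi_empty: "phi {} = q"
  by (simp add: phi_def raised_height_def)

lemma phi_rec:
  assumes "S \<subseteq> {1..n}" "S \<noteq> {}"
  obtains i where "i \<in> {1..n}" "raisable n i S" "phi S = rderiv (f i) (phi (raised n i S))"
proof -
  define i where "i = (SOME i. i \<in> {1..n} \<and> raisable n i S)"
  have i: "i \<in> {1..n}" "raisable n i S"
    using someI_ex[of "\<lambda>i. i \<in> {1..n} \<and> raisable n i S"] raisable_exists[OF assms]
    unfolding i_def by blast+
  have "phi S = rderiv (f i) (phi (raised n i S))"
    using raised_height[OF assms(1) i(2)] by (simp add: phi_def i_def Let_def)
  with i show thesis by (rule that)
qed

lemma phi_induct [consumes 1, case_names empty step]:
  assumes "S \<subseteq> {1..n}" "P q"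
    "\<And>i p. i \<in> {1..n} \<Longrightarrow> P p \<Longrightarrow> P (rderiv (f i) p)"
  shows "P (phi S)"
  using assms(1)
proof (induction "raised_height n S" arbitrary: S rule: less_induct)
  case less
  show ?case
  proof (cases "S = {}")
    case False
    then obtain i where i: "i \<in> {1..n}" "raisable n i S" "phi S = rderiv (f i) (phi (raised n i S))"
      using phi_rec less.prems by blast
    have "P (phi (raised n i S))"
      using less raised_subset[OF less.prems i(2)] raised_height[OF less.prems i(2)] by simp
    then show ?thesis using assms(3) i by simp
  qed (simp add: phi_empty assms(2))
qed

lemma phi_poly [simp]: "S \<subseteq> {1..n} \<Longrightarrow> phi S \<in> mat_polynomials"
  by (induction rule: phi_induct) (auto intro: q_poly rderiv_poly)

section \<open>The relations of the spin module\<close>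

lemma rderiv_eqG_zero:
  assumes "p \<in> mat_polynomials" "p \<doteq> (\<lambda>_. 0)" "stab A"
  shows "rderiv A p \<doteq> (\<lambda>_. 0)"
  using rderiv_cong[OF assms(1) mat_polynomials.const assms(2,3)] by simp

lemma rderiv_eqG_cmult:
  assumes "p \<in> mat_polynomials" "r \<in> mat_polynomials" "p \<doteq> (\<lambda>x. c * r x)" "stab A"
  shows "rderiv A p \<doteq> (\<lambda>x. c * rderiv A r x)"
  using rderiv_cong[OF assms(1) mat_polynomials_cmult[OF assms(2), of c] assms(3,4)]
  by (simp add: rderiv_cmult assms(2))

lemma rderiv_h_f:
  assumes "p \<in> mat_polynomials" "i \<in> {1..n}" "j \<in> {1..n}" "rderiv (h i) p \<doteq> (\<lambda>x. of_int a * p x)"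
  shows "rderiv (h i) (rderiv (f j) p) \<doteq> (\<lambda>x. of_int (a - cartan n i j) * rderiv (f j) p x)"
proof -
  have "rderiv (f j) (rderiv (h i) p) \<doteq> (\<lambda>x. of_int a * rderiv (f j) p x)"
    using assms by (intro rderiv_eqG_cmult rderiv_poly) auto
  moreover have "rderiv (h i) (rderiv (f j) p) x =
      rderiv (f j) (rderiv (h i) p) x + - of_int (cartan n i j) * rderiv (f j) p x" for x
    using rderiv_bracket[OF assms(1), of "h i" "f j" x]
    unfolding brackets(3)[OF assms(2,3)] rderiv_scale[OF assms(1)] by (simp add: algebra_simps)
  ultimately show ?thesis by (simp add: eqG_def algebra_simps)
qed

lemma rderiv_e_f:
  assumes "p \<in> mat_polynomials" "i \<in> {1..n}" "j \<in> {1..n}"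
  shows "rderiv (e i) (rderiv (f j) p) x = rderiv (f j) (rderiv (e i) p) x + (if i = j then rderiv (h i) p x else 0)"
  using rderiv_bracket[OF assms(1), of "e i" "f j" x] brackets(4)[OF assms(2,3)]
    rderiv_scale[OF assms(1), of 0 0 x]
  by (auto simp: algebra_simps split: if_splits)

lemma rderiv_f_f:
  assumes "p \<in> mat_polynomials" "i \<in> {1..n}" "j \<in> {1..n}" "i \<noteq> j" "cartan n i j = 0"
  shows "rderiv (f i) (rderiv (f j) p) x = rderiv (f j) (rderiv (f i) p) x"
  using rderiv_bracket[OF assms(1), of "f i" "f j" x] brackets(5)[OF assms(2-5)]
    rderiv_scale[OF assms(1), of 0 0 x] by simp

text \<open>Path independence, weight and raising are proved together by induction on the height:
  the action of e_i at \<open>S\<close> uses all three at sets of smaller height.\<close>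

definition good :: "nat set \<Rightarrow> bool" where
  "good S \<longleftrightarrow> (\<forall>i\<in>{1..n}.
     (raisable n i S \<longrightarrow> phi S \<doteq> rderiv (f i) (phi (raised n i S))) \<and>
     rderiv (h i) (phi S) \<doteq> (\<lambda>x. of_int (spin_wt n S i) * phi S x) \<and>
     rderiv (e i) (phi S) \<doteq> (if raisable n i S then phi (raised n i S) else (\<lambda>_. 0)))"

lemma goodD:
  assumes "good S" "i \<in> {1..n}"
  shows "raisable n i S \<Longrightarrow> phi S \<doteq> rderiv (f i) (phi (raised n i S))"
    "rderiv (h i) (phi S) \<doteq> (\<lambda>x. of_int (spin_wt n S i) * phi S x)"
    "raisable n i S \<Longrightarrow> rderiv (e i) (phi S) \<doteq> phi (raised n i S)"
    "\<not> raisable n i S \<Longrightarrow> rderiv (e i) (phi S) \<doteq> (\<lambda>_. 0)"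
  using assms by (auto simp: good_def split: if_splits)

text \<open>By e f = f e + h the vector f_i \<open>phi S\<close> is killed by e_i, while its weight
  \<open>spin_wt n S i - 2\<close> is negative. Such a vector vanishes on the group; this cuts the
  module down to the spin weights.\<close>

lemma good_f_zero:
  assumes S: "S \<subseteq> {1..n}" and "good S" "i \<in> {1..n}" "\<not> lowerable n i S"
  shows "rderiv (f i) (phi S) \<doteq> (\<lambda>_. 0)"
proof (rule negative_highest_weight[where i = i and k = "nat (2 - spin_wt n S i)"])
  note D = goodD[OF assms(2,3)]
  show "rderiv (f i) (phi S) \<in> mat_polynomials" using S by (simp add: rderiv_poly)
  show "nat (2 - spin_wt n S i) > 0" by (simp add: spin_wt_def)
  have "spin_wt n S i \<le> 0" using assms(4) by (simp add: spin_wt_def)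
  then have "- of_nat (nat (2 - spin_wt n S i)) = (of_int (spin_wt n S i - 2) :: complex)"
    by (simp add: of_nat_nat)
  then show "rderiv (h i) (rderiv (f i) (phi S)) \<doteq> (\<lambda>x. - of_nat (nat (2 - spin_wt n S i)) * rderiv (f i) (phi S) x)"
    using rderiv_h_f[OF phi_poly[OF S] assms(3,3) D(2)] by (simp add: cartan_def)
  \<comment> \<open>This is the term that cancels the contribution of h_i when e_i is moved past
    f_i.\<close>
  have *: "rderiv (f i) (rderiv (e i) (phi S)) \<doteq> (\<lambda>x. of_int (- spin_wt n S i) * phi S x)"
  proof (cases "raisable n i S")
    case True
    have "rderiv (f i) (rderiv (e i) (phi S)) \<doteq> rderiv (f i) (phi (raised n i S))"
      using S D(3)[OF True] assms(3) raised_subset[OF S True] by (intro rderiv_cong) (simp_all add: rderiv_poly)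
    also have "\<dots> \<doteq> phi S" using D(1)[OF True] by (rule eqG_sym)
    finally show ?thesis using True assms(4) by (simp add: spin_wt_def)
  next
    case False
    then have "rderiv (f i) (rderiv (e i) (phi S)) \<doteq> (\<lambda>_. 0)"
      using S assms(3) D(4) by (intro rderiv_eqG_zero[of "rderiv (e i) (phi S)"]) (auto intro!: rderiv_poly)
    then show ?thesis using False assms(4) by (simp add: spin_wt_def)
  qed
  show "rderiv (e i) (rderiv (f i) (phi S)) \<doteq> (\<lambda>_. 0)"
    using * D(2) rderiv_e_f[OF phi_poly[OF S] assms(3,3)] by (simp add: eqG_def)
qed (fact assms)

lemma good_empty: "good {}"
  unfolding good_def phi_empty
proof (intro ballI conjI)
  fix i assume i: "i \<in> {1..n}"
  show "raisable n i {} \<longrightarrow> q \<doteq> rderiv (f i) (phi (raised n i {}))" by (simp add: raisable_def)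
  have "rderiv (h i) q \<doteq> (\<lambda>x. (if i = n then 1 else 0) * q x)"
  proof (rule rderiv_eqG_I[OF q_poly])
    show "q (x ** mexp (h i) z) = (if i = n then exp z else 1) * q x" if "x \<in> G" for x z
      by (rule q_H[OF that i])
  qed (auto intro!: derivative_eq_intros)
  then show "rderiv (h i) q \<doteq> (\<lambda>x. of_int (spin_wt n {} i) * q x)"
    by (auto simp: spin_wt_def lowerable_def raisable_def eqG_def)
  have "rderiv (e i) q \<doteq> (\<lambda>x. 0 * q x)"
    by (rule rderiv_eqG_I[OF q_poly, of _ "\<lambda>_. 1"]) (auto simp: q_X[OF _ i])
  then show "rderiv (e i) q \<doteq> (if raisable n i {} then phi (raised n i {}) else (\<lambda>_. 0))"
    by (simp add: raisable_def)
qed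

text \<open>With \<open>phi S\<close> = f_j \<open>phi U\<close>, moving e_i past f_j leaves f_j e_i
  \<open>phi U\<close>, and an h_i term if i = j. Goodness at smaller height evaluates both.\<close>

lemma good_all: "S \<subseteq> {1..n} \<Longrightarrow> good S"
proof (induction "raised_height n S" arbitrary: S rule: less_induct)
  case less
  note S = less.prems
  show ?case
  proof (cases "S = {}")
    case False
    then obtain j where j: "j \<in> {1..n}" "raisable n j S" "phi S = rderiv (f j) (phi (raised n j S))"
      using phi_rec S by blast
    have IH: "good U" if "U \<subseteq> {1..n}" "raised_height n U < raised_height n S" for U
      using less that by blast
    have um: "good (raised n i S)" "raised n i S \<subseteq> {1..n}" if "raisable n i S" for i
      using IH[of "raised n i S"] raised_subset[OF S that] raised_height[OF S that] by simp_all
    define U where "U = raised n j S"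
    have U: "good U" "U \<subseteq> {1..n}" using um[OF j(2)] by (simp_all add: U_def)
    have pS: "phi S = rderiv (f j) (phi U)" using j by (simp add: U_def)
    have a: "phi S \<doteq> rderiv (f i) (phi (raised n i S))" if i: "i \<in> {1..n}" "raisable n i S" for i
    proof (cases "i = j")
      case False
      note c = two_raisable[OF i(2) j(2) False S]
      \<comment> \<open>The common result of raising at \<open>i\<close> and \<open>j\<close> in
        either order. Both descriptions of \<open>phi S\<close> pass through \<open>phi R\<close>,
        and f_i commutes with f_j.\<close>
      define R where "R = raised n i U"
      have R: "R \<subseteq> {1..n}" "R = raised n j (raised n i S)"
        using raised_subset[OF U(2), of i] c by (simp_all add: R_def U_def)
      have "phi U \<doteq> rderiv (f i) (phi R)"
        unfolding R_def using goodD(1)[OF U(1) i(1)] c(1) by (simp add: U_def)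
      then have "phi S \<doteq> rderiv (f j) (rderiv (f i) (phi R))"
        unfolding pS using U R j by (intro rderiv_cong) (auto intro: rderiv_poly)
      also have "\<dots> \<doteq> rderiv (f i) (rderiv (f j) (phi R))"
        using rderiv_f_f[OF phi_poly[OF R(1)] i(1) j(1) False c(4)] by (simp add: eqG_def)
      also have "\<dots> \<doteq> rderiv (f i) (phi (raised n i S))"
      proof (rule rderiv_cong)
        show "rderiv (f j) (phi R) \<doteq> phi (raised n i S)"
          using goodD(1)[OF um(1)[OF i(2)] j(1) c(2)] R(2) by (simp add: eqG_sym)
      qed (use R(1) um(2)[OF i(2)] i in \<open>auto intro: rderiv_poly\<close>)
      finally show ?thesis .
    qed (use j(3) in simp)
    have b: "rderiv (h i) (phi S) \<doteq> (\<lambda>x. of_int (spin_wt n S i) * phi S x)" if i: "i \<in> {1..n}" for i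
      unfolding pS spin_wt_raised[OF S j(2) i j(1)] U_def[symmetric]
      using goodD(2)[OF U(1) i] U(2) i j by (intro rderiv_h_f) auto
    have c: "rderiv (e i) (phi S) \<doteq> (if raisable n i S then phi (raised n i S) else (\<lambda>_. 0))"
      if i: "i \<in> {1..n}" for i
    proof -
      have ef: "rderiv (e i) (phi S) x = rderiv (f j) (rderiv (e i) (phi U)) x + (if i = j then rderiv (h i) (phi U) x else 0)" for x
        unfolding pS by (rule rderiv_e_f[OF phi_poly[OF U(2)] i j(1)])
      have zero: "rderiv (f j) (rderiv (e i) (phi U)) \<doteq> (\<lambda>_. 0)" if "\<not> raisable n i U"
        using goodD(4)[OF U(1) i that] U i j by (intro rderiv_eqG_zero[of "rderiv (e i) (phi U)"]) (auto intro: rderiv_poly)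
      show ?thesis
      proof (cases "i = j")
        case True
        have "lowerable n j U" using lowerable_raised[OF j(2)] by (simp add: U_def)
        then have "\<not> raisable n j U" "spin_wt n U j = 1" by (auto simp: lowerable_not_raisable spin_wt_def)
        then show ?thesis using True zero ef goodD(2)[OF U(1) i] j(2)
          by (simp add: eqG_def U_def)
      next
        case False
        show ?thesis
        proof (cases "raisable n i U")
          case True
          have "rderiv (f j) (rderiv (e i) (phi U)) \<doteq> rderiv (f j) (phi (raised n i U))"
            using goodD(3)[OF U(1) i True] U i j raised_subset[OF U(2) True]
            by (intro rderiv_cong) (auto intro: rderiv_poly)
          then have 1: "rderiv (e i) (phi S) \<doteq> rderiv (f j) (phi (raised n i U))"
            using ef False by (simp add: eqG_def)
          show ?thesis
          proof (cases "raisable n i S")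
            case True
            note c = two_raisable[OF True j(2) False S]
            note 1
            also have "rderiv (f j) (phi (raised n i U)) \<doteq> phi (raised n i S)"
              using goodD(1)[OF um(1)[OF True] j(1) c(2)] c(3) by (simp add: eqG_sym U_def)
            finally show ?thesis using True by simp
          next
            \<comment> \<open>Here e_i \<open>phi S\<close> would have a weight that is not reached
              by raising \<open>S\<close>; the candidate is f_j applied where \<open>j\<close> is
              not lowerable, hence zero.\<close>
            case nS: False
            have "\<not> lowerable n j (raised n i U)"
              using raised_blocks[OF j(2) False _ nS] True by (simp add: U_def)
            moreover have "good (raised n i U)"
              using raised_height[OF U(2) True] raised_height[OF S j(2)] raised_subset[OF U(2) True]
              by (intro IH) (auto simp: U_def)
            ultimately have "rderiv (f j) (phi (raised n i U)) \<doteq> (\<lambda>_. 0)"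
              using good_f_zero[OF raised_subset[OF U(2) True] _ j(1)] by blast
            with 1 have "rderiv (e i) (phi S) \<doteq> (\<lambda>_. 0)" by (rule eqG_trans)
            then show ?thesis using nS by simp
          qed
        next
          case nU: False
          then have "\<not> raisable n i S" using two_raisable(1)[OF _ j(2) False S] by (auto simp: U_def)
          then show ?thesis using zero[OF nU] ef False by (simp add: eqG_def)
        qed
      qed
    qed
    show ?thesis unfolding good_def using a b c by blast
  qed (simp add: good_empty)
qed

section \<open>Action of the group generators on the functions \<open>phi S\<close>\<close>

lemma phi_f:
  assumes "S \<subseteq> {1..n}" "i \<in> {1..n}"
  shows "rderiv (f i) (phi S) \<doteq> (if lowerable n i S then phi (lowered n i S) else (\<lambda>_. 0))"
proof (cases "lowerable n i S")
  case True
  have "phi (lowered n i S) \<doteq> rderiv (f i) (phi (raised n i (lowered n i S)))"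
    using goodD(1)[OF good_all[OF lowered_subset[OF assms]] assms(2) raisable_lowered[OF True]] .
  then show ?thesis using True raised_lowered[OF True] by (simp add: eqG_sym)
next
  case False
  then show ?thesis using good_f_zero[OF assms(1) good_all[OF assms(1)] assms(2)] by simp
qed

lemma phi_Y:
  assumes "S \<subseteq> {1..n}" "i \<in> {1..n}" "x \<in> G"
  shows "phi S (x ** mexp (f i) t) = phi S x + (if lowerable n i S then t * phi (lowered n i S) x else 0)"
proof -
  let ?r = "if lowerable n i S then phi (lowered n i S) else (\<lambda>_. 0)"
  have "rderiv (f i) ?r \<doteq> (\<lambda>_. 0)"
  proof (cases "lowerable n i S")
    case True
    then have "\<not> lowerable n i (lowered n i S)" using raisable_lowered lowerable_not_raisable by blast
    then show ?thesis using phi_f[OF lowered_subset[OF assms(1,2)] assms(2)] True by simp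
  qed simp
  then have "phi S (x ** mexp (f i) t) = phi S x + t * ?r x"
    using assms phi_f[OF assms(1,2)] lowered_subset[OF assms(1,2)]
    by (intro affine_action) (auto intro: mat_polynomials.const)
  then show ?thesis by simp
qed

lemma phi_X:
  assumes "S \<subseteq> {1..n}" "i \<in> {1..n}" "x \<in> G"
  shows "phi S (x ** mexp (e i) t) = phi S x + (if raisable n i S then t * phi (raised n i S) x else 0)"
proof -
  let ?r = "if raisable n i S then phi (raised n i S) else (\<lambda>_. 0)"
  have S: "rderiv (e i) (phi S) \<doteq> ?r" using good_all[OF assms(1)] assms(2) by (simp add: good_def)
  have "rderiv (e i) ?r \<doteq> (\<lambda>_. 0)"
  proof (cases "raisable n i S")
    case True
    then show ?thesis
      using goodD(4)[OF good_all[OF raised_subset[OF assms(1) True]] assms(2)] lowerable_raised[OF True]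
        lowerable_not_raisable by auto
  qed simp
  then have "phi S (x ** mexp (e i) t) = phi S x + t * ?r x"
    using assms S raised_subset[OF assms(1)]
    by (intro affine_action) (auto intro: mat_polynomials.const)
  then show ?thesis by simp
qed

lemma phi_H:
  assumes "S \<subseteq> {1..n}" "i \<in> {1..n}" "x \<in> G"
  shows "phi S (x ** mexp (h i) z) = exp (of_int (spin_wt n S i) * z) * phi S x"
  using assms goodD(2)[OF good_all[OF assms(1)] assms(2)] by (intro exp_action) auto

lemma G_y_bold: "i \<in> {1..n} \<Longrightarrow> y_bold f h i c \<in> G"
  by (simp add: y_bold_def one_param_eq coroot_eq mult_closed G_Y G_H)

text \<open>The coroot factor contributes c to the power minus the weight. In the lowerable case its
  inverse cancels the parameter of y_i in the lowered term, so a move has coefficient 1 and only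
  rests carry factors.\<close>

lemma phi_y_bold:
  assumes "S \<subseteq> {1..n}" "i \<in> {1..n}" "x \<in> G" "c \<noteq> 0"
  shows "phi S (x ** y_bold f h i c) =
    (if lowerable n i S then inverse c * phi S x + phi (lowered n i S) x
     else if raisable n i S then c * phi S x else phi S x)"
proof -
  have "phi S (x ** y_bold f h i c) =
    exp (of_int (spin_wt n S i) * Ln (inverse c)) * phi S (x ** mexp (f i) c)"
    using phi_H[OF assms(1,2) mult_closed(1)[OF assms(3) G_Y[OF assms(2)]]]
    by (simp add: y_bold_def one_param_eq coroot_eq matrix_mul_assoc)
  then show ?thesis using assms phi_Y[OF assms(1-3), of c]
    by (simp add: spin_wt_def exp_minus distrib_left)
qed

definition refl_inv :: "nat \<Rightarrow> 'v cmat" where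
  "refl_inv i = mexp (e i) 1 ** mexp (f i) (-1) ** mexp (e i) 1"

lemma G_refl_inv: "i \<in> {1..n} \<Longrightarrow> refl_inv i \<in> G"
  by (simp add: refl_inv_def mult_closed G_X G_Y)

lemma refl_lift_inv: "refl_lift e f i ** refl_inv i = mat 1" "refl_inv i ** refl_lift e f i = mat 1"
proof -
  have c: "mexp A (-1) ** mexp A 1 = mat 1" "mexp A 1 ** mexp A (-1) = mat 1" for A :: "'v cmat"
    using mexp_minus[of A 1] by simp_all
  have c': "B ** mexp A (-1) ** mexp A 1 = B" "B ** mexp A 1 ** mexp A (-1) = B" for A B :: "'v cmat"
    using c by (simp_all flip: matrix_mul_assoc)
  show "refl_lift e f i ** refl_inv i = mat 1" "refl_inv i ** refl_lift e f i = mat 1"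
    by (simp_all add: refl_lift_def refl_inv_def one_param_eq matrix_mul_assoc c c')
qed

text \<open>On the span of two neighbouring weight vectors this is the matrix of the inverse lift in
  SL_2. The sign -1 appears in one direction only, namely when \<open>S\<close> is
  lowerable.\<close>

lemma phi_refl_inv:
  assumes S: "S \<subseteq> {1..n}" and i: "i \<in> {1..n}" and x: "x \<in> G"
  shows "phi S (x ** refl_inv i) =
    (if raisable n i S then phi (raised n i S) x else if lowerable n i S then - phi (lowered n i S) x else phi S x)"
proof -
  let ?x1 = "x ** mexp (e i) 1" and ?x2 = "x ** mexp (e i) 1 ** mexp (f i) (-1)"
  have G: "?x1 \<in> G" "?x2 \<in> G" using x i by (simp_all add: mult_closed G_X G_Y)
  have eq: "x ** refl_inv i = ?x2 ** mexp (e i) 1" by (simp add: refl_inv_def matrix_mul_assoc)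
  consider "raisable n i S" | "lowerable n i S" | "\<not> raisable n i S" "\<not> lowerable n i S" by blast
  then show ?thesis
  proof cases
    case 1
    let ?U = "raised n i S"
    have U: "?U \<subseteq> {1..n}" "lowerable n i ?U" "lowered n i ?U = S" "\<not> raisable n i ?U" "\<not> lowerable n i S"
      using raised_subset[OF S 1] lowerable_raised[OF 1] lowered_raised[OF 1] lowerable_not_raisable 1 by auto
    show ?thesis
      using 1 U unfolding eq
      by (simp add: phi_X[OF S i G(2)] phi_Y[OF S i G(1)] phi_Y[OF U(1) i G(1)] phi_X[OF S i x]
          phi_X[OF U(1) i x])
  next
    case 2
    let ?M = "lowered n i S"
    have M: "?M \<subseteq> {1..n}" "raisable n i ?M" "raised n i ?M = S" "\<not> raisable n i S"
      using lowered_subset[OF S i] raisable_lowered[OF 2] raised_lowered[OF 2] lowerable_not_raisable 2 by auto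
    show ?thesis
      using 2 M unfolding eq
      by (simp add: phi_X[OF S i G(2)] phi_Y[OF S i G(1)] phi_X[OF S i x] phi_X[OF M(1) i x])
  next
    case 3
    then show ?thesis unfolding eq
      by (simp add: phi_X[OF S i G(2)] phi_Y[OF S i G(1)] phi_X[OF S i x])
  qed
qed

lemma phi_left_invariant:
  assumes "S \<subseteq> {1..n}" "i \<in> {1..n}"
  shows "(\<lambda>x. phi S (mexp (f i) t ** x)) \<doteq> phi S"
proof -
  have "phi S \<in> mat_polynomials \<and> (\<lambda>x. phi S (mexp (f i) t ** x)) \<doteq> phi S"
    using assms(1)
  proof (induction rule: phi_induct)
    case empty
    then show ?case using q_poly q_Y assms(2) by (simp add: eqG_def)
  next
    case (step j p)
    have "(\<lambda>x. p (mexp (f i) t ** x)) \<in> mat_polynomials"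
      using mat_polynomials_translate[of p _ "mat 1"] step by simp
    then have "rderiv (f j) (\<lambda>x. p (mexp (f i) t ** x)) \<doteq> rderiv (f j) p"
      using step by (intro rderiv_cong) auto
    then show ?case using step by (simp add: rderiv_translate rderiv_poly)
  qed
  then show ?thesis by blast
qed

text \<open>At the identity, right and left translation by y_i coincide, so left invariance makes
  every derivative along f_i vanish there.\<close>

lemma phi_one:
  assumes "S \<subseteq> {1..n}"
  shows "phi S (mat 1) = (if S = {} then 1 else 0)"
proof (cases "S = {}")
  case False
  then obtain i where i: "i \<in> {1..n}" "raisable n i S" "phi S = rderiv (f i) (phi (raised n i S))"
    using phi_rec assms by blast
  let ?U = "raised n i S"
  have U: "?U \<subseteq> {1..n}" using raised_subset[OF assms i(2)] .
  have "phi ?U (mat 1 ** mexp (f i) w) = phi ?U (mat 1)" for w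
    using phi_left_invariant[OF U i(1), of w] by (auto simp: eqG_def dest: bspec[of _ _ "mat 1"])
  then have "((\<lambda>w. phi ?U (mat 1 ** mexp (f i) w)) has_field_derivative 0) (at 0)" by simp
  moreover have "((\<lambda>w. phi ?U (mat 1 ** mexp (f i) w)) has_field_derivative rderiv (f i) (phi ?U) (mat 1 ** mexp (f i) 0)) (at 0)"
    by (rule mat_poly_mexp_deriv[OF phi_poly[OF U]])
  ultimately have "rderiv (f i) (phi ?U) (mat 1 ** mexp (f i) 0) = 0" using DERIV_unique by blast
  then show ?thesis using False i(3) by simp
qed (simp add: phi_empty q_one)

end

section \<open>Reduced words in the Weyl group\<close>

text \<open>The coordinates of a weight with respect to the basis \<open>\<epsilon>\<^sub>k / 2\<close>, in which the Weyl group
  acts by signed permutations.\<close>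

definition eps :: "nat \<Rightarrow> (nat \<Rightarrow> int) \<Rightarrow> nat \<Rightarrow> int" where
  "eps n l k = (if k \<in> {1..n} then l n + 2 * (\<Sum>j\<in>{k..<n}. l j) else 0)"

definition wact :: "nat \<Rightarrow> nat \<Rightarrow> (nat \<Rightarrow> int) \<Rightarrow> nat \<Rightarrow> int" where
  "wact n i x = (if i = n then x(n := - x n) else x(i := x (Suc i), Suc i := x i))"

definition wacts :: "nat \<Rightarrow> nat list \<Rightarrow> (nat \<Rightarrow> int) \<Rightarrow> nat \<Rightarrow> int" where
  "wacts n is x = foldr (wact n) is x"

lemma wacts_simps [simp]: "wacts n [] x = x" "wacts n (i # is) x = wact n i (wacts n is x)"
  by (simp_all add: wacts_def)

lemma wacts_append: "wacts n (is @ js) x = wacts n is (wacts n js x)"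
  by (simp add: wacts_def)

lemma eps_Suc: "k \<in> {1..<n} \<Longrightarrow> eps n l k = 2 * l k + eps n l (Suc k)"
  by (simp add: eps_def sum.atLeast_Suc_lessThan)

text \<open>The simple roots are \<epsilon>_i - \<epsilon>_{i+1} for i < n and \<epsilon>_n; the
  coordinates are doubled because the basis vectors are halved.\<close>

lemma eps_cartan:
  assumes "i \<in> {1..n}" "k \<in> {1..n}"
  shows "eps n (\<lambda>j. cartan n j i) k = (if k = i then 2 else if k = Suc i then -2 else 0)"
proof -
  have "k \<le> n" using assms by simp
  then show ?thesis using assms(2)
  proof (induction k rule: inc_induct)
    case base
    then show ?case using assms(1) by (auto simp: eps_def cartan_def)
  next
    case (step k)
    then have "eps n (\<lambda>j. cartan n j i) k = 2 * cartan n k i + eps n (\<lambda>j. cartan n j i) (Suc k)"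
      by (intro eps_Suc) auto
    then show ?case using step assms(1) by (auto simp: cartan_def)
  qed
qed

lemma eps_simple_refl:
  assumes "i \<in> {1..n}"
  shows "eps n (simple_refl n i l) = wact n i (eps n l)"
proof
  fix k
  show "eps n (simple_refl n i l) k = wact n i (eps n l) k"
  proof (cases "k \<in> {1..n}")
    case True
    have "eps n (simple_refl n i l) k = eps n l k - l i * eps n (\<lambda>j. cartan n j i) k"
      using True assms
      by (auto simp: eps_def simple_refl_def sum_subtractf sum_distrib_left algebra_simps)
    also have "\<dots> = wact n i (eps n l) k"
    proof (cases "i = n")
      case True
      have "eps n l n = l n" using assms True by (simp add: eps_def)
      then show ?thesis using True \<open>k \<in> {1..n}\<close> assms
        by (auto simp: wact_def eps_cartan)
    next
      case False
      then have "eps n l i = 2 * l i + eps n l (Suc i)" using assms by (intro eps_Suc) auto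
      then show ?thesis using False \<open>k \<in> {1..n}\<close> assms
        by (auto simp: wact_def eps_cartan)
    qed
    finally show ?thesis .
  next
    case False
    then show ?thesis using assms by (auto simp: eps_def wact_def)
  qed
qed

section \<open>Weyl group elements as signed permutations\<close>

lemma word_elt_simps [simp]:
  "word_elt n [] = id" "word_elt n (i # is) = simple_refl n i \<circ> word_elt n is"
  by (simp_all add: word_elt_def)

lemma word_elt_append: "word_elt n (is @ js) = word_elt n is \<circ> word_elt n js"
  by (induction "is") (simp_all add: comp_assoc)

lemma eps_word:
  "set is \<subseteq> {1..n} \<Longrightarrow> eps n (word_elt n is l) = wacts n is (eps n l)"
  by (induction "is") (simp_all add: eps_simple_refl)

lemma word_elt_outside: "j \<notin> {1..n} \<Longrightarrow> word_elt n is l j = l j"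
  by (induction "is") (auto simp: simple_refl_def)

lemma eps_inj:
  assumes "eps n l = eps n l'" "\<And>j. j \<notin> {1..n} \<Longrightarrow> l j = l' j"
  shows "l = l'"
proof
  fix j
  consider "j \<notin> {1..n}" | "j = n" "j \<in> {1..n}" | "j \<in> {1..<n}" by force
  then show "l j = l' j"
  proof cases
    case 2
    then show ?thesis using fun_cong[OF assms(1), of n] by (simp add: eps_def)
  next
    case 3
    then show ?thesis
      using fun_cong[OF assms(1), of j] fun_cong[OF assms(1), of "Suc j"] eps_Suc[OF 3, of l] eps_Suc[OF 3, of l']
      by simp
  qed (use assms(2) in simp)
qed

text \<open>A regular dominant weight with coordinates 2n, ..., 4, 2. They are distinct and
  positive, so its image determines the signs and the permutation of a Weyl group element.\<close>

definition rvec :: "nat \<Rightarrow> nat \<Rightarrow> int" where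
  "rvec n k = (if k \<in> {1..n} then 2 * (int n + 1 - int k) else 0)"

lemma rvec_pos: "k \<in> {1..n} \<Longrightarrow> rvec n k > 0"
  by (auto simp: rvec_def)

lemma eps_rvec: "eps n (\<lambda>j. if j = n then 2 else 1) = rvec n"
proof
  fix k
  show "eps n (\<lambda>j. if j = n then 2 else 1) k = rvec n k"
    by (auto simp: eps_def rvec_def sum.If_cases of_nat_diff algebra_simps)
qed

text \<open>The signs and the permutation are fixed before the vector, so they can be read off from
  one regular vector and then used for all others.\<close>

lemma wacts_signed_perm:
  assumes "set is \<subseteq> {1..n}"
  shows "\<exists>\<sigma> \<pi>. (\<forall>k\<in>{1..n}. (\<sigma> k = 1 \<or> \<sigma> k = - 1) \<and> \<pi> k \<in> {1..n}) \<and> inj_on \<pi> {1..n} \<and>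
    (\<forall>x. \<forall>k\<in>{1..n}. wacts n is x k = \<sigma> k * x (\<pi> k))"
  using assms
proof (induction "is")
  case Nil
  show ?case by (intro exI[of _ "\<lambda>_. 1"] exI[of _ "\<lambda>k. k"]) auto
next
  case (Cons i "is")
  then obtain \<sigma> \<pi> where *: "\<And>k. k \<in> {1..n} \<Longrightarrow> \<sigma> k = 1 \<or> \<sigma> k = - 1" "\<And>k. k \<in> {1..n} \<Longrightarrow> \<pi> k \<in> {1..n}"
    "inj_on \<pi> {1..n}" "\<And>x k. k \<in> {1..n} \<Longrightarrow> wacts n is x k = \<sigma> k * x (\<pi> k)"
    using Cons.IH by (metis (no_types, lifting) list.set_intros(2) subset_eq)
  have i: "i \<in> {1..n}" using Cons.prems by simp
  show ?case
  proof (cases "i = n")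
    case True
    show ?thesis
      by (intro exI[of _ "\<sigma>(n := - \<sigma> n)"] exI[of _ \<pi>])
         (use * True in \<open>auto simp: wact_def\<close>)
  next
    case False
    let ?t = "\<lambda>k. if k = i then Suc i else if k = Suc i then i else k"
    have t: "?t k \<in> {1..n}" if "k \<in> {1..n}" for k using that i False by auto
    have "inj_on ?t {1..n}" by (auto simp: inj_on_def split: if_splits)
    moreover have "?t ` {1..n} \<subseteq> {1..n}" using t by blast
    ultimately have inj: "inj_on (\<pi> \<circ> ?t) {1..n}"
      using comp_inj_on[of ?t "{1..n}" \<pi>] inj_on_subset[OF *(3)] by blast
    have "wacts n (i # is) x k = (\<sigma> \<circ> ?t) k * x ((\<pi> \<circ> ?t) k)" if "k \<in> {1..n}" for x k
      using *(4)[OF t[OF that], of x] False i by (auto simp: wact_def)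
    moreover have "(\<sigma> \<circ> ?t) k = 1 \<or> (\<sigma> \<circ> ?t) k = - 1" "(\<pi> \<circ> ?t) k \<in> {1..n}" if "k \<in> {1..n}" for k
      using *(1,2)[OF t[OF that]] by simp_all
    ultimately show ?thesis using inj by blast
  qed
qed

lemma wacts_outside: "set is \<subseteq> {1..n} \<Longrightarrow> k \<notin> {1..n} \<Longrightarrow> wacts n is x k = x k"
proof (induction "is")
  case (Cons i "is")
  then have "k \<noteq> i" "i \<noteq> n \<Longrightarrow> k \<noteq> Suc i" "k = n \<Longrightarrow> i \<noteq> n" by auto
  then show ?case using Cons by (auto simp: wact_def)
qed simp

lemma rvec_sign_inj:
  assumes "a * rvec n k = b * rvec n l" "a = 1 \<or> a = - 1" "b = 1 \<or> b = - 1" "k \<in> {1..n}" "l \<in> {1..n}"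
  shows "a = b \<and> k = l"
  using assms by (auto simp: rvec_def)

lemma wacts_determined:
  assumes "set is \<subseteq> {1..n}" "set js \<subseteq> {1..n}" "wacts n is (rvec n) = wacts n js (rvec n)"
  shows "wacts n is x = wacts n js x"
proof
  fix k
  show "wacts n is x k = wacts n js x k"
  proof (cases "k \<in> {1..n}")
    case True
    obtain \<sigma> \<pi> where 1: "\<And>k. k \<in> {1..n} \<Longrightarrow> \<sigma> k = 1 \<or> \<sigma> k = - 1" "\<And>k. k \<in> {1..n} \<Longrightarrow> \<pi> k \<in> {1..n}"
      "\<And>x k. k \<in> {1..n} \<Longrightarrow> wacts n is x k = \<sigma> k * x (\<pi> k)"
      using wacts_signed_perm[OF assms(1)] by blast
    obtain \<sigma>' \<pi>' where 2: "\<And>k. k \<in> {1..n} \<Longrightarrow> \<sigma>' k = 1 \<or> \<sigma>' k = - 1" "\<And>k. k \<in> {1..n} \<Longrightarrow> \<pi>' k \<in> {1..n}"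
      "\<And>x k. k \<in> {1..n} \<Longrightarrow> wacts n js x k = \<sigma>' k * x (\<pi>' k)"
      using wacts_signed_perm[OF assms(2)] by blast
    have "\<sigma> k * rvec n (\<pi> k) = \<sigma>' k * rvec n (\<pi>' k)"
      using assms(3) 1(3)[OF True] 2(3)[OF True] by metis
    then have "\<sigma> k = \<sigma>' k \<and> \<pi> k = \<pi>' k"
      using rvec_sign_inj 1(1,2)[OF True] 2(1,2)[OF True] by blast
    then show ?thesis using 1(3)[OF True] 2(3)[OF True] by simp
  next
    case False
    then show ?thesis using assms wacts_outside by simp
  qed
qed

lemma word_elt_eq_iff:
  assumes "set is \<subseteq> {1..n}" "set js \<subseteq> {1..n}"
  shows "word_elt n is = word_elt n js \<longleftrightarrow> wacts n is (rvec n) = wacts n js (rvec n)"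
proof
  assume "word_elt n is = word_elt n js"
  then show "wacts n is (rvec n) = wacts n js (rvec n)"
    using eps_word[OF assms(1), of "\<lambda>j. if j = n then 2 else 1"]
      eps_word[OF assms(2), of "\<lambda>j. if j = n then 2 else 1"] by (simp add: eps_rvec)
next
  assume *: "wacts n is (rvec n) = wacts n js (rvec n)"
  show "word_elt n is = word_elt n js"
  proof
    fix l
    show "word_elt n is l = word_elt n js l"
    proof (rule eps_inj[of n])
      show "eps n (word_elt n is l) = eps n (word_elt n js l)"
        by (simp only: eps_word[OF assms(1)] eps_word[OF assms(2)] wacts_determined[OF assms *])
    qed (simp add: word_elt_outside)
  qed
qed

definition pairs :: "nat \<Rightarrow> (nat \<times> nat) set" where
  "pairs n = {(k, l). 1 \<le> k \<and> k < l \<and> l \<le> n}"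

lemma finite_pairs [simp]: "finite (pairs n)"
  by (rule finite_subset[of _ "{1..n} \<times> {1..n}"]) (auto simp: pairs_def)

text \<open>The number of positive roots \<open>\<epsilon>\<^sub>k\<close>, \<open>\<epsilon>\<^sub>k - \<epsilon>\<^sub>l\<close>, \<open>\<epsilon>\<^sub>k + \<epsilon>\<^sub>l\<close> (\<open>k < l\<close>) pairing negatively
  with \<open>x\<close>.\<close>

definition inversions :: "nat \<Rightarrow> (nat \<Rightarrow> int) \<Rightarrow> nat" where
  "inversions n x = (\<Sum>k\<in>{1..n}. of_bool (x k < 0)) +
     (\<Sum>p\<in>pairs n. of_bool (x (fst p) < x (snd p)) + of_bool (x (fst p) + x (snd p) < 0))"

text \<open>The sign change interchanges the conditions for \<epsilon>_k - \<epsilon>_n and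
  \<epsilon>_k + \<epsilon>_n, so only the root \<epsilon>_n changes its count. The correction terms
  on both sides avoid subtraction of natural numbers.\<close>

lemma inversions_flip:
  assumes "n \<ge> 1"
  shows "inversions n (x(n := - x n)) + of_bool (x n < 0) = inversions n x + of_bool (x n > 0)"
proof -
  let ?y = "x(n := - x n)"
  have n: "{1..n} = insert n {1..<n}" using assms by auto
  have "(\<Sum>p\<in>pairs n. of_bool (?y (fst p) < ?y (snd p)) + of_bool (?y (fst p) + ?y (snd p) < 0)) =
    (\<Sum>p\<in>pairs n. of_bool (x (fst p) < x (snd p)) + of_bool (x (fst p) + x (snd p) < (0::int)) :: nat)"
  proof (rule sum.cong[OF refl])
    fix p assume "p \<in> pairs n"
    then obtain k l where p: "p = (k, l)" "k < l" "l \<le> n" by (auto simp: pairs_def)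
    have "x k < - x n \<longleftrightarrow> x k + x n < 0" "x k - x n < 0 \<longleftrightarrow> x k < x n" by linarith+
    then show "of_bool (?y (fst p) < ?y (snd p)) + of_bool (?y (fst p) + ?y (snd p) < 0) =
      (of_bool (x (fst p) < x (snd p)) + of_bool (x (fst p) + x (snd p) < 0) :: nat)"
      using p by (cases "l = n") simp_all
  qed
  moreover have "(\<Sum>k\<in>{1..<n}. of_bool (?y k < 0)) = (\<Sum>k\<in>{1..<n}. of_bool (x k < (0::int)) :: nat)"
    by (rule sum.cong) auto
  moreover have first: "(\<Sum>k\<in>{1..n}. of_bool (z k < 0)) =
      of_bool (z n < 0) + (\<Sum>k\<in>{1..<n}. of_bool (z k < (0::int)) :: nat)" for z
    unfolding n by (subst sum.insert) simp_all
  moreover have "of_bool (?y n < 0) = (of_bool (x n > 0) :: nat)" by simp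
  ultimately show ?thesis unfolding inversions_def using first[of ?y] first[of x] by linarith
qed

text \<open>The transposition permutes the positive roots other than \<epsilon>_i -
  \<epsilon>_{i+1}; only the pair (i, i + 1) changes its count.\<close>

lemma inversions_swap:
  assumes "i \<in> {1..<n}"
  shows "inversions n (x(i := x (Suc i), Suc i := x i)) + of_bool (x i < x (Suc i)) =
    inversions n x + of_bool (x (Suc i) < x i)"
proof -
  let ?y = "x(i := x (Suc i), Suc i := x i)"
  let ?t = "\<lambda>k. if k = i then Suc i else if k = Suc i then i else k"
  have y: "?y k = x (?t k)" for k by auto
  let ?F = "\<lambda>x p. of_bool (x (fst p) < x (snd p)) + of_bool (x (fst p) + x (snd p) < (0::int)) :: nat"
  have s: "pairs n = insert (i, Suc i) (pairs n - {(i, Suc i)})" using assms by (auto simp: pairs_def)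
  have split: "sum f (pairs n) = f (i, Suc i) + sum f (pairs n - {(i, Suc i)})" for f :: "nat \<times> nat \<Rightarrow> nat"
    by (subst s, subst sum.insert) auto
  have "(\<Sum>p\<in>pairs n - {(i, Suc i)}. ?F ?y p) = (\<Sum>p\<in>pairs n - {(i, Suc i)}. ?F x p)"
    by (rule sum.reindex_bij_witness[of _ "\<lambda>p. (?t (fst p), ?t (snd p))" "\<lambda>p. (?t (fst p), ?t (snd p))"])
       (use assms in \<open>auto simp: pairs_def split: if_splits\<close>)
  moreover have "(\<Sum>k\<in>{1..n}. of_bool (?y k < 0)) = (\<Sum>k\<in>{1..n}. of_bool (x k < (0::int)) :: nat)"
    by (rule sum.reindex_bij_witness[of _ ?t ?t]) (use assms in \<open>auto split: if_splits\<close>)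
  ultimately show ?thesis unfolding inversions_def split by (simp add: add.commute)
qed

text \<open>The simple root at \<open>i\<close> pairs positively with \<open>x\<close>. For the
  image of \<open>rvec\<close> under w this says that s_i w is longer than w.\<close>

definition ascent :: "nat \<Rightarrow> (nat \<Rightarrow> int) \<Rightarrow> nat \<Rightarrow> bool" where
  "ascent n x i \<longleftrightarrow> (if i = n then x n > 0 else x (Suc i) < x i)"

text \<open>The image of a regular vector has nonzero and distinct coordinates, so one of the two
  correction terms vanishes and the other is 1.\<close>

lemma inversions_wact:
  assumes "set is \<subseteq> {1..n}" "i \<in> {1..n}"
  defines "x \<equiv> wacts n is (rvec n)"
  shows "ascent n x i \<Longrightarrow> inversions n (wact n i x) = Suc (inversions n x)"
    "\<not> ascent n x i \<Longrightarrow> inversions n x = Suc (inversions n (wact n i x))"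
proof -
  obtain \<sigma> \<pi> where *: "\<And>k. k \<in> {1..n} \<Longrightarrow> \<sigma> k = 1 \<or> \<sigma> k = - 1" "\<And>k. k \<in> {1..n} \<Longrightarrow> \<pi> k \<in> {1..n}"
    "inj_on \<pi> {1..n}" "\<And>k. k \<in> {1..n} \<Longrightarrow> x k = \<sigma> k * rvec n (\<pi> k)"
    using wacts_signed_perm[OF assms(1)] unfolding x_def by blast
  have nz: "x k \<noteq> 0" if "k \<in> {1..n}" for k
    using *(1,2,4)[OF that] by (auto simp: rvec_def)
  have ne: "x k \<noteq> x l" if "k \<in> {1..n}" "l \<in> {1..n}" "k \<noteq> l" for k l
  proof
    assume "x k = x l"
    then have "\<pi> k = \<pi> l"
      using rvec_sign_inj[of "\<sigma> k" n "\<pi> k" "\<sigma> l" "\<pi> l"] * that by auto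
    then show False using *(3) that by (auto dest: inj_onD)
  qed
  have "n \<ge> 1" using assms(2) by auto
  have "(ascent n x i \<longrightarrow> inversions n (wact n i x) = Suc (inversions n x)) \<and>
    (\<not> ascent n x i \<longrightarrow> inversions n x = Suc (inversions n (wact n i x)))"
  proof (cases "i = n")
    case True
    then show ?thesis using inversions_flip[OF \<open>n \<ge> 1\<close>, of x] nz[of n] assms(2)
      by (auto simp: wact_def ascent_def of_bool_def split: if_splits)
  next
    case False
    then have i: "i \<in> {1..<n}" using assms(2) by auto
    then show ?thesis using inversions_swap[OF i, of x] ne[of i "Suc i"] False
      by (auto simp: wact_def ascent_def of_bool_def split: if_splits)
  qed
  then show "ascent n x i \<Longrightarrow> inversions n (wact n i x) = Suc (inversions n x)"
    "\<not> ascent n x i \<Longrightarrow> inversions n x = Suc (inversions n (wact n i x))" by blast+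
qed

lemma inversions_rvec: "inversions n (rvec n) = 0"
  unfolding inversions_def by (auto simp: rvec_def pairs_def intro!: sum.neutral)

lemma inversions_le_length:
  "set is \<subseteq> {1..n} \<Longrightarrow> inversions n (wacts n is (rvec n)) \<le> length is"
proof (induction "is")
  case (Cons i "is")
  then show ?case using inversions_wact[of "is" n i]
    by (cases "ascent n (wacts n is (rvec n)) i") auto
qed (simp add: inversions_rvec)

lemma increasing_self_map:
  assumes "\<And>k. k \<in> {1..n} \<Longrightarrow> \<pi> k \<in> {1..n}" "\<And>k. k \<in> {1..<n} \<Longrightarrow> \<pi> k < \<pi> (Suc k)" "k \<in> {1..n}"
  shows "\<pi> k = (k::nat)"
proof (rule antisym)
  have "1 \<le> k" "k \<le> n" using assms(3) by auto
  show "k \<le> \<pi> k" using \<open>1 \<le> k\<close> \<open>k \<le> n\<close>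
  proof (induction k rule: dec_induct)
    case base
    then show ?case using assms(1)[of 1] by auto
  next
    case (step k)
    then show ?case using assms(2)[of k] by auto
  qed
  show "\<pi> k \<le> k" using \<open>k \<le> n\<close> \<open>1 \<le> k\<close>
  proof (induction k rule: inc_induct)
    case base
    then show ?case using assms(1)[of n] by auto
  next
    case (step k)
    then show ?case using assms(2)[of k] by auto
  qed
qed

text \<open>For s = 1 this is the dominant chamber, for s = -1 the antidominant one. Constant sign
  forces the permutation to be increasing, hence to be the identity.\<close>

lemma monotone_signed_perm:
  assumes "set is \<subseteq> {1..n}" "s = 1 \<or> s = - 1"
  defines "x \<equiv> wacts n is (rvec n)"
  assumes "\<And>k. k \<in> {1..n} \<Longrightarrow> s * x k > 0" "\<And>k. k \<in> {1..<n} \<Longrightarrow> s * x (Suc k) < s * x k"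
  shows "x = (\<lambda>k. s * rvec n k)"
proof -
  obtain \<sigma> \<pi> where *: "\<And>k. k \<in> {1..n} \<Longrightarrow> \<sigma> k = 1 \<or> \<sigma> k = - 1" "\<And>k. k \<in> {1..n} \<Longrightarrow> \<pi> k \<in> {1..n}"
    "\<And>k. k \<in> {1..n} \<Longrightarrow> x k = \<sigma> k * rvec n (\<pi> k)"
    using wacts_signed_perm[OF assms(1)] unfolding x_def by blast
  have \<sigma>: "\<sigma> k = s" if "k \<in> {1..n}" for k
    using *(1-3)[OF that] assms(4)[OF that] assms(2) by (auto simp: rvec_def)
  have "\<pi> k = k" if "k \<in> {1..n}" for k
  proof (rule increasing_self_map[OF *(2) _ that])
    fix k assume k: "k \<in> {1..<n}"
    then show "\<pi> k < \<pi> (Suc k)"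
      using *(2,3)[of k] *(2,3)[of "Suc k"] \<sigma>[of k] \<sigma>[of "Suc k"] assms(5)[OF k] assms(2)
      by (auto simp: rvec_def)
  qed auto
  then have "x k = s * rvec n k" if "k \<in> {1..n}" for k using *(3)[OF that] \<sigma>[OF that] that by simp
  moreover have "x k = s * rvec n k" if "k \<notin> {1..n}" for k
    using wacts_outside[OF assms(1) that] that by (auto simp: x_def rvec_def)
  ultimately show ?thesis by blast
qed

lemma all_ascents:
  assumes "set is \<subseteq> {1..n}" "\<And>i. i \<in> {1..n} \<Longrightarrow> ascent n (wacts n is (rvec n)) i"
  shows "wacts n is (rvec n) = rvec n"
proof -
  let ?x = "wacts n is (rvec n)"
  have dec: "?x (Suc k) < ?x k" if "k \<in> {1..<n}" for k
    using assms(2)[of k] that by (auto simp: ascent_def)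
  have pos: "?x k > 0" if "k \<in> {1..n}" for k
  proof -
    have "k \<le> n" "1 \<le> k" using that by auto
    then show ?thesis
    proof (induction k rule: inc_induct)
      case base
      then show ?case using assms(2)[of n] by (auto simp: ascent_def)
    next
      case (step k)
      then show ?case using dec[of k] by force
    qed
  qed
  show ?thesis using monotone_signed_perm[OF assms(1), of 1] dec pos by simp
qed

lemma no_ascents:
  assumes "set is \<subseteq> {1..n}" "\<And>i. i \<in> {1..n} \<Longrightarrow> \<not> ascent n (wacts n is (rvec n)) i"
  shows "wacts n is (rvec n) = (\<lambda>k. - rvec n k)"
proof -
  let ?x = "wacts n is (rvec n)"
  obtain \<sigma> \<pi> where *: "\<And>k. k \<in> {1..n} \<Longrightarrow> \<sigma> k = 1 \<or> \<sigma> k = - 1" "\<And>k. k \<in> {1..n} \<Longrightarrow> \<pi> k \<in> {1..n}"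
    "inj_on \<pi> {1..n}" "\<And>k. k \<in> {1..n} \<Longrightarrow> ?x k = \<sigma> k * rvec n (\<pi> k)"
    using wacts_signed_perm[OF assms(1)] by blast
  have inc: "?x (Suc k) > ?x k" if "k \<in> {1..<n}" for k
  proof -
    have "?x k \<noteq> ?x (Suc k)"
    proof
      assume "?x k = ?x (Suc k)"
      then have "\<pi> k = \<pi> (Suc k)"
        using rvec_sign_inj[of "\<sigma> k" n "\<pi> k" "\<sigma> (Suc k)" "\<pi> (Suc k)"] * that by auto
      then show False using inj_onD[OF *(3), of k "Suc k"] that by auto
    qed
    then show ?thesis using assms(2)[of k] that by (auto simp: ascent_def)
  qed
  have neg: "?x k < 0" if "k \<in> {1..n}" for k
  proof -
    have "k \<le> n" "1 \<le> k" using that by auto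
    then show ?thesis
    proof (induction k rule: inc_induct)
      case base
      then have "?x n \<le> 0" and "n \<in> {1..n}" using assms(2)[of n] by (auto simp: ascent_def)
      moreover have "?x n \<noteq> 0"
        using *(1,4)[of n] rvec_pos[OF *(2)[of n]] \<open>n \<in> {1..n}\<close> by auto
      ultimately show ?case by simp
    next
      case (step k)
      then show ?case using inc[of k] by force
    qed
  qed
  show ?thesis using monotone_signed_perm[OF assms(1), of "-1"] inc neg by simp
qed

lemma wact_involutive: "n \<ge> 1 \<Longrightarrow> wact n i (wact n i x) = x"
  by (auto simp: wact_def)

text \<open>Sorting: applying a letter that is not an ascent lowers the number of inversions by one,
  and a vector all of whose letters are ascents is already \<open>rvec\<close>.\<close>

lemma exists_inversions_word:
  assumes "set is \<subseteq> {1..n}"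
  shows "\<exists>js. set js \<subseteq> {1..n} \<and> wacts n js (rvec n) = wacts n is (rvec n) \<and>
    length js = inversions n (wacts n is (rvec n))"
  using assms
proof (induction "inversions n (wacts n is (rvec n))" arbitrary: "is" rule: less_induct)
  case less
  let ?x = "wacts n is (rvec n)"
  show ?case
  proof (cases "\<forall>i\<in>{1..n}. ascent n ?x i")
    case True
    then have "?x = rvec n" using less.prems by (intro all_ascents) auto
    then show ?thesis by (intro exI[of _ "[]"]) (simp add: inversions_rvec)
  next
    case False
    then obtain i where i: "i \<in> {1..n}" "\<not> ascent n ?x i" by blast
    then have inv: "inversions n ?x = Suc (inversions n (wacts n (i # is) (rvec n)))"
      using inversions_wact(2)[OF less.prems i(1)] by simp
    then obtain js where js: "set js \<subseteq> {1..n}" "wacts n js (rvec n) = wacts n (i # is) (rvec n)"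
      "length js = inversions n (wacts n (i # is) (rvec n))"
      using less.hyps[of "i # is"] less.prems i by auto
    have "n \<ge> 1" using i by auto
    then have "wacts n (i # js) (rvec n) = ?x" using js(2) by (simp add: wact_involutive)
    then show ?thesis using js i inv by (intro exI[of _ "i # js"]) simp
  qed
qed

lemma weyl_length_word:
  assumes "set is \<subseteq> {1..n}"
  shows "weyl_length n (word_elt n is) = inversions n (wacts n is (rvec n))"
  unfolding weyl_length_def
proof (rule Least_equality)
  obtain js where js: "set js \<subseteq> {1..n}" "wacts n js (rvec n) = wacts n is (rvec n)"
    "length js = inversions n (wacts n is (rvec n))" using exists_inversions_word[OF assms] by blast
  then have "word_elt n js = word_elt n is" using word_elt_eq_iff assms by blast
  then show "\<exists>js. set js \<subseteq> {1..n} \<and> word_elt n js = word_elt n is \<and>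
    length js = inversions n (wacts n is (rvec n))" using js by blast
next
  fix l assume "\<exists>js. set js \<subseteq> {1..n} \<and> word_elt n js = word_elt n is \<and> length js = l"
  then obtain js where js: "set js \<subseteq> {1..n}" "word_elt n js = word_elt n is" "length js = l" by blast
  then have "wacts n js (rvec n) = wacts n is (rvec n)" using word_elt_eq_iff assms by blast
  then show "inversions n (wacts n is (rvec n)) \<le> l" using inversions_le_length[OF js(1)] js(3) by simp
qed

lemma inversions_max: "inversions n x \<le> inversions n (\<lambda>k. - rvec n k)"
  unfolding inversions_def
  by (intro add_mono sum_mono) (auto simp: rvec_def pairs_def of_bool_def)

text \<open>Words are prolonged by ascents as long as there are any. The bound
  \<open>inversions_max\<close> makes this stop, and it stops at the negative of
  \<open>rvec\<close>.\<close>

lemma exists_longest_word: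
  "\<exists>is. set is \<subseteq> {1..n} \<and> wacts n is (rvec n) = (\<lambda>k. - rvec n k)"
proof -
  have "\<exists>js. set js \<subseteq> {1..n} \<and> wacts n js (rvec n) = (\<lambda>k. - rvec n k)" if "set is \<subseteq> {1..n}" for "is"
    using that
  proof (induction "inversions n (\<lambda>k. - rvec n k) - inversions n (wacts n is (rvec n))"
      arbitrary: "is" rule: less_induct)
    case less
    let ?x = "wacts n is (rvec n)"
    show ?case
    proof (cases "\<exists>i\<in>{1..n}. ascent n ?x i")
      case True
      then obtain i where i: "i \<in> {1..n}" "ascent n ?x i" by blast
      have "inversions n (wacts n (i # is) (rvec n)) = Suc (inversions n ?x)"
        using inversions_wact(1)[OF less.prems i(1)] i(2) by simp
      then show ?thesis
        using less.hyps[of "i # is"] less.prems i inversions_max[of n "wacts n (i # is) (rvec n)"]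
        by auto
    next
      case False
      then show ?thesis using no_ascents[OF less.prems] less.prems by blast
    qed
  qed
  from this[of "[]"] show ?thesis by simp
qed

section \<open>The longest element and reduced words\<close>

lemma longest_elt_word:
  obtains "is" where "set is \<subseteq> {1..n}" "longest_elt n = word_elt n is"
    "wacts n is (rvec n) = (\<lambda>k. - rvec n k)"
proof -
  obtain "is" where w: "set is \<subseteq> {1..n}" "wacts n is (rvec n) = (\<lambda>k. - rvec n k)"
    using exists_longest_word by blast
  have "longest_elt n = word_elt n is"
    unfolding longest_elt_def
  proof (rule the_equality)
    have "weyl_length n w' \<le> weyl_length n (word_elt n is)" if "w' \<in> weyl_group n" for w'
      using that w inversions_max by (auto simp: weyl_group_def weyl_length_word)
    then show "word_elt n is \<in> weyl_group n \<and>
      (\<forall>w'\<in>weyl_group n. weyl_length n w' \<le> weyl_length n (word_elt n is))"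
      using w by (auto simp: weyl_group_def)
  next
    fix w' assume w': "w' \<in> weyl_group n \<and> (\<forall>w''\<in>weyl_group n. weyl_length n w'' \<le> weyl_length n w')"
    then obtain js where js: "set js \<subseteq> {1..n}" "w' = word_elt n js" by (auto simp: weyl_group_def)
    \<comment> \<open>An element of maximal length cannot be prolonged, so it has no ascents and
      sends \<open>rvec\<close> to its negative; this gives uniqueness.\<close>
    have max: "weyl_length n (word_elt n (i # js)) \<le> weyl_length n (word_elt n js)" if "i \<in> {1..n}" for i
    proof -
      have "word_elt n (i # js) \<in> weyl_group n"
        unfolding weyl_group_def using that js(1) by (intro CollectI exI[of _ "i # js"]) auto
      then show ?thesis using w' js(2) by blast
    qed
    have "\<not> ascent n (wacts n js (rvec n)) i" if "i \<in> {1..n}" for i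
    proof
      assume "ascent n (wacts n js (rvec n)) i"
      then have "inversions n (wacts n (i # js) (rvec n)) = Suc (inversions n (wacts n js (rvec n)))"
        using inversions_wact(1)[OF js(1) that] by simp
      then show False using max[OF that] weyl_length_word[of "i # js" n] weyl_length_word[OF js(1)] js(1) that
        by simp
    qed
    then have "wacts n js (rvec n) = (\<lambda>k. - rvec n k)" using no_ascents[OF js(1)] by blast
    then show "w' = word_elt n is" using w js word_elt_eq_iff by metis
  qed
  then show thesis using that w by blast
qed

text \<open>For the image of \<open>rvec\<close> under w this is the state of the spin weight w
  Lambda_n, since both start with positive coordinates only.\<close>

definition negs :: "nat \<Rightarrow> (nat \<Rightarrow> int) \<Rightarrow> nat set" where
  "negs n x = {k \<in> {1..n}. x k < 0}"

lemma negs_rvec: "negs n (rvec n) = {}"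
  by (auto simp: negs_def rvec_def)

lemma negs_subset: "negs n x \<subseteq> {1..n}"
  by (auto simp: negs_def)

text \<open>At an ascent i < n the entries at \<open>i\<close> and i + 1 are decreasing, which
  excludes a minus sign followed by a plus sign; at i = n the entry is positive.\<close>

lemma negs_wact:
  assumes "i \<in> {1..n}" "ascent n x i"
  shows "\<not> raisable n i (negs n x)"
    "negs n (wact n i x) = (if lowerable n i (negs n x) then lowered n i (negs n x) else negs n x)"
proof -
  show "\<not> raisable n i (negs n x)"
    using assms by (auto simp: ascent_def raisable_def negs_def split: if_splits)
  show "negs n (wact n i x) = (if lowerable n i (negs n x) then lowered n i (negs n x) else negs n x)"
  proof (cases "i = n")
    case True
    then show ?thesis using assms by (auto simp: ascent_def lowerable_def lowered_def negs_def wact_def)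
  next
    case False
    then have "Suc i \<in> {1..n}" using assms by auto
    then show ?thesis using assms False
      by (auto simp: ascent_def lowerable_def lowered_def negs_def wact_def)
  qed
qed

text \<open>Reducedness of the word, in a form that passes to its tails.\<close>

definition ascending :: "nat \<Rightarrow> nat list \<Rightarrow> bool" where
  "ascending n is \<longleftrightarrow> set is \<subseteq> {1..n} \<and> inversions n (wacts n is (rvec n)) = length is"

lemma ascending_Cons:
  assumes "ascending n (i # is)"
  shows "ascending n is" "i \<in> {1..n}" "ascent n (wacts n is (rvec n)) i"
proof -
  have s: "set is \<subseteq> {1..n}" "i \<in> {1..n}" using assms by (auto simp: ascending_def)
  have "inversions n (wacts n (i # is) (rvec n)) = Suc (length is)" using assms by (simp add: ascending_def)
  with inversions_wact[OF s] inversions_le_length[OF s(1)]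
  show "ascending n is" "ascent n (wacts n is (rvec n)) i"
    using s by (auto simp: ascending_def) (metis Suc_leI Suc_n_not_le_n le_SucI le_antisym nat.inject)+
  show "i \<in> {1..n}" by (rule s)
qed

text \<open>The lift uses a reduced word picked by \<open>SOME\<close>, so its properties are shown
  for all reduced words of w_0 s_n.\<close>

lemma reduced_expr_longest_refl:
  assumes "n \<ge> 1"
  defines "w \<equiv> longest_elt n \<circ> simple_refl n n"
  shows "reduced_expr n w (SOME is. reduced_expr n w is)"
    "reduced_expr n w is \<Longrightarrow> ascending n is"
    "reduced_expr n w is \<Longrightarrow> negs n (wacts n is (rvec n)) = {1..<n}"
proof -
  obtain js where js: "set js \<subseteq> {1..n}" "longest_elt n = word_elt n js"
    "wacts n js (rvec n) = (\<lambda>k. - rvec n k)" by (rule longest_elt_word)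
  let ?ks = "js @ [n]"
  have ks: "set ?ks \<subseteq> {1..n}" "w = word_elt n ?ks"
    using js assms by (auto simp: w_def word_elt_append)
  obtain ls where ls: "set ls \<subseteq> {1..n}" "wacts n ls (rvec n) = wacts n ?ks (rvec n)"
    "length ls = inversions n (wacts n ?ks (rvec n))" using exists_inversions_word[OF ks(1)] by blast
  have "reduced_expr n w ls"
    unfolding reduced_expr_def using ls ks word_elt_eq_iff[OF ls(1) ks(1)] weyl_length_word[OF ks(1)] by simp
  then show "reduced_expr n w (SOME is. reduced_expr n w is)" by (rule someI)
  assume red: "reduced_expr n w is"
  then have "is": "set is \<subseteq> {1..n}" "word_elt n is = word_elt n ?ks"
    "length is = inversions n (wacts n ?ks (rvec n))"
    using ks weyl_length_word[OF ks(1)] by (simp_all add: reduced_expr_def)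
  then have eq: "wacts n is (rvec n) = wacts n ?ks (rvec n)" using word_elt_eq_iff ks(1) by blast
  then show "ascending n is" using "is" by (simp add: ascending_def)
  obtain \<sigma> \<pi> where *: "\<And>k. k \<in> {1..n} \<Longrightarrow> \<sigma> k = 1 \<or> \<sigma> k = - 1" "\<And>k. k \<in> {1..n} \<Longrightarrow> \<pi> k \<in> {1..n}"
    "\<And>x k. k \<in> {1..n} \<Longrightarrow> wacts n js x k = \<sigma> k * x (\<pi> k)"
    using wacts_signed_perm[OF js(1)] by blast
  \<comment> \<open>The longest element acts as -1 on every vector, as its effect on
    \<open>rvec\<close> already shows.\<close>
  have "wacts n js x k = - x k" if "k \<in> {1..n}" for x k
  proof -
    have "\<sigma> k * rvec n (\<pi> k) = - 1 * rvec n k" using *(3)[OF that, of "rvec n"] js(3) by simp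
    then have "\<sigma> k = - 1 \<and> \<pi> k = k" using rvec_sign_inj *(1,2)[OF that] that by blast
    then show ?thesis using *(3)[OF that] by simp
  qed
  \<comment> \<open>The last letter of \<open>?ks\<close> makes the coordinate \<open>n\<close>
    negative and the longest element then changes all signs, so exactly the first n - 1 coordinates
    become negative.\<close>
  then show "negs n (wacts n is (rvec n)) = {1..<n}"
    unfolding eq wacts_append negs_def by (auto simp: wact_def rvec_def split: if_splits)
qed

lemma reduced_expr_id: "(SOME is. reduced_expr n id is) = []"
proof -
  have "weyl_length n id = 0"
    using weyl_length_word[of "[]" n] by (simp add: inversions_rvec)
  then have "reduced_expr n id is \<longleftrightarrow> is = []" for "is"
    by (auto simp: reduced_expr_def)
  then show ?thesis by simp
qed

section \<open>Triangles and labels\<close>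

text \<open>The triangle whose label increases exactly at the rows in \<open>R\<close>.\<close>

definition tri :: "nat \<Rightarrow> nat set \<Rightarrow> nat \<Rightarrow> nat \<Rightarrow> nat" where
  "tri n R l k = (if 1 \<le> k \<and> k \<le> l \<and> l \<le> n then if k \<le> card (R \<inter> {1..l}) then k else k + 1 else 0)"

lemma card_Int_Suc:
  "card (R \<inter> {1..Suc l}) = card (R \<inter> {1..l}) + (if Suc l \<in> R then 1 else 0)"
proof -
  have "R \<inter> {1..Suc l} = (if Suc l \<in> R then insert (Suc l) (R \<inter> {1..l}) else R \<inter> {1..l})"
    by (auto simp: le_Suc_eq)
  then show ?thesis by simp
qed

lemma card_Int_le: "card (R \<inter> {1..l}) \<le> l"
  using card_mono[of "{1..l}" "R \<inter> {1..l}"] by simp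

lemma map_skip_upt:
  assumes "1 \<le> s" "s \<le> Suc l"
  shows "map (\<lambda>k. if k < s then k else Suc k) [1..<Suc l] = filter (\<lambda>x. x \<noteq> s) [1..<l + 2]"
proof -
  have 1: "[1..<Suc l] = [1..<s] @ [s..<Suc l]"
    using upt_add_eq_append[of 1 s "Suc l - s"] assms by simp
  have "[s..<l + 2] = s # [Suc s..<l + 2]" using assms by (simp add: upt_rec)
  moreover have "[1..<l + 2] = [1..<s] @ [s..<l + 2]"
    using upt_add_eq_append[of 1 s "l + 2 - s"] assms by simp
  ultimately have 2: "[1..<l + 2] = [1..<s] @ s # [Suc s..<l + 2]" by simp
  have "filter (\<lambda>x. x \<noteq> s) [1..<s] = [1..<s]" "filter (\<lambda>x. x \<noteq> s) [Suc s..<l + 2] = [Suc s..<l + 2]"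
    by (auto simp: filter_id_conv)
  moreover have "map (\<lambda>k. if k < s then k else Suc k) [1..<s] = [1..<s]"
    by (auto intro: map_idI)
  moreover have "map (\<lambda>k. if k < s then k else Suc k) [s..<Suc l] = map Suc [s..<Suc l]"
    by (rule map_cong) auto
  moreover have "map Suc [s..<Suc l] = [Suc s..<l + 2]" by (simp add: map_Suc_upt del: upt_Suc)
  ultimately show ?thesis unfolding 1 2 by (simp del: upt_Suc)
qed

lemma row_label_tri:
  assumes "l \<le> n"
  shows "row_label (tri n R) l = 1 + card (R \<inter> {1..l})"
proof -
  let ?s = "1 + card (R \<inter> {1..l})"
  have s: "1 \<le> ?s" "?s \<le> Suc l" using card_Int_le[of R l] by simp_all
  have "map (tri n R l) [1..<Suc l] = map (\<lambda>k. if k < ?s then k else Suc k) [1..<Suc l]"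
    using assms by (intro map_cong) (auto simp: tri_def)
  also have "\<dots> = filter (\<lambda>x. x \<noteq> ?s) [1..<l + 2]" by (rule map_skip_upt[OF s])
  finally have "rev (map (tri n R l) [1..<Suc l]) = rev (filter (\<lambda>x. x \<noteq> ?s) [1..<l + 2])" by (rule arg_cong)
  then have row: "row (tri n R) l = filter (\<lambda>x. x \<noteq> ?s) (rev [1..<l + 2])"
    by (simp only: row_def rev_map rev_filter)
  show ?thesis
    unfolding row_label_def
  proof (rule the_equality)
    show "?s \<in> {1..l + 1} \<and> row (tri n R) l = filter (\<lambda>x. x \<noteq> ?s) (rev [1..<l + 2])"
      using s row by simp
  next
    fix s' assume s': "s' \<in> {1..l + 1} \<and> row (tri n R) l = filter (\<lambda>x. x \<noteq> s') (rev [1..<l + 2])"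
    then have "set (filter (\<lambda>x. x \<noteq> s') (rev [1..<l + 2])) = set (filter (\<lambda>x. x \<noteq> ?s) (rev [1..<l + 2]))"
      using row by simp
    then have "{x \<in> {1..<l + 2}. x \<noteq> s'} = {x \<in> {1..<l + 2}. x \<noteq> ?s}"
      by (simp only: set_filter set_rev set_upt)
    then have "?s \<notin> {x \<in> {1..<l + 2}. x \<noteq> s'}" by (simp only: mem_Collect_eq) simp
    then show "s' = ?s" using s by auto
  qed
qed

lemma label_tri:
  assumes "n \<ge> 2"
  shows "k \<le> n \<Longrightarrow> label n (tri n R) k = 1 + card (R \<inter> {1..k})"
    "label n (tri n R) (Suc n) = 2 + card (R \<inter> {1..n - 1})"
  using assms row_label_tri[of k n R] row_label_tri[of "n - 1" n R] by (auto simp: label_def)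

text \<open>The convention s_{n+1} = s_{n-1} + 1 leaves only types I and IV for row
  \<open>n\<close>, decided by whether \<open>n\<close> is in \<open>R\<close>. This is the clause i
  = n of \<open>lowerable\<close> and \<open>raisable\<close>.\<close>

lemma type_tri:
  assumes "n \<ge> 2" "k \<in> {1..n}"
  shows "type_I n (tri n R) k \<longleftrightarrow> lowerable n k R" "type_IV n (tri n R) k \<longleftrightarrow> raisable n k R"
proof -
  obtain j where j: "k = Suc j" using assms(2) by (cases k) auto
  have 1: "label n (tri n R) k = 1 + card (R \<inter> {1..j}) + (if k \<in> R then 1 else 0)"
    "label n (tri n R) (k - 1) = 1 + card (R \<inter> {1..j})"
    using assms label_tri(1)[OF assms(1), of k R] label_tri(1)[OF assms(1), of j R] card_Int_Suc[of R j] j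
    by auto
  have 2: "label n (tri n R) (k + 1) = (if k = n then 2 + card (R \<inter> {1..j})
      else label n (tri n R) k + (if Suc k \<in> R then 1 else 0))"
    using assms label_tri[OF assms(1)] card_Int_Suc[of R k] j by auto
  show "type_I n (tri n R) k \<longleftrightarrow> lowerable n k R" "type_IV n (tri n R) k \<longleftrightarrow> raisable n k R"
    unfolding type_I_def type_IV_def 2 1 by (auto simp: lowerable_def raisable_def)
qed

lemma tri_monomial_bar_tri:
  assumes "n \<ge> 2" "R \<subseteq> {1..n}"
  shows "tri_monomial_bar n (tri n R) c = (\<Prod>k\<in>{1..n}. row_factor n R (c (n - card (R \<inter> {..k})) k) k)"
proof -
  let ?\<delta> = "tri n R"
  have lab: "n + 1 - label n ?\<delta> k = n - card (R \<inter> {..k})" if "k \<in> {1..n}" for k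
  proof -
    have "R \<inter> {..k} = R \<inter> {1..k}" using assms(2) by auto
    then show ?thesis using label_tri(1)[OF assms(1), of k R] that by simp
  qed
  have "tri_monomial_bar n ?\<delta> c =
     (\<Prod>i\<in>{1..n}. if type_I n ?\<delta> i then inverse (c (n + 1 - label n ?\<delta> i) i) else 1) *
     (\<Prod>i\<in>{1..n}. if type_IV n ?\<delta> i then inverse (inverse (c (n + 1 - label n ?\<delta> i) i)) else 1)"
    unfolding tri_monomial_bar_def tri_monomial_def by (simp only: prod.inter_filter[OF finite_atLeastAtMost])
  also have "\<dots> = (\<Prod>k\<in>{1..n}. row_factor n R (c (n - card (R \<inter> {..k})) k) k)"
    unfolding prod.distrib[symmetric]
  proof (rule prod.cong[OF refl])
    fix k assume k: "k \<in> {1..n}"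
    show "(if type_I n ?\<delta> k then inverse (c (n + 1 - label n ?\<delta> k) k) else 1) *
      (if type_IV n ?\<delta> k then inverse (inverse (c (n + 1 - label n ?\<delta> k) k)) else 1) =
      row_factor n R (c (n - card (R \<inter> {..k})) k) k"
      unfolding type_tri[OF assms(1) k] lab[OF k] by (auto simp: row_factor_def lowerable_def raisable_def)
  qed
  finally show ?thesis .
qed

section \<open>Bijection between triangles and subsets\<close>

lemma tri_mem_triangles: "tri n R \<in> triangles n"
proof -
  have "1 \<le> tri n R (Suc l) k \<and> tri n R (Suc l) k \<le> tri n R l k \<and>
     tri n R l k < tri n R (Suc l) (Suc k) \<and> tri n R (Suc l) (Suc k) \<le> n + 1"
    if "1 \<le> k" "k \<le> l" "l < n" for l k
    using that card_Int_Suc[of R l] by (auto simp: tri_def)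
  then show ?thesis by (auto simp: triangles_def tri_def)
qed

lemma tri_inj:
  assumes "R \<subseteq> {1..n}" "R' \<subseteq> {1..n}" "tri n R = tri n R'"
  shows "R = R'"
proof -
  have eq: "card (R \<inter> {1..l}) = card (R' \<inter> {1..l})" if "l \<le> n" for l
    using row_label_tri[OF that, of R] row_label_tri[OF that, of R'] assms(3) by simp
  have "k \<in> R \<longleftrightarrow> k \<in> R'" if k: "k \<in> {1..n}" for k
  proof -
    obtain j where j: "k = Suc j" using k by (cases k) auto
    have "(if Suc j \<in> R then 1 else 0 :: nat) = (if Suc j \<in> R' then 1 else 0)"
      using eq[of "Suc j"] eq[of j] k unfolding card_Int_Suc j by simp
    then show ?thesis unfolding j by (simp split: if_splits)
  qed
  then show ?thesis using assms(1,2) by blast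
qed

lemma tri_full: "tri n {1..n} = lowest_triangle n"
proof (intro ext)
  fix l k
  have "{1..n} \<inter> {1..l} = {1..l}" if "l \<le> n" using that by auto
  then show "tri n {1..n} l k = lowest_triangle n l k"
    by (auto simp: tri_def lowest_triangle_def)
qed

text \<open>Every entry is \<open>k\<close> or k + 1, and in row \<open>l\<close> the entries equal
  to \<open>k\<close> form an initial segment of length \<open>a l\<close>. From one row to the next
  this length grows by 0 or 1, and \<open>R\<close> records where it grows.\<close>

lemma tri_surj:
  assumes n: "n \<ge> 2" and \<delta>: "\<delta> \<in> triangles n"
  shows "\<exists>R. R \<subseteq> {1..n} \<and> \<delta> = tri n R"
proof -
  have out: "\<delta> l k = 0" if "\<not> (1 \<le> k \<and> k \<le> l \<and> l \<le> n)" for l k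
    using \<delta> that unfolding triangles_def by blast
  have D: "1 \<le> \<delta> (Suc l) k" "\<delta> (Suc l) k \<le> \<delta> l k" "\<delta> l k < \<delta> (Suc l) (Suc k)" "\<delta> (Suc l) (Suc k) \<le> n + 1"
    if "1 \<le> k" "k \<le> l" "l < n" for l k
    using \<delta> that unfolding triangles_def by blast+
  have inc: "\<delta> l k < \<delta> l (Suc k)" if "1 \<le> k" "Suc k \<le> l" "l \<le> n" for l k
    using D(2)[of k "l - 1"] D(3)[of k "l - 1"] that by (cases l) auto
  have up_n: "\<delta> n k \<le> Suc k" if "1 \<le> k" "k \<le> n" for k
    using \<open>k \<le> n\<close> \<open>1 \<le> k\<close>
  proof (induction k rule: inc_induct)
    case base
    then show ?case using D(4)[of "n - 1" "n - 1"] n by (cases n) auto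
  next
    case (step k)
    then show ?case using inc[of k n] by auto
  qed
  have lo_n: "k \<le> \<delta> n k" if "1 \<le> k" "k \<le> n" for k
    using \<open>1 \<le> k\<close> \<open>k \<le> n\<close>
  proof (induction k rule: dec_induct)
    case base
    then show ?case using D(1)[of 1 "n - 1"] n by (cases n) auto
  next
    case (step k)
    then show ?case using inc[of k n] by auto
  qed
  \<comment> \<open>The last row is strictly increasing with values from 1 to n + 1, so it satisfies
    the bounds; interlacing carries them to the shorter rows.\<close>
  have bounds: "k \<le> \<delta> l k \<and> \<delta> l k \<le> Suc k" if "1 \<le> k" "k \<le> l" "l \<le> n" for l k
    using \<open>l \<le> n\<close> \<open>1 \<le> k\<close> \<open>k \<le> l\<close>
  proof (induction l arbitrary: k rule: inc_induct)
    case base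
    then show ?case using up_n lo_n by auto
  next
    case (step l)
    then show ?case using D(2,3)[of k l] step.IH[of k] step.IH[of "Suc k"] by fastforce
  qed
  define P where "P l = {k \<in> {1..l}. \<delta> l k = k}" for l
  define a where "a l = card (P l)" for l
  have P: "P l = {1..a l}" if "l \<le> n" for l
  proof -
    have down: "k \<in> P l" if "Suc k \<in> P l" "1 \<le> k" for k
      using that inc[of k l] bounds[of k l] \<open>l \<le> n\<close> by (auto simp: P_def)
    \<comment> \<open>The inserted 0 gives the maximum a value when no entry of the row equals its
      index.\<close>
    have "P l = {1..Max (insert 0 (P l))}"
    proof
      show "P l \<subseteq> {1..Max (insert 0 (P l))}"
        by (auto simp: P_def)
      have "k \<in> P l" if "1 \<le> k" "k \<le> Max (insert 0 (P l))" for k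
        using that(2,1)
      proof (induction k rule: inc_induct)
        case base
        then have "Max (insert 0 (P l)) \<noteq> 0" by simp
        moreover have "Max (insert 0 (P l)) \<in> insert 0 (P l)" by (rule Max_in) (auto simp: P_def)
        ultimately show ?case by (metis insertE)
      next
        case (step k)
        then show ?case using down by auto
      qed
      then show "{1..Max (insert 0 (P l))} \<subseteq> P l" by auto
    qed
    then show ?thesis by (metis a_def card_atLeastAtMost diff_Suc_1)
  qed
  have a0: "a 0 = 0" by (simp add: a_def P_def)
  have a_step: "a l \<le> a (Suc l) \<and> a (Suc l) \<le> Suc (a l)" if "l < n" for l
  proof
    have "P l \<subseteq> P (Suc l)"
    proof
      fix k assume "k \<in> P l"
      then show "k \<in> P (Suc l)"
        using D(2)[of k l] bounds[of k "Suc l"] that by (auto simp: P_def)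
    qed
    then show "a l \<le> a (Suc l)" unfolding a_def by (intro card_mono) (auto simp: P_def)
    show "a (Suc l) \<le> Suc (a l)"
    proof (cases "a (Suc l) \<le> 1")
      case False
      then obtain k where k: "a (Suc l) = Suc k" "1 \<le> k" by (cases "a (Suc l)") auto
      then have "Suc k \<in> P (Suc l)" using P[of "Suc l"] that by auto
      then have "k \<in> P l" using D(3)[of k l] bounds[of k l] k that by (auto simp: P_def)
      then show ?thesis using P[of l] that k by auto
    qed simp
  qed
  define R where "R = {l \<in> {1..n}. a l = Suc (a (l - 1))}"
  have card_R: "card (R \<inter> {1..l}) = a l" if "l \<le> n" for l
    using that
  proof (induction l)
    case (Suc l)
    then show ?case using a_step[of l] unfolding card_Int_Suc by (auto simp: R_def)
  qed (simp add: a0)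
  have "\<delta> l k = tri n R l k" for l k
  proof (cases "1 \<le> k \<and> k \<le> l \<and> l \<le> n")
    case True
    then have "k \<le> a l \<longleftrightarrow> \<delta> l k = k" using P[of l] by (auto simp: P_def set_eq_iff)
    then show ?thesis using True bounds[of k l] card_R[of l] by (auto simp: tri_def)
  next
    case False
    then show ?thesis using out by (auto simp: tri_def)
  qed
  then have "\<delta> = tri n R" by blast
  moreover have "R \<subseteq> {1..n}" by (auto simp: R_def)
  ultimately show ?thesis by blast
qed

lemma tri_bij:
  assumes "n \<ge> 2"
  shows "bij_betw (tri n) {R. R \<subseteq> {1..n} \<and> card R < n} (triangles n - {lowest_triangle n})"
proof (rule bij_betw_imageI)
  show "inj_on (tri n) {R. R \<subseteq> {1..n} \<and> card R < n}"
    using tri_inj by (auto simp: inj_on_def)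
  show "tri n ` {R. R \<subseteq> {1..n} \<and> card R < n} = triangles n - {lowest_triangle n}"
  proof (intro equalityI subsetI)
    fix \<delta> assume "\<delta> \<in> tri n ` {R. R \<subseteq> {1..n} \<and> card R < n}"
    then obtain R where R: "R \<subseteq> {1..n}" "card R < n" "\<delta> = tri n R" by blast
    then have "tri n R \<noteq> tri n {1..n}" using tri_inj[of R n "{1..n}"] by auto
    then show "\<delta> \<in> triangles n - {lowest_triangle n}"
      using R tri_mem_triangles tri_full by auto
  next
    fix \<delta> assume \<delta>: "\<delta> \<in> triangles n - {lowest_triangle n}"
    then obtain R where R: "R \<subseteq> {1..n}" "\<delta> = tri n R" using tri_surj[OF assms] by blast
    then have "R \<noteq> {1..n}" using \<delta> tri_full by auto
    then have "card R < n" using R psubset_card_mono[of "{1..n}" R] by auto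
    then show "\<delta> \<in> tri n ` {R. R \<subseteq> {1..n} \<and> card R < n}" using R by blast
  qed
qed

text \<open>The path weight has an additional row 0, the start of the process. Its factor is 1 by
  the convention for \<open>c'\<close>, and inserting 0 into \<open>R\<close> does not affect the
  other rows.\<close>

lemma sum_triangles:
  assumes "n \<ge> 2" "\<And>r i. i \<ge> 1 \<Longrightarrow> c' r i = c r i" "\<And>r. c' r 0 = 1"
  shows "(\<Sum>\<delta>\<in>triangles n - {lowest_triangle n}. tri_monomial_bar n \<delta> c) =
    (\<Sum>R | R \<subseteq> {1..n} \<and> card R < n. path_weight n c' n 0 R)"
proof -
  have "(\<Sum>\<delta>\<in>triangles n - {lowest_triangle n}. tri_monomial_bar n \<delta> c) =
    (\<Sum>R | R \<subseteq> {1..n} \<and> card R < n. tri_monomial_bar n (tri n R) c)"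
    by (rule sum.reindex_bij_betw[OF tri_bij[OF assms(1)], symmetric])
  also have "\<dots> = (\<Sum>R | R \<subseteq> {1..n} \<and> card R < n. path_weight n c' n 0 R)"
  proof (rule sum.cong[OF refl])
    fix R assume "R \<in> {R. R \<subseteq> {1..n} \<and> card R < n}"
    then have R: "R \<subseteq> {1..n}" by simp
    have "{0..n} = insert 0 {1..n}" by auto
    then have "path_weight n c' n 0 R = row_factor n (insert 0 R) 1 0 *
        (\<Prod>k\<in>{1..n}. row_factor n (insert 0 R) (c' (n - card (R \<inter> {..k})) k) k)"
      unfolding path_weight_def by (simp add: assms(3))
    also have "row_factor n (insert 0 R) 1 0 = 1" by (simp add: row_factor_def)
    also have "(\<Prod>k\<in>{1..n}. row_factor n (insert 0 R) (c' (n - card (R \<inter> {..k})) k) k) =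
        (\<Prod>k\<in>{1..n}. row_factor n R (c (n - card (R \<inter> {..k})) k) k)"
      by (rule prod.cong[OF refl]) (auto simp: row_factor_def lowerable_def raisable_def assms(2))
    finally show "tri_monomial_bar n (tri n R) c = path_weight n c' n 0 R"
      using tri_monomial_bar_tri[OF assms(1) R] by simp
  qed
  finally show ?thesis .
qed

section \<open>The generalized minor\<close>

context spin_minor
begin

section \<open>The minor as a coefficient after all sweeps\<close>

definition y_sweep :: "(nat \<Rightarrow> nat \<Rightarrow> complex) \<Rightarrow> nat \<Rightarrow> nat \<Rightarrow> 'v cmat" where
  "y_sweep c r j = mat_prod (map (\<lambda>i. y_bold f h i (c r i)) [1..<Suc j])"

definition y_sweeps :: "(nat \<Rightarrow> nat \<Rightarrow> complex) \<Rightarrow> nat \<Rightarrow> 'v cmat" where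
  "y_sweeps c r = mat_prod (concat (map (\<lambda>m. map (\<lambda>i. y_bold f h i (c m i)) [1..<Suc n]) [1..<Suc r]))"

lemma y_sweep_0 [simp]: "y_sweep c r 0 = mat 1"
  by (simp add: y_sweep_def)

lemma y_sweep_Suc: "y_sweep c r (Suc j) = y_sweep c r j ** y_bold f h (Suc j) (c r (Suc j))"
  by (simp add: y_sweep_def mat_prod_append mat_prod_Cons)

lemma y_sweeps_0 [simp]: "y_sweeps c 0 = mat 1"
  by (simp add: y_sweeps_def)

lemma y_sweeps_Suc: "y_sweeps c (Suc r) = y_sweeps c r ** y_sweep c (Suc r) n"
proof -
  have "[1..<Suc (Suc r)] = [1..<Suc r] @ [Suc r]" by simp
  then show ?thesis unfolding y_sweeps_def y_sweep_def
    by (simp del: upt_Suc add: mat_prod_append)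
qed

lemma G_y_sweep: "j \<le> n \<Longrightarrow> y_sweep c r j \<in> G"
  by (induction j) (simp_all add: y_sweep_Suc mult_closed G_y_bold)

lemma G_y_sweeps: "y_sweeps c r \<in> G"
  by (induction r) (simp_all add: y_sweeps_Suc mult_closed G_y_sweep)

text \<open>The element \<open>y\<close> is the inverse lift; the hypothesis says that evaluation at
  \<open>y\<close> picks out the coefficient of \<open>phi {1..<n}\<close>. The letters are removed
  from the right end of the product, in the order in which \<open>spin_transfer\<close> consumes
  them.\<close>

lemma phi_Theta:
  assumes y: "y \<in> G" "\<And>S. S \<subseteq> {1..n} \<Longrightarrow> phi S y = (if S = {1..<n} then 1 else 0)"
    and c: "\<And>m i. m \<in> {1..n} \<Longrightarrow> i \<in> {1..n} \<Longrightarrow> c m i \<noteq> 0"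
  shows "q (y ** Theta_minus n f h c) =
    (\<Sum>\<delta>\<in>triangles n - {lowest_triangle n}. tri_monomial_bar n \<delta> c)"
proof -
  define c' where "c' r i = (if i = 0 then 1 else c r i)" for r i
  define A where "A r S = phi S (y ** y_sweeps c r)" for r S
  define B where "B r j S = phi S (y ** y_sweeps c (r - 1) ** y_sweep c r j)" for r j S
  interpret spin_transfer n c' A B
  proof
    show "n \<ge> 1" using n2 by simp
    show "c' r 0 = 1" for r by (simp add: c'_def)
    show "c' r j \<noteq> 0" if "r \<in> {1..n}" "j \<in> {1..n}" for r j using c[OF that] by (simp add: c'_def)
    show "A 0 S = (if S = {1..<n} then 1 else 0)" if "S \<subseteq> {1..n}" for S
      using y(2)[OF that] by (simp add: A_def)
    show "B r 0 S = A (r - 1) S" for r S by (simp add: A_def B_def)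
    show "A r S = B r n S" if "r \<in> {1..n}" for r S
      using that by (cases r) (simp_all add: A_def B_def y_sweeps_Suc matrix_mul_assoc)
    show "B r j S = (if lowerable n j S then inverse (c' r j) * B r (j - 1) S + B r (j - 1) (lowered n j S)
        else if raisable n j S then c' r j * B r (j - 1) S else B r (j - 1) S)"
      if rj: "r \<in> {1..n}" "j \<in> {1..n}" and S: "S \<subseteq> {1..n}" for r j S
    proof -
      obtain k where k: "j = Suc k" using rj by (cases j) auto
      let ?x = "y ** y_sweeps c (r - 1) ** y_sweep c r k"
      have x: "?x \<in> G" using y(1) k rj by (simp add: mult_closed G_y_sweeps G_y_sweep)
      have "y ** y_sweeps c (r - 1) ** y_sweep c r j = ?x ** y_bold f h j (c r j)"
        by (simp add: k y_sweep_Suc matrix_mul_assoc)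
      then show ?thesis using phi_y_bold[OF S rj(2) x c[OF rj]] k by (simp add: B_def c'_def)
    qed
  qed
  have "Theta_minus n f h c = y_sweeps c n" by (simp add: Theta_minus_def y_sweeps_def)
  then have "q (y ** Theta_minus n f h c) = A n {}" by (simp add: A_def phi_empty)
  also have "\<dots> = (\<Sum>R | R \<subseteq> {1..n} \<and> card R < n. path_weight n c' n 0 R)" by (rule A_eq_sum)
  also have "\<dots> = (\<Sum>\<delta>\<in>triangles n - {lowest_triangle n}. tri_monomial_bar n \<delta> c)"
    by (rule sum_triangles[OF n2, symmetric]) (simp_all add: c'_def)
  finally show ?thesis .
qed

section \<open>Inverses of lifted reduced words\<close>

definition lift_inv :: "nat list \<Rightarrow> 'v cmat" where
  "lift_inv is = mat_prod (map refl_inv (rev is))"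

lemma lift_inv_Cons: "lift_inv (i # is) = lift_inv is ** refl_inv i"
  by (simp add: lift_inv_def mat_prod_append mat_prod_Cons)

lemma lift_inv_Nil [simp]: "lift_inv [] = mat 1"
  by (simp add: lift_inv_def)

lemma G_lift_inv: "set is \<subseteq> {1..n} \<Longrightarrow> lift_inv is \<in> G"
  by (induction "is") (simp_all add: lift_inv_Cons mult_closed G_refl_inv)

lemma matrix_inv_eqI:
  fixes A B :: "'v cmat"
  assumes "A ** B = mat 1" "B ** A = mat 1"
  shows "matrix_inv A = B"
  unfolding matrix_inv_def
proof (rule some_equality)
  fix C assume "A ** C = mat 1 \<and> C ** A = mat 1"
  then have "C ** (A ** B) = B" by (simp add: matrix_mul_assoc)
  then show "C = B" using assms(1) by simp
qed (use assms in simp)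

lemma matrix_inv_lift: "matrix_inv (mat_prod (map (refl_lift e f) is)) = lift_inv is"
proof (rule matrix_inv_eqI)
  show "mat_prod (map (refl_lift e f) is) ** lift_inv is = mat 1"
  proof (induction "is")
    case (Cons i "is")
    have "refl_lift e f i ** mat_prod (map (refl_lift e f) is) ** (lift_inv is ** refl_inv i) =
        refl_lift e f i ** (mat_prod (map (refl_lift e f) is) ** lift_inv is) ** refl_inv i"
      by (simp add: matrix_mul_assoc)
    then show ?case by (simp add: Cons lift_inv_Cons mat_prod_Cons refl_lift_inv)
  qed simp
  show "lift_inv is ** mat_prod (map (refl_lift e f) is) = mat 1"
  proof (induction "is")
    case (Cons i "is")
    have "lift_inv is ** refl_inv i ** (refl_lift e f i ** mat_prod (map (refl_lift e f) is)) =
        lift_inv is ** (refl_inv i ** refl_lift e f i) ** mat_prod (map (refl_lift e f) is)"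
      by (simp add: matrix_mul_assoc)
    then show ?case by (simp add: Cons lift_inv_Cons mat_prod_Cons refl_lift_inv)
  qed simp
qed

text \<open>No sign appears because each letter of a reduced word lowers or fixes the weight it acts on.\<close>

lemma phi_lift_inv:
  assumes "ascending n is" "S \<subseteq> {1..n}"
  shows "phi S (lift_inv is) = (if S = negs n (wacts n is (rvec n)) then 1 else 0)"
  using assms
proof (induction "is" arbitrary: S)
  case Nil
  then show ?case by (simp add: phi_one negs_rvec)
next
  case (Cons i "is")
  note S = Cons.prems(2)
  let ?x = "wacts n is (rvec n)"
  have asc: "ascending n is" "i \<in> {1..n}" "ascent n ?x i" using ascending_Cons[OF Cons.prems(1)] by auto
  have G: "lift_inv is \<in> G" using asc(1) by (intro G_lift_inv) (simp add: ascending_def)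
  note IH = Cons.IH[OF asc(1)]
  note N = negs_wact[OF asc(2,3)] and nsub = negs_subset[of n ?x]
  note phi = phi_refl_inv[OF S asc(2) G]
  consider "raisable n i S" | "lowerable n i S" | "\<not> raisable n i S" "\<not> lowerable n i S" by blast
  then show ?case
  proof cases
    case 1
    have "S = negs n (wact n i ?x) \<longleftrightarrow> raised n i S = negs n ?x"
      using N 1 lowered_raised[OF 1] lowerable_raised[OF 1] raised_lowered[of n i "negs n ?x"] by auto
    then show ?thesis using 1 phi IH[OF raised_subset[OF S 1]] by (simp add: lift_inv_Cons)
  next
    case 2
    have "S \<noteq> negs n (wact n i ?x)"
      using N 2 raisable_lowered[of n i "negs n ?x"] lowerable_not_raisable[of n i S] by auto
    \<comment> \<open>The term with the sign -1 is evaluated at a raisable set. An ascent excludes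
      such a set as the previous state, so this term vanishes.\<close>
    moreover have "lowered n i S \<noteq> negs n ?x" using raisable_lowered[OF 2] N(1) by auto
    ultimately show ?thesis
      using 2 phi IH[OF lowered_subset[OF S asc(2)]] lowerable_not_raisable[OF 2] by (simp add: lift_inv_Cons)
  next
    case 3
    have "S = negs n (wact n i ?x) \<longleftrightarrow> S = negs n ?x"
      using N 3 raisable_lowered[of n i "negs n ?x"] by auto
    then show ?thesis using 3 phi IH[OF S] by (simp add: lift_inv_Cons)
  qed
qed

end

theorem theorem8p9:
  fixes n :: nat
    and e f h :: "nat \<Rightarrow> complex^'v::finite^'v"
    and \<Delta> :: "complex^'v^'v \<Rightarrow> complex"
    and c :: "nat \<Rightarrow> nat \<Rightarrow> complex"
  assumes "n \<ge> 2"
    and "simply_connected_B n e f h"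
    and "is_principal_minor n e f h n \<Delta>"
    and "\<And>m i. m \<in> {1..n} \<Longrightarrow> i \<in> {1..n} \<Longrightarrow> c m i \<noteq> 0"
  shows "gen_minor n e f \<Delta> (longest_elt n \<circ> simple_refl n n) id (Theta_minus n f h c) =
         (\<Sum>\<delta>\<in>triangles n - {lowest_triangle n}. tri_monomial_bar n \<delta> c)"
proof -
  interpret simply_connected_chevalley_B n e f h
    using assms(1,2) by unfold_locales (auto simp: simply_connected_B_def)
  obtain q where q: "q \<in> mat_polynomials" "\<And>g. g \<in> G \<Longrightarrow> \<Delta> g = q g"
    using assms(3) unfolding is_principal_minor_def regular_on_def by blast
  interpret spin_minor n e f h q
  proof
    fix u t v assume "u \<in> Um" "t \<in> T" "v \<in> Up"
    moreover from this have "u ** t ** v \<in> G" by (simp add: mult_closed Um_G T_G Up_G)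
    ultimately show "q (u ** t ** v) = fund_weight n h n t"
      using assms(3) q(2) unfolding is_principal_minor_def by metis
  qed (rule q(1))
  let ?w = "longest_elt n \<circ> simple_refl n n"
  define ws where "ws = (SOME is. reduced_expr n ?w is)"
  have ws: "ascending n ws" "negs n (wacts n ws (rvec n)) = {1..<n}"
    using reduced_expr_longest_refl[of n] assms(1) unfolding ws_def by simp_all
  have G: "lift_inv ws \<in> G" using ws(1) by (intro G_lift_inv) (simp add: ascending_def)
  have "Theta_minus n f h c = y_sweeps c n" by (simp add: Theta_minus_def y_sweeps_def)
  then have "lift_inv ws ** Theta_minus n f h c \<in> G" using G by (simp add: mult_closed G_y_sweeps)
  \<comment> \<open>The only reduced word of the identity is empty, so the right lift is the unit
    matrix and only the inverse of the left lift remains.\<close>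
  then have "gen_minor n e f \<Delta> ?w id (Theta_minus n f h c) = q (lift_inv ws ** Theta_minus n f h c)"
    using q(2) by (simp add: gen_minor_def weyl_lift_def reduced_expr_id matrix_inv_lift flip: ws_def)
  also have "\<dots> = (\<Sum>\<delta>\<in>triangles n - {lowest_triangle n}. tri_monomial_bar n \<delta> c)"
    using phi_lift_inv[OF ws(1)] ws(2) assms(4) by (intro phi_Theta G) simp_all
  finally show ?thesis .
qed

end
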